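(* Let $v\in\mathrm{RV}_\gamma$ for some $\gamma>0$ and put $\ell(t)=t^{-\gamma}v(t)$. Assume that for every function $\epsilon(t)>0$ with $\epsilon(t)\to0$ as $t\to\infty$, $$\log(t)\Big(\frac{\ell([1+\epsilon(t)]t)}{\ell(t)}-1\Big)\to0\qquad\text{as }t\to\infty .$$ Let $X_1,X_2,\ldots$ be independent exponential random variables with mean $1$, let $$M_n^*=\max_{i=1,\ldots,n}\{v(i)X_i\},\qquad \tau_n^*=\min\{i=1,\ldots,n: v(i)X_i=M_n^*\},$$ and put $\beta_n=\log(n/\gamma)-\log\log(n)$. Then: (i) $\big(\frac{M_n^*}{v(n)}-\beta_n,\ \frac{n-\tau_n^*}{n}\log n\big)\to(G,E_\gamma)$ in distribution as $n\to\infty$, where $G,E_\gamma$ are independent, $G$ is Gumbel and $E_\gamma$ is exponential with rate $\gamma$. (ii) The point process on $(-\infty,\infty]^2$ consisting of the points $\big(\frac{v(i)X_i}{v(n)}-\beta_n,\ \frac{n-i}{n}\log n\big)$, $i=1,2,\ldots$, converges in distribution as $n\to\infty$ to the Poisson point process with mean measure $\hat\mu(\mathrm dx,\mathrm dz)=e^{-x}\,\mathrm dx\times\gamma e^{-\gamma z}\,\mathrm dz$.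
   Context: $\mathrm{RV}_\rho$ ($\rho\in\mathbb R$) denotes the set of measurable functions $f:(0,\infty)\to(0,\infty)$ with $f(ut)/f(t)\to u^\rho$ as $t\to\infty$ for every $u>0$. The Gumbel distribution has distribution function $\exp(-e^{-x})$, $x\in\mathbb R$. The measure $\hat\mu$ is carried by $\mathbb R^2$. The space $(-\infty,\infty]^2$ is the Euclidean plane compactified at $+\infty$ in each coordinate, so that the sets $[x,\infty]\times[z,\infty]$, $x,z\in\mathbb R$, are compact. Convergence in distribution of point processes is with respect to the vague topology on the space of Radon measures on $(-\infty,\infty]^2$. *)

theory Defs
  imports "HOL-Probability.Probability"
begin

definition regularly_varying :: "real \<Rightarrow> (real \<Rightarrow> real) \<Rightarrow> bool" where
  "regularly_varying \<rho> f \<longleftrightarrow>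
     f \<in> borel_measurable (restrict_space borel {0<..}) \<and> (\<forall>t>0. f t > 0) \<and>
     (\<forall>u>0. ((\<lambda>t. f (u * t) / f t) \<longlongrightarrow> u powr \<rho>) at_top)"

definition borel_of :: "'a topology \<Rightarrow> 'a measure" where
  "borel_of T = sigma (topspace T) {U. openin T U}"

(* The random elements X n need only be well defined (measurable) from some n on. *)
definition converges_in_distribution ::
    "'b topology \<Rightarrow> 'a measure \<Rightarrow> (nat \<Rightarrow> 'a \<Rightarrow> 'b) \<Rightarrow> 'c measure \<Rightarrow> ('c \<Rightarrow> 'b) \<Rightarrow> bool" where
  "converges_in_distribution T M X M' Y \<longleftrightarrow>
     (\<forall>\<^sub>F n in sequentially. X n \<in> measurable M (borel_of T)) \<and>
     Y \<in> measurable M' (borel_of T) \<and>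
     (\<forall>F. continuous_map T euclideanreal F \<and> bounded (F ` topspace T) \<longrightarrow>
        (\<lambda>n. \<integral>\<omega>. F (X n \<omega>) \<partial>M) \<longlonglongrightarrow> (\<integral>\<omega>. F (Y \<omega>) \<partial>M'))"

(* Intended for locally compact second countable E, where every Borel measure that is finite
   on compact sets is automatically inner and outer regular (Radon). *)
definition radon_measures :: "'a::topological_space set \<Rightarrow> 'a measure set" where
  "radon_measures E = {\<mu>. sets \<mu> = sets (restrict_space borel E) \<and>
     (\<forall>K. compact K \<and> K \<subseteq> E \<longrightarrow> emeasure \<mu> K < \<infinity>)}"

definition compactly_supported :: "'a::topological_space set \<Rightarrow> ('a \<Rightarrow> real) set" where
  "compactly_supported E = {f. continuous_on E f \<and>
     (\<exists>K. compact K \<and> K \<subseteq> E \<and> (\<forall>x\<in>E - K. f x = 0))}"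

definition vague_topology :: "'a::topological_space set \<Rightarrow> 'a measure topology" where
  "vague_topology E = topology_generated_by
     {{\<mu> \<in> radon_measures E. (\<integral>x. f x \<partial>\<mu>) \<in> U} | f U. f \<in> compactly_supported E \<and> open U}"

definition poisson_process ::
    "'a::topological_space set \<Rightarrow> 'a measure \<Rightarrow> 'c measure \<Rightarrow> ('c \<Rightarrow> 'a measure) \<Rightarrow> bool" where
  "poisson_process E \<mu> M N \<longleftrightarrow>
     N \<in> measurable M (borel_of (vague_topology E)) \<and>
     (\<forall>A \<in> sets (restrict_space borel E).
        (emeasure \<mu> A < \<infinity> \<longrightarrow>
           (\<forall>k::nat. measure M {\<omega> \<in> space M. emeasure (N \<omega>) A = of_nat k} =
              exp (- measure \<mu> A) * measure \<mu> A ^ k / fact k)) \<and>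
        (emeasure \<mu> A = \<infinity> \<longrightarrow> (AE \<omega> in M. emeasure (N \<omega>) A = \<infinity>))) \<and>
     (\<forall>(A :: nat \<Rightarrow> 'a set) m. (\<forall>i<m. A i \<in> sets (restrict_space borel E)) \<and>
        disjoint_family_on A {..<m} \<longrightarrow>
        prob_space.indep_vars M (\<lambda>_. borel) (\<lambda>i \<omega>. emeasure (N \<omega>) (A i)) {..<m})"

(* The counting measure of the points p i (i in I), with multiplicity:
   the image of counting measure on I under p. *)
definition point_measure_of ::
    "'a::topological_space set \<Rightarrow> nat set \<Rightarrow> (nat \<Rightarrow> 'a) \<Rightarrow> 'a measure" where
  "point_measure_of E I p = distr (count_space I) (restrict_space borel E) p"

(* (-\<infinity>,\<infinity>]^2; in the order topology of ereal the sets [x,\<infinity>] x [z,\<infinity>] are compact. *)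
definition upper_plane :: "(ereal \<times> ereal) set" where
  "upper_plane = {-\<infinity><..} \<times> {-\<infinity><..}"

(* e^{-x} dx x \<gamma> e^{-\<gamma> z} dz on all of R^2, transported to (-\<infinity>,\<infinity>]^2. *)
definition mu_hat :: "real \<Rightarrow> (ereal \<times> ereal) measure" where
  "mu_hat \<gamma> = distr
     (density lborel (\<lambda>x::real. ennreal (exp (- x))) \<Otimes>\<^sub>M
      density lborel (\<lambda>z::real. ennreal (\<gamma> * exp (- \<gamma> * z))))
     (restrict_space borel upper_plane) (\<lambda>(x, z). (ereal x, ereal z))"

definition beta :: "real \<Rightarrow> nat \<Rightarrow> real" where
  "beta \<gamma> n = ln (real n / \<gamma>) - ln (ln (real n))"

definition Mstar :: "(real \<Rightarrow> real) \<Rightarrow> (nat \<Rightarrow> 'a \<Rightarrow> real) \<Rightarrow> nat \<Rightarrow> 'a \<Rightarrow> real" where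
  "Mstar v X n \<omega> = Max ((\<lambda>i. v (real i) * X i \<omega>) ` {1..n})"

definition taustar :: "(real \<Rightarrow> real) \<Rightarrow> (nat \<Rightarrow> 'a \<Rightarrow> real) \<Rightarrow> nat \<Rightarrow> 'a \<Rightarrow> nat" where
  "taustar v X n \<omega> = Min {i \<in> {1..n}. v (real i) * X i \<omega> = Mstar v X n \<omega>}"

end

theory Submission
  imports Defs "HOL-Real_Asymp.Real_Asymp"
begin

text \<open>
  In the coordinates \<open>u = exp (- x)\<close>, \<open>w = exp (- \<gamma> z)\<close> the space \<open>(-\<infinity>,\<infinity>]\<^sup>2\<close> becomes the closed
  quadrant and the limiting intensity becomes Lebesgue measure. The points of the prelimit process
  are independent, and the second coordinate of each is deterministic, so everything rests on one
  computation: the expected number of points with \<open>u < a\<close> and \<open>w < b\<close> tends to \<open>a b\<close>, while each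
  single point lies in such a box with a probability tending to 0 uniformly.

  That computation is \<open>tail_sum_limit\<close>. Up to the factor \<open>exp (- x)\<close>, the probability that the
  \<open>i\<close>-th point exceeds \<open>x\<close> is about the mesh \<open>ln n / n\<close> times \<open>\<gamma> exp (- ln n (v n / v i - 1))\<close>, so the sum
  over \<open>i\<close> is a Riemann sum in the rescaled time \<open>s = (n - i) / n \<cdot> ln n\<close>. The assumption on \<open>l\<close>
  says that \<open>l\<close> changes by a factor \<open>1 + o(1 / ln n)\<close> over distances \<open>o(n)\<close>; hence the exponent
  tends to \<open>- \<gamma> s\<close> (\<open>weight_ratio_limit\<close>). Iterating the assumption over geometric steps gives an
  exponent of at most \<open>C - c s\<close> over the whole range of \<open>i\<close> (\<open>weight_ratio_lower\<close>), so dominated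
  convergence applies and the sum tends to the integral of \<open>\<gamma> exp (- x - \<gamma> s)\<close>.

  Independence then gives the probability of seeing no point in a finite union of dyadic cells, and
  inclusion-exclusion the probability of every pattern of empty and occupied cells
  (\<open>hit_pattern_limit\<close>). Two points in one cell are so rare that these patterns determine the limit,
  as in Kallenberg's criterion for simple point processes: a vaguely open set contains, with each of
  its measures, all measures with the same cell counts at every fine enough level
  (\<open>vague_open_agree\<close>), so the lower bound of the portmanteau theorem for open sets can be read off
  from the patterns (\<open>points_limit\<close>). The same lower bound for the maximum and its time follows from
  the pattern in which one cell is occupied and every cell that could contain a higher point is
  empty (\<open>maximum_and_time_limit\<close>).
\<close>

section \<open>Slow variation at logarithmic rate\<close>

text \<open>
  A hypothesis about every null function \<open>\<epsilon>\<close> is a uniform statement in disguise: if the bound failed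
  for all \<open>\<delta>\<close> and \<open>T\<close>, the counterexamples \<open>(t k, e k)\<close> with \<open>t k \<rightarrow> \<infinity>\<close> and \<open>e k \<rightarrow> 0\<close> could be
  collected into one null function for which the hypothesis fails.
\<close>
lemma slow_variation_uniform:
  fixes l :: "real \<Rightarrow> real"
  assumes slow: "\<And>\<epsilon> :: real \<Rightarrow> real. (\<forall>t>0. \<epsilon> t > 0) \<Longrightarrow> (\<epsilon> \<longlongrightarrow> 0) at_top \<Longrightarrow>
           ((\<lambda>t. ln t * (l ((1 + \<epsilon> t) * t) / l t - 1)) \<longlongrightarrow> 0) at_top"
    and "\<eta> > 0"
  shows "\<exists>\<delta>>0. \<exists>T>1. \<forall>t\<ge>T. \<forall>e. 0 < e \<and> e < \<delta> \<longrightarrow> \<bar>ln t * (l ((1 + e) * t) / l t - 1)\<bar> \<le> \<eta>"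
proof (rule ccontr)
  assume neg: "\<not> ?thesis"
  have "\<exists>t e. t \<ge> real k + 2 \<and> 0 < e \<and> e < 1 / (real k + 1) \<and>
      \<bar>ln t * (l ((1 + e) * t) / l t - 1)\<bar> > \<eta>" for k
  proof -
    have "(0::real) < 1 / (real k + 1)" "real k + 2 > 1" by simp_all
    with neg show ?thesis by (meson not_less)
  qed
  then obtain t e where te: "\<And>k. t k \<ge> real k + 2" "\<And>k. 0 < e k" "\<And>k. e k < 1 / (real k + 1)"
      "\<And>k. \<bar>ln (t k) * (l ((1 + e k) * t k) / l (t k) - 1)\<bar> > \<eta>"
    by metis
  \<comment> \<open>Different \<open>k\<close> may share the value \<open>t k\<close>; any choice will do, since \<open>t k\<close> exceeds \<open>k\<close> and so
    large arguments come from large indices only.\<close>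
  define \<kappa> where "\<kappa> s = (SOME k. t k = s)" for s
  define \<epsilon> where "\<epsilon> s = (if s \<in> range t then e (\<kappa> s) else 1 / s)" for s
  have \<kappa>: "t (\<kappa> s) = s" if "s \<in> range t" for s
    unfolding \<kappa>_def using that by (metis (mono_tags) rangeE someI)
  have "(\<epsilon> \<longlongrightarrow> 0) at_top"
  proof (rule tendstoI)
    fix r :: real assume r: "r > 0"
    obtain K :: nat where K: "1 / r < real K" using reals_Archimedean2 by blast
    show "\<forall>\<^sub>F s in at_top. dist (\<epsilon> s) 0 < r"
      unfolding eventually_at_top_linorder
    proof (intro exI allI impI)
      fix s assume s: "Max (insert (1 / r + 1) (t ` {..K})) + 1 \<le> s"
      then have s1: "s > 1 / r + 1" and s2: "\<And>k. k \<le> K \<Longrightarrow> t k < s"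
        by (smt (verit) Max_ge finite_imageI finite_insert finite_atMost insertI1,
            smt (verit) Max_ge finite_imageI finite_insert finite_atMost insertI2 imageI atMost_iff)
      have "s > 0" using s1 r by (smt (verit) divide_pos_pos)
      show "dist (\<epsilon> s) 0 < r"
      proof (cases "s \<in> range t")
        case True
        then have "\<kappa> s > K" using \<kappa> s2 by (metis less_irrefl not_le)
        then have "e (\<kappa> s) < 1 / (real K + 1)"
          using te(3)[of "\<kappa> s"] by (smt (verit) frac_le of_nat_0_le_iff of_nat_less_iff)
        also have "\<dots> < r" using K r by (simp add: field_simps)
        finally show ?thesis using True te(2)[of "\<kappa> s"] by (simp add: \<epsilon>_def)
      next
        case False
        have "1 / s < r" using s1 r \<open>s > 0\<close> by (simp add: field_simps)
        then show ?thesis using False \<open>s > 0\<close> by (simp add: \<epsilon>_def)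
      qed
    qed
  qed
  moreover have "\<forall>t>0. \<epsilon> t > 0" using te(2) by (simp add: \<epsilon>_def)
  ultimately have lim: "((\<lambda>t. ln t * (l ((1 + \<epsilon> t) * t) / l t - 1)) \<longlongrightarrow> 0) at_top"
    by (rule slow[rotated])
  have "filterlim t at_top sequentially"
  proof (rule filterlim_at_top_mono)
    show "filterlim (\<lambda>k. real k) at_top sequentially" by (rule filterlim_real_sequentially)
    show "\<forall>\<^sub>F k in sequentially. real k \<le> t k" using te(1) by (intro always_eventually) (smt (verit))
  qed
  then have "(\<lambda>k. ln (t k) * (l ((1 + \<epsilon> (t k)) * t k) / l (t k) - 1)) \<longlonglongrightarrow> 0"
    using filterlim_compose[OF lim] by blast
  then have "\<forall>\<^sub>F k in sequentially. \<bar>ln (t k) * (l ((1 + \<epsilon> (t k)) * t k) / l (t k) - 1)\<bar> < \<eta>"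
    using \<open>\<eta> > 0\<close> by (drule_tac tendstoD[where e=\<eta>]) (auto simp: dist_real_def)
  then obtain k where "\<bar>ln (t k) * (l ((1 + \<epsilon> (t k)) * t k) / l (t k) - 1)\<bar> < \<eta>"
    by (auto simp: eventually_sequentially)
  moreover have "\<epsilon> (t k) = e (\<kappa> (t k))" by (simp add: \<epsilon>_def)
  moreover have "t (\<kappa> (t k)) = t k" by (rule \<kappa>) simp
  ultimately show False using te(4)[of "\<kappa> (t k)"] by simp
qed

text \<open>
  In terms of \<open>ln l\<close> the increments add up, which the iteration in the next lemma needs.
\<close>
lemma slow_variation_ln:
  fixes l :: "real \<Rightarrow> real"
  assumes pos: "\<And>t. t > 0 \<Longrightarrow> l t > 0"
    and slow: "\<And>\<epsilon> :: real \<Rightarrow> real. (\<forall>t>0. \<epsilon> t > 0) \<Longrightarrow> (\<epsilon> \<longlongrightarrow> 0) at_top \<Longrightarrow>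
           ((\<lambda>t. ln t * (l ((1 + \<epsilon> t) * t) / l t - 1)) \<longlongrightarrow> 0) at_top"
    and "\<eta> > 0"
  shows "\<exists>\<delta>>0. \<exists>T>1. \<forall>t\<ge>T. \<forall>u. 1 \<le> u \<and> u \<le> 1 + \<delta> \<longrightarrow> \<bar>ln (l (u * t)) - ln (l t)\<bar> \<le> \<eta> / ln t"
proof -
  obtain \<delta> T where \<delta>: "\<delta> > 0" "T > 1" and
    b: "\<And>t e. t \<ge> T \<Longrightarrow> 0 < e \<Longrightarrow> e < \<delta> \<Longrightarrow> \<bar>ln t * (l ((1 + e) * t) / l t - 1)\<bar> \<le> \<eta> / 2"
    using slow_variation_uniform[OF slow half_gt_zero[OF \<open>\<eta> > 0\<close>]] by blast
  define T' where "T' = max T (exp \<eta>)"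
  have "\<bar>ln (l (u * t)) - ln (l t)\<bar> \<le> \<eta> / ln t" if t: "t \<ge> T'" and u: "1 \<le> u" "u \<le> 1 + \<delta> / 2" for t u
  proof (cases "u = 1")
    case True
    then show ?thesis using \<open>\<eta> > 0\<close> \<delta> t by (simp add: T'_def)
  next
    case False
    have t1: "t > 1" "t \<ge> T" "ln t \<ge> \<eta>"
      using t \<delta> by (auto simp: T'_def ln_ge_iff)
    then have lt: "ln t > 0" by simp
    define r where "r = l (u * t) / l t - 1"
    have "\<bar>ln t * r\<bar> \<le> \<eta> / 2" using b[of t "u - 1"] t1 u False \<delta> by (simp add: r_def)
    then have r: "\<bar>r\<bar> \<le> \<eta> / 2 / ln t" using lt by (simp add: abs_mult field_simps)
    also have "\<dots> \<le> 1 / 2" using t1 lt by (simp add: field_simps)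
    finally have r2: "\<bar>r\<bar> \<le> 1 / 2" .
    have "\<bar>ln (1 + r)\<bar> \<le> 2 * \<bar>r\<bar>"
    proof (cases "r \<ge> 0")
      case True
      then show ?thesis using ln_add_one_self_le_self[of r] by simp
    next
      case neg: False
      have "ln (1 + r) \<ge> r - 2 * r\<^sup>2"
        using ln_one_minus_pos_lower_bound[of "- r"] neg r2 by simp
      moreover have "2 * r\<^sup>2 \<le> - r"
        using neg r2 mult_left_mono[of "- r" "1 / 2" "- r"] by (simp add: power2_eq_square)
      moreover have "ln (1 + r) \<le> 0" using neg r2 by simp
      ultimately show ?thesis using neg by simp
    qed
    moreover have "ln (1 + r) = ln (l (u * t)) - ln (l t)"
      using pos[of t] pos[of "u * t"] t1 u by (simp add: r_def ln_div)
    ultimately have "\<bar>ln (l (u * t)) - ln (l t)\<bar> \<le> 2 * (\<eta> / 2 / ln t)"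
      using r by simp
    then show ?thesis by simp
  qed
  moreover have "\<delta> / 2 > 0" "T' > 1" using \<delta> by (auto simp: T'_def)
  ultimately show ?thesis by blast
qed

text \<open>
  A distance \<open>w > 1 + \<delta>\<close> is covered by about \<open>ln w / ln (1 + \<delta>)\<close> steps of ratio at most \<open>1 + \<delta>\<close>, and
  each step costs at most \<open>\<eta> / ln t\<close> because its base point is at least \<open>t\<close>.
\<close>
lemma slow_variation_iterate:
  fixes l :: "real \<Rightarrow> real"
  assumes step: "\<And>t u. t \<ge> T \<Longrightarrow> 1 \<le> u \<Longrightarrow> u \<le> 1 + \<delta> \<Longrightarrow> \<bar>ln (l (u * t)) - ln (l t)\<bar> \<le> \<eta> / ln t"
    and "\<delta> > 0" "T > 1" "\<eta> > 0" and t: "t \<ge> T" and w: "w \<ge> 1"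
  shows "\<bar>ln (l (w * t)) - ln (l t)\<bar> \<le> \<eta> / ln t * (1 + ln w / ln (1 + \<delta>))"
proof -
  have lt: "ln t > 0" and t0: "t > 0" using assms by auto
  have it: "\<bar>ln (l (w * t)) - ln (l t)\<bar> \<le> real k * (\<eta> / ln t)" if "1 \<le> w" "w \<le> (1 + \<delta>) ^ k" for k w
    using that
  proof (induction k arbitrary: w)
    case 0
    then show ?case by simp
  next
    case (Suc k)
    \<comment> \<open>The first step starts at \<open>w' t\<close> and has ratio \<open>u\<close>; the remaining ratio \<open>w'\<close> is left to the
      induction hypothesis.\<close>
    define u where "u = min w (1 + \<delta>)"
    define w' where "w' = w / u"
    have u: "1 \<le> u" "u \<le> 1 + \<delta>" "u \<le> w"
      using Suc.prems \<open>\<delta> > 0\<close> by (auto simp: u_def)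
    have pw: "1 \<le> (1 + \<delta>) ^ k" using \<open>\<delta> > 0\<close> by (intro one_le_power) simp
    have w': "1 \<le> w'" "w' \<le> (1 + \<delta>) ^ k"
      using Suc.prems \<open>\<delta> > 0\<close> pw u by (auto simp: w'_def u_def min_def field_simps)
    have wt: "w' * t \<ge> t" using w' t0 by simp
    have "\<bar>ln (l (u * (w' * t))) - ln (l (w' * t))\<bar> \<le> \<eta> / ln (w' * t)"
      using u wt t by (intro step) auto
    also have "\<dots> \<le> \<eta> / ln t"
    proof (rule divide_left_mono)
      show "ln t \<le> ln (w' * t)" using wt t0 by simp
      then show "0 < ln (w' * t) * ln t" using lt by simp
    qed (use \<open>\<eta> > 0\<close> in simp)
    finally have "\<bar>ln (l (w * t)) - ln (l (w' * t))\<bar> \<le> \<eta> / ln t"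
      using u by (simp add: w'_def)
    moreover have "real (Suc k) * (\<eta> / ln t) = real k * (\<eta> / ln t) + \<eta> / ln t"
      by (simp add: ring_distribs add_divide_distrib)
    ultimately show ?case using Suc.IH[OF w'] by linarith
  qed
  define k where "k = nat \<lceil>ln w / ln (1 + \<delta>)\<rceil>"
  have ld: "ln (1 + \<delta>) > 0" using \<open>\<delta> > 0\<close> by simp
  have lw: "ln w \<ge> 0" using w by simp
  have q: "0 \<le> ln w / ln (1 + \<delta>)" using ld lw by simp
  have k1: "real k \<ge> ln w / ln (1 + \<delta>)" unfolding k_def by (rule real_nat_ceiling_ge)
  have k2: "real k \<le> 1 + ln w / ln (1 + \<delta>)" unfolding k_def using q by linarith
  have "ln w \<le> real k * ln (1 + \<delta>)" using k1 ld by (simp add: field_simps)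
  also have "\<dots> = ln ((1 + \<delta>) ^ k)" using \<open>\<delta> > 0\<close> by (simp add: ln_realpow)
  finally have "w \<le> (1 + \<delta>) ^ k" using w \<open>\<delta> > 0\<close> by simp
  from it[OF w this] have "\<bar>ln (l (w * t)) - ln (l t)\<bar> \<le> real k * (\<eta> / ln t)" .
  also have "\<dots> \<le> (1 + ln w / ln (1 + \<delta>)) * (\<eta> / ln t)"
    using k2 lt \<open>\<eta> > 0\<close> by (intro mult_right_mono) auto
  finally show ?thesis by (simp add: mult.commute)
qed

section \<open>Ratios of weights near and far from the last index\<close>

text \<open>
  The rescaled time of index \<open>i\<close>, the second coordinate of the \<open>i\<close>-th point. For \<open>n \<ge> 2\<close> it
  decreases in \<open>i\<close>, and it vanishes at \<open>i = n\<close>.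
\<close>
definition position :: "nat \<Rightarrow> nat \<Rightarrow> real" where
  "position n i = (real n - real i) / real n * ln (real n)"

locale slow_weights =
  fixes v l :: "real \<Rightarrow> real" and \<gamma> :: real
  assumes gamma_pos: "\<gamma> > 0"
    and v_pos: "t > 0 \<Longrightarrow> v t > 0"
    and l_eq: "t > 0 \<Longrightarrow> l t = t powr (- \<gamma>) * v t"
    and slow: "(\<forall>t>0. \<epsilon> t > 0) \<Longrightarrow> (\<epsilon> \<longlongrightarrow> 0) at_top \<Longrightarrow>
           ((\<lambda>t. ln t * (l ((1 + \<epsilon> t) * t) / l t - 1)) \<longlongrightarrow> 0) at_top"
begin

lemma l_pos: "t > 0 \<Longrightarrow> l t > 0"
  using l_eq v_pos by simp

lemma ln_v: "t > 0 \<Longrightarrow> ln (v t) = ln (l t) + \<gamma> * ln t"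
  using l_eq[of t] v_pos[of t] by (simp add: ln_mult ln_powr)

text \<open>
  Lower bounds on \<open>v x / v y - 1\<close> may be proved for the difference of logarithms, which is additive.
\<close>
lemma weight_ratio_ge_ln_diff:
  assumes "x > 0" "y > 0" shows "v x / v y - 1 \<ge> ln (v x) - ln (v y)"
  using ln_le_minus_one[of "v x / v y"] v_pos[OF assms(1)] v_pos[OF assms(2)] by (simp add: ln_div)

text \<open>
  This linear lower bound supplies the dominating function of the Riemann sum. It is uniform over the
  whole range of \<open>i\<close>, and its proof distinguishes four regimes: bounded \<open>i\<close>, where \<open>v n \<rightarrow> \<infinity>\<close>
  suffices; \<open>i\<close> below \<open>\<surd>n\<close>, where \<open>ln (n / i)\<close> is of order \<open>ln n\<close> and outweighs the slowly varying
  factor; \<open>i\<close> between \<open>\<surd>n\<close> and \<open>n\<close>, where \<open>1 / ln i\<close> is of order \<open>1 / ln n\<close>; and the indices slightly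
  above \<open>n\<close>, which are within the reach of a single step.
\<close>
lemma weight_ratio_lower:
  "\<exists>c>0. \<exists>C. \<forall>\<^sub>F n in sequentially. \<forall>i\<ge>1. z < position n i \<longrightarrow>
     ln (real n) * (v (real n) / v (real i) - 1) \<ge> c * position n i - C"
proof -
  obtain \<delta> T where \<delta>: "\<delta> > 0" and T: "T > 1" and
    b: "\<And>t u. t \<ge> T \<Longrightarrow> 1 \<le> u \<Longrightarrow> u \<le> 1 + \<delta> \<Longrightarrow> \<bar>ln (l (u * t)) - ln (l t)\<bar> \<le> 1 / ln t"
    using slow_variation_ln[OF l_pos slow zero_less_one] by blast
  define K where "K = ln (1 + \<delta>)"
  have K: "K > 0" using \<delta> by (simp add: K_def)
  \<comment> \<open>Beyond \<open>T1\<close> the slowly varying factor costs at most half of the exponent \<open>\<gamma>\<close>.\<close>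
  define T1 where "T1 = max T (exp (2 / (K * \<gamma>)))"
  have T1: "T1 > 1" "T1 \<ge> T" "2 / (K * \<gamma>) \<le> ln T1"
    using T by (auto simp: T1_def ln_ge_iff)
  have below: "ln (v n) - ln (v t) \<ge> \<gamma> / 2 * ln (n / t) - 1 / ln t" if "t \<ge> T1" "n \<ge> t" for n t
  proof -
    have t: "t > 1" using that T1 by simp
    then have lt: "ln t > 0" by simp
    have "\<bar>ln (l (n / t * t)) - ln (l t)\<bar> \<le> 1 / ln t * (1 + ln (n / t) / ln (1 + \<delta>))"
      using that T1 T \<delta> t by (intro slow_variation_iterate[OF b]) auto
    note this' = this
    have 1: "ln (l n) - ln (l t) \<ge> - (1 / ln t + (1 / (ln t * K)) * ln (n / t))"
    proof -
      have "n / t * t = n" using t by simp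
      moreover have "1 / ln t * (1 + ln (n / t) / ln (1 + \<delta>)) = 1 / ln t + (1 / (ln t * K)) * ln (n / t)"
        unfolding K_def by (simp add: distrib_left)
      ultimately show ?thesis using this' by (simp only: abs_le_iff) linarith
    qed
    have "2 / (K * \<gamma>) \<le> ln t" using T1 that(1) by (smt (verit) ln_le_cancel_iff)
    then have "1 / (ln t * K) \<le> \<gamma> / 2"
      using K gamma_pos lt by (simp add: field_simps)
    moreover have lnt: "ln (n / t) \<ge> 0" using that t by simp
    ultimately have "(1 / (ln t * K)) * ln (n / t) \<le> \<gamma> / 2 * ln (n / t)"
      by (rule mult_right_mono)
    moreover have "ln (v n) - ln (v t) = ln (l n) - ln (l t) + \<gamma> * ln (n / t)"
      using t that by (simp add: ln_v ln_div algebra_simps)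
    ultimately show ?thesis using 1 by (simp add: algebra_simps)
  qed
  define i0 where "i0 = nat \<lceil>T1\<rceil>"
  have i0: "real i0 \<ge> T1" unfolding i0_def by linarith
  define B where "B = Max ((\<lambda>i. ln (v (real i))) ` {1..i0})"
  have B: "ln (v (real i)) \<le> B" if "1 \<le> i" "i \<le> i0" for i
    unfolding B_def using that by (intro Max_ge) auto
  have tl: "filterlim (\<lambda>n. ln (real n)) at_top sequentially"
    using filterlim_compose[OF ln_at_top filterlim_real_sequentially] .
  have e1: "\<forall>\<^sub>F n in sequentially. n \<ge> i0 + 3" by (rule eventually_ge_at_top)
  have e2: "\<forall>\<^sub>F n in sequentially. ln (real n) \<ge> Q" for Q
    using tl by (auto simp: filterlim_at_top)
  define c where "c = min (\<gamma> / 2) 1"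
  define C where "C = 2 + \<gamma> * \<bar>z\<bar> + 1 + \<bar>z\<bar>"
  have c: "c > 0" "c \<le> 1" "c \<le> \<gamma> / 2" using gamma_pos by (auto simp: c_def)
  have C: "C \<ge> 2 + \<gamma> * \<bar>z\<bar>" "C \<ge> 0" using gamma_pos by (auto simp: C_def)
  have "\<forall>\<^sub>F n in sequentially. \<forall>i\<ge>1. z < position n i \<longrightarrow>
     ln (real n) * (v (real n) / v (real i) - 1) \<ge> c * position n i - C"
    using e1 e2[of 1] e2[of "\<bar>z\<bar> / \<delta>"] e2[of "(1 + 1 / ln T1) / (\<gamma> / 4)"]
      e2[of "ln (real i0) + (B + 1 + 1 / ln (real i0) - ln (v (real i0))) / (\<gamma> / 2)"]
  proof eventually_elim
    case (elim n)
    have n: "real n > 1" "ln (real n) \<ge> 1" using elim by auto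
    have n0: "real n \<ge> real i0" using elim by simp
    show ?case
    proof (intro allI impI)
      fix i :: nat assume i: "i \<ge> 1" and z: "z < position n i"
      have ip: "real i > 0" using i by simp
      let ?D = "ln (v (real n)) - ln (v (real i))"
      have D: "ln (real n) * (v (real n) / v (real i) - 1) \<ge> ln (real n) * ?D"
        using n weight_ratio_ge_ln_diff[of "real n" "real i"] ip by (intro mult_left_mono) auto
      have pos: "position n i \<ge> 0" "position n i \<le> ln (real n)" if "i \<le> n"
        using that n by (auto simp: position_def field_simps)
      have big: "ln (real n) * (v (real n) / v (real i) - 1) \<ge> c * position n i - C" if "?D \<ge> 1" "i \<le> n"
      proof -
        have "ln (real n) * ?D \<ge> ln (real n) * 1" using n that by (intro mult_left_mono) auto
        moreover have "c * position n i \<le> 1 * position n i"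
          using c pos[OF that(2)] by (intro mult_right_mono) auto
        ultimately have "c * position n i - C \<le> ln (real n) * ?D"
          using pos[OF that(2)] C by linarith
        then show ?thesis using D by linarith
      qed
      consider "i \<le> i0" | "i > i0" "i \<le> n" "ln (real i) < ln (real n) / 2"
        | "i > i0" "i \<le> n" "ln (real i) \<ge> ln (real n) / 2" | "i > n" by linarith
      then show "ln (real n) * (v (real n) / v (real i) - 1) \<ge> c * position n i - C"
      proof cases
        case 1
        have "ln (v (real n)) - ln (v (real i0)) \<ge> \<gamma> / 2 * ln (real n / real i0) - 1 / ln (real i0)"
          using i0 n0 by (intro below) auto
        moreover have "\<gamma> / 2 * ln (real n / real i0) \<ge> B + 1 + 1 / ln (real i0) - ln (v (real i0))"
          using elim(5) gamma_pos i0 T1 n by (simp add: ln_div field_simps)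
        ultimately have "?D \<ge> 1" using B[OF i 1] by linarith
        then show ?thesis using big 1 n0 D by (smt (verit) of_nat_le_iff)
      next
        case 2
        have "?D \<ge> \<gamma> / 2 * ln (real n / real i) - 1 / ln (real i)"
          using i0 2 by (intro below) auto
        moreover have "\<gamma> / 2 * ln (real n / real i) \<ge> \<gamma> / 2 * (ln (real n) / 2)"
          using gamma_pos 2 n ip by (intro mult_left_mono) (auto simp: ln_div)
        moreover have "1 / ln (real i) \<le> 1 / ln T1"
          using T1 i0 2 by (intro divide_left_mono mult_pos_pos) auto
        moreover have "\<gamma> / 2 * (ln (real n) / 2) \<ge> 1 + 1 / ln T1"
          using elim(4) gamma_pos by (simp add: field_simps)
        ultimately have "?D \<ge> 1" by linarith
        then show ?thesis using big 2 D by linarith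
      next
        case 3
        have "?D \<ge> \<gamma> / 2 * ln (real n / real i) - 1 / ln (real i)"
          using i0 3 by (intro below) auto
        moreover have "ln (real i) > 0" using 3 n by linarith
        then have "1 / ln (real i) \<le> 2 / ln (real n)"
          using 3 n by (simp add: field_simps)
        moreover have "ln (real n / real i) \<ge> 1 - real i / real n"
          using ln_le_minus_one[of "real i / real n"] ip n by (simp add: ln_div)
        then have "\<gamma> / 2 * ln (real n / real i) \<ge> \<gamma> / 2 * (1 - real i / real n)"
          using gamma_pos by (intro mult_left_mono) auto
        ultimately have "?D \<ge> \<gamma> / 2 * (1 - real i / real n) - 2 / ln (real n)" by linarith
        then have "ln (real n) * ?D \<ge> ln (real n) * (\<gamma> / 2 * (1 - real i / real n) - 2 / ln (real n))"
          using n by (intro mult_left_mono) auto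
        also have "ln (real n) * (\<gamma> / 2 * (1 - real i / real n) - 2 / ln (real n)) = \<gamma> / 2 * position n i - 2"
          using n by (simp add: position_def field_simps)
        finally have "\<gamma> / 2 * position n i - 2 \<le> ln (real n) * ?D" .
        moreover have "c * position n i \<le> \<gamma> / 2 * position n i"
          using c pos 3 by (intro mult_right_mono) auto
        moreover have "C \<ge> 2" using C gamma_pos by (simp add: C_def)
        ultimately show ?thesis using D by linarith
      next
        case 4
        have neg: "position n i < 0" using 4 n by (simp add: position_def mult_neg_pos divide_neg_pos)
        have "position n i = (1 - real i / real n) * ln (real n)"
          using n by (simp add: position_def field_simps)
        then have q: "(real i / real n - 1) * ln (real n) \<le> \<bar>z\<bar>" using z by (simp add: algebra_simps)
        also have "\<bar>z\<bar> \<le> \<delta> * ln (real n)" using elim(3) \<delta> by (simp add: field_simps)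
        finally have "real i / real n \<le> 1 + \<delta>" using n by (simp add: mult_le_cancel_right)
        then have "\<bar>ln (l (real i / real n * real n)) - ln (l (real n))\<bar> \<le> 1 / ln (real n)"
          using 4 n n0 i0 T1 by (intro b) auto
        then have "ln (l (real i)) - ln (l (real n)) \<le> 1 / ln (real n)" using n by simp
        moreover have "ln (real i / real n) \<le> real i / real n - 1"
          using n ip by (intro ln_le_minus_one) auto
        then have "\<gamma> * ln (real i / real n) \<le> \<gamma> * (real i / real n - 1)"
          using gamma_pos by (intro mult_left_mono) auto
        moreover have "- ?D = ln (l (real i)) - ln (l (real n)) + \<gamma> * ln (real i / real n)"
          using n ip by (simp add: ln_v ln_div algebra_simps)
        ultimately have "- ?D \<le> 1 / ln (real n) + \<gamma> * (real i / real n - 1)" by linarith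
        then have "ln (real n) * (- ?D) \<le> ln (real n) * (1 / ln (real n) + \<gamma> * (real i / real n - 1))"
          using n by (intro mult_left_mono) auto
        also have "\<dots> = 1 + \<gamma> * ((real i / real n - 1) * ln (real n))"
          using n by (simp add: algebra_simps)
        also have "\<dots> \<le> 1 + \<gamma> * \<bar>z\<bar>" using q gamma_pos by simp
        finally have "ln (real n) * ?D \<ge> - 1 - \<gamma> * \<bar>z\<bar>"
          unfolding mult_minus_right by linarith
        moreover have "c * position n i \<le> 0" using c neg by (simp add: mult_le_0_iff)
        ultimately show ?thesis using D C by linarith
      qed
    qed
  qed
  then show ?thesis using c by blast
qed

text \<open>
  With \<open>i / n = 1 - x\<close> and \<open>x = s / ln n\<close> the power \<open>(n / i) powr \<gamma>\<close> contributes \<open>\<gamma> s / ln n\<close>, and the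
  assumption on \<open>l\<close> is exactly what makes the slowly varying factor contribute \<open>o(1 / ln n)\<close>.
\<close>
lemma weight_ratio_limit:
  assumes s: "(\<lambda>n. position n (i n)) \<longlonglongrightarrow> s"
  shows "(\<lambda>n. ln (real n) * (v (real n) / v (real (i n)) - 1)) \<longlonglongrightarrow> \<gamma> * s"
proof -
  have tl: "filterlim (\<lambda>n. ln (real n)) at_top sequentially"
    using filterlim_compose[OF ln_at_top filterlim_real_sequentially] .
  have ln_big: "\<forall>\<^sub>F n in sequentially. ln (real n) \<ge> Q" for Q
    using tl by (auto simp: filterlim_at_top)
  have inv0: "(\<lambda>n. inverse (ln (real n))) \<longlonglongrightarrow> 0"
    by (rule tendsto_inverse_0_at_top[OF tl])
  define x where "x n = position n (i n) * inverse (ln (real n))" for n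
  have x0: "x \<longlonglongrightarrow> 0" using tendsto_mult[OF s inv0] by (simp add: x_def[abs_def])
  have nbig: "\<forall>\<^sub>F n in sequentially. real n > 1 \<and> ln (real n) \<ge> 1"
    using ln_big[of 1] eventually_gt_at_top[of 1] by eventually_elim auto
  have xev: "\<forall>\<^sub>F n in sequentially. \<bar>x n\<bar> < e" if "e > 0" for e
    using tendstoD[OF x0 that] by (simp add: dist_real_def)
  have xhalf: "\<forall>\<^sub>F n in sequentially. \<bar>x n\<bar> < 1/2" by (rule xev) simp
  have ratio: "\<forall>\<^sub>F n in sequentially. real (i n) / real n = 1 - x n"
    using nbig by eventually_elim (auto simp: x_def position_def field_simps)
  have ipos: "\<forall>\<^sub>F n in sequentially. real (i n) > 0"
    using ratio nbig xhalf
  proof eventually_elim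
    case (elim n)
    have "real (i n) / real n > 0" using elim(1,3) by linarith
    then show ?case by (simp add: zero_less_divide_iff)
  qed
  have lnr: "(\<lambda>n. ln (real n) * - ln (1 - x n)) \<longlonglongrightarrow> s"
  proof (rule tendsto_sandwich[OF _ _ s])
    show "\<forall>\<^sub>F n in sequentially. position n (i n) \<le> ln (real n) * - ln (1 - x n)"
      using nbig xhalf
    proof eventually_elim
      case (elim n)
      have "ln (1 - x n) \<le> - x n" using ln_le_minus_one[of "1 - x n"] elim by auto
      then have "ln (real n) * x n \<le> ln (real n) * - ln (1 - x n)" using elim by (intro mult_left_mono) auto
      moreover have "ln (real n) * x n = position n (i n)" using elim by (simp add: x_def)
      ultimately show ?case by simp
    qed
    show "\<forall>\<^sub>F n in sequentially. ln (real n) * - ln (1 - x n) \<le> position n (i n) / (1 - x n)"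
      using nbig xhalf
    proof eventually_elim
      case (elim n)
      have "ln (inverse (1 - x n)) \<le> inverse (1 - x n) - 1" using elim by (intro ln_le_minus_one) auto
      also have "\<dots> = x n / (1 - x n)" using elim by (auto simp: field_simps)
      finally have "- ln (1 - x n) \<le> x n / (1 - x n)" using elim by (simp add: ln_inverse)
      then have "ln (real n) * - ln (1 - x n) \<le> ln (real n) * (x n / (1 - x n))"
        using elim by (intro mult_left_mono) auto
      moreover have "ln (real n) * x n = position n (i n)" using elim by (simp add: x_def)
      ultimately show ?case by simp
    qed
    have "(\<lambda>n. position n (i n) / (1 - x n)) \<longlonglongrightarrow> s / (1 - 0)"
      by (intro tendsto_intros s x0) auto
    then show "(\<lambda>n. position n (i n) / (1 - x n)) \<longlonglongrightarrow> s" by simp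
  qed
  define y where "y n = ln (v (real n)) - ln (v (real (i n)))" for n
  define R where "R n = ln (real n) * (ln (l (real n)) - ln (l (real (i n))))" for n
  \<comment> \<open>Depending on whether \<open>i n\<close> is below or above \<open>n\<close>, the increment of \<open>ln l\<close> is taken from the one
    or from the other; either way the base point has logarithm at least \<open>ln n / 2\<close>.\<close>
  have R0: "R \<longlonglongrightarrow> 0"
  proof (rule tendstoI)
    fix e :: real assume e: "e > 0"
    then have e4: "e / 4 > 0" by simp
    obtain \<delta> T where \<delta>: "\<delta> > 0" and T: "T > 1" and
      b: "\<And>t u. t \<ge> T \<Longrightarrow> 1 \<le> u \<Longrightarrow> u \<le> 1 + \<delta> \<Longrightarrow> \<bar>ln (l (u * t)) - ln (l t)\<bar> \<le> (e / 4) / ln t"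
      using slow_variation_ln[OF l_pos slow e4] by blast
    define d where "d = min (1/2) (\<delta> / (1 + \<delta>))"
    have d: "d > 0" "d \<le> 1/2" "d \<le> \<delta> / (1 + \<delta>)"
      unfolding d_def using \<delta> by (simp, intro min.cobounded1, intro min.cobounded2)
    show "\<forall>\<^sub>F n in sequentially. dist (R n) 0 < e"
      using nbig ratio xev[OF d(1)] ln_big[of "2 * ln 2"]
        filterlim_at_top[THEN iffD1, OF filterlim_real_sequentially, rule_format, of "2 * T"]
    proof eventually_elim
      case (elim n)
      have "real (i n) = (1 - x n) * real n" using elim by (simp add: field_simps)
      moreover have "(1 - x n) * real n \<ge> 1 / 2 * real n"
        using elim d by (intro mult_right_mono) auto
      ultimately have i2: "real (i n) \<ge> real n / 2" by simp
      have iT: "real (i n) \<ge> T" using i2 elim by simp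
      have lni: "ln (real (i n)) \<ge> ln (real n) / 2"
      proof -
        have "ln (real n / 2) \<le> ln (real (i n))" using i2 elim by (intro ln_mono) auto
        then show ?thesis using elim by (simp add: ln_div)
      qed
      have "\<bar>ln (l (real n)) - ln (l (real (i n)))\<bar> \<le> (e / 4) / (ln (real n) / 2)"
      proof (cases "i n \<le> n")
        case True
        have "1 / (1 - x n) \<le> 1 + \<delta>"
        proof -
          have "1 - x n \<ge> 1 - \<delta> / (1 + \<delta>)" using elim d by linarith
          also have "1 - \<delta> / (1 + \<delta>) = 1 / (1 + \<delta>)" using \<delta> by (simp add: field_simps)
          finally have "1 - x n \<ge> 1 / (1 + \<delta>)" .
          then show ?thesis using \<delta> elim d by (simp add: field_simps)
        qed
        moreover have "real n / real (i n) = 1 / (1 - x n)"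
          unfolding elim(2)[symmetric] by simp
        ultimately have "real n / real (i n) \<le> 1 + \<delta>" by simp
        then have "\<bar>ln (l (real n / real (i n) * real (i n))) - ln (l (real (i n)))\<bar> \<le> (e / 4) / ln (real (i n))"
          using True iT T by (intro b) auto
        also have "\<dots> \<le> (e / 4) / (ln (real n) / 2)"
          using e lni elim by (intro divide_left_mono mult_pos_pos) auto
        finally show ?thesis using iT T by simp
      next
        case False
        have "\<delta> / (1 + \<delta>) \<le> \<delta>" using \<delta> by (simp add: field_simps)
        then have "real (i n) / real n \<le> 1 + \<delta>" using elim d by linarith
        then have "\<bar>ln (l (real (i n) / real n * real n)) - ln (l (real n))\<bar> \<le> (e / 4) / ln (real n)"
        proof (intro b)
          show "1 \<le> real (i n) / real n" using False elim(1) by simp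
          show "T \<le> real n" using elim T by linarith
        qed
        also have "\<dots> \<le> (e / 4) / (ln (real n) / 2)"
          using e elim by (intro divide_left_mono mult_pos_pos) auto
        finally show ?thesis using elim(1) by (simp add: abs_minus_commute)
      qed
      then have "ln (real n) * \<bar>ln (l (real n)) - ln (l (real (i n)))\<bar> \<le> ln (real n) * ((e / 4) / (ln (real n) / 2))"
        using elim by (intro mult_left_mono) auto
      also have "\<dots> = e / 2" using elim by simp
      finally show ?case using e elim by (simp add: R_def dist_real_def abs_mult)
    qed
  qed
  have yl: "(\<lambda>n. ln (real n) * y n) \<longlonglongrightarrow> \<gamma> * s"
  proof (rule Lim_transform_eventually)
    show "(\<lambda>n. R n + \<gamma> * (ln (real n) * - ln (1 - x n))) \<longlonglongrightarrow> \<gamma> * s"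
      using tendsto_add[OF R0 tendsto_mult[OF tendsto_const[of \<gamma>] lnr]] by simp
    show "\<forall>\<^sub>F n in sequentially. R n + \<gamma> * (ln (real n) * - ln (1 - x n)) = ln (real n) * y n"
      using nbig ratio ipos
    proof eventually_elim
      case (elim n)
      have "ln (1 - x n) = ln (real (i n)) - ln (real n)"
        unfolding elim(2)[symmetric] using elim(1,3) by (simp add: ln_div)
      then show ?case using elim(1,3) by (simp add: R_def y_def ln_v right_diff_distrib distrib_left)
    qed
  qed
  have y0: "y \<longlonglongrightarrow> 0"
  proof (rule Lim_transform_eventually)
    show "(\<lambda>n. ln (real n) * y n * inverse (ln (real n))) \<longlonglongrightarrow> 0"
      using tendsto_mult[OF yl inv0] by simp
    show "\<forall>\<^sub>F n in sequentially. ln (real n) * y n * inverse (ln (real n)) = y n"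
      using nbig by eventually_elim auto
  qed
  have yev: "\<forall>\<^sub>F n in sequentially. \<bar>y n\<bar> < 1/2"
    using tendstoD[OF y0, of "1/2"] by (simp add: dist_real_def)
  show ?thesis
  proof (rule tendsto_sandwich[OF _ _ yl])
    show "\<forall>\<^sub>F n in sequentially. ln (real n) * y n \<le> ln (real n) * (v (real n) / v (real (i n)) - 1)"
      using nbig ipos
      by eventually_elim (auto simp: y_def intro!: mult_left_mono weight_ratio_ge_ln_diff)
    show "\<forall>\<^sub>F n in sequentially. ln (real n) * (v (real n) / v (real (i n)) - 1) \<le> ln (real n) * y n / (1 - y n)"
      using nbig ipos yev
    proof eventually_elim
      case (elim n)
      have "v (real n) / v (real (i n)) = exp (y n)"
        using elim v_pos[of "real n"] v_pos[of "real (i n)"] by (simp add: y_def exp_diff)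
      moreover have "exp (y n) - 1 \<le> y n / (1 - y n)"
      proof -
        have "1 - y n \<le> exp (- y n)" using exp_ge_add_one_self[of "- y n"] by simp
        then have "exp (y n) * (1 - y n) \<le> exp (y n) * exp (- y n)" by (intro mult_left_mono) auto
        then have "exp (y n) * (1 - y n) \<le> 1" by (simp add: exp_minus)
        then show ?thesis using elim by (simp add: field_simps)
      qed
      ultimately have "ln (real n) * (v (real n) / v (real (i n)) - 1) \<le> ln (real n) * (y n / (1 - y n))"
        using elim by (intro mult_left_mono) auto
      then show ?case by simp
    qed
    have "(\<lambda>n. ln (real n) * y n / (1 - y n)) \<longlonglongrightarrow> \<gamma> * s / (1 - 0)"
      by (intro tendsto_intros yl y0) auto
    then show "(\<lambda>n. ln (real n) * y n / (1 - y n)) \<longlonglongrightarrow> \<gamma> * s" by simp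
  qed
qed

end

section \<open>The expected number of points as a Riemann sum\<close>

lemma exponential_tail_integral:
  fixes z k :: real
  assumes "k > 0"
  shows "has_bochner_integral lborel (\<lambda>s. exp (- k * s) * indicator {z..} s) (exp (- k * z) / k)"
proof (rule has_bochner_integral_nn_integral)
  have "(\<integral>\<^sup>+ s. ennreal (exp (- k * s)) * indicator {z..} s \<partial>lborel) = 0 - (- exp (- k * z) / k)"
  proof (rule nn_integral_FTC_atLeast)
    show "((\<lambda>s. - exp (- k * s) / k) \<longlongrightarrow> 0) at_top"
      using \<open>k > 0\<close> by real_asymp
  qed (use \<open>k > 0\<close> in \<open>auto intro!: derivative_eq_intros\<close>)
  then show "(\<integral>\<^sup>+ s. ennreal (exp (- k * s) * indicator {z..} s) \<partial>lborel) = ennreal (exp (- k * z) / k)"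
    by (simp add: ennreal_mult' mult.commute[of k] flip: ennreal_indicator)
qed (use \<open>k > 0\<close> in \<open>auto simp: indicator_def\<close>)

lemma position_order: "n \<ge> 2 \<Longrightarrow> i < j \<Longrightarrow> position n i \<ge> position n j + ln (real n) / real n"
proof -
  assume n: "n \<ge> 2" and ij: "i < j"
  have "real j - real i \<ge> 1" using ij by linarith
  then have "(real j - real i) * (ln (real n) / real n) \<ge> 1 * (ln (real n) / real n)"
    using n by (intro mult_right_mono) auto
  moreover have "position n i - position n j = (real j - real i) * (ln (real n) / real n)"
    by (simp add: position_def diff_divide_distrib algebra_simps)
  ultimately show ?thesis by linarith
qed

text \<open>
  The intervals of length \<open>ln n / n\<close> to the right of the rescaled times are disjoint, so that a sum
  over indices is the integral of a step function.
\<close>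
lemma position_inj: "n \<ge> 2 \<Longrightarrow> position n i \<le> s \<Longrightarrow> s < position n i + ln (real n) / real n \<Longrightarrow>
   position n j \<le> s \<Longrightarrow> s < position n j + ln (real n) / real n \<Longrightarrow> i = j"
  using position_order[of n i j] position_order[of n j i] by linarith

lemma finite_position:
  assumes "n \<ge> 2" shows "finite {i. z < position n i}"
proof (rule finite_subset)
  show "{i. z < position n i} \<subseteq> {.. nat \<lceil>real n * (1 + \<bar>z\<bar> / ln (real n))\<rceil>}"
  proof
    fix i assume "i \<in> {i. z < position n i}"
    then have "z < (1 - real i / real n) * ln (real n)"
      using assms by (simp add: position_def diff_divide_distrib)
    then have "real i / real n - 1 < (- z) / ln (real n)"
      using assms by (simp add: field_simps)
    also have "\<dots> \<le> \<bar>z\<bar> / ln (real n)" using assms by (intro divide_right_mono) auto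
    finally have "real i / real n - 1 < \<bar>z\<bar> / ln (real n)" .
    then have "real i < real n * (1 + \<bar>z\<bar> / ln (real n))"
      using assms by (simp add: field_simps)
    then show "i \<in> {.. nat \<lceil>real n * (1 + \<bar>z\<bar> / ln (real n))\<rceil>}" by simp linarith
  qed
qed simp

context slow_weights
begin

text \<open>
  Whenever \<open>beta \<gamma> n + x\<close> is nonnegative, this is the probability that the \<open>i\<close>-th rescaled value
  exceeds \<open>x\<close>.
\<close>
definition tail :: "real \<Rightarrow> nat \<Rightarrow> nat \<Rightarrow> real" where
  "tail x n i = exp (- (beta \<gamma> n + x) * (v (real n) / v (real i)))"

lemma beta_asymp:
  "(\<lambda>n. (beta \<gamma> n + x) / ln (real n)) \<longlonglongrightarrow> 1"
  using gamma_pos unfolding beta_def by real_asymp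

text \<open>
  The centring \<open>beta \<gamma> n\<close> is chosen so that \<open>exp (- beta \<gamma> n)\<close> is \<open>\<gamma>\<close> times the mesh \<open>ln n / n\<close> of the
  rescaled times.
\<close>
lemma tail_eq:
  assumes "n \<ge> 2"
  shows "tail x n i / (ln (real n) / real n) =
    \<gamma> * exp (- x) * exp (- ((beta \<gamma> n + x) / ln (real n)) * (ln (real n) * (v (real n) / v (real i) - 1)))"
proof -
  have e: "exp (- beta \<gamma> n) = \<gamma> * (ln (real n) / real n)"
    using assms gamma_pos by (simp add: beta_def exp_diff exp_minus exp_add field_simps)
  have "tail x n i = exp (- beta \<gamma> n) * exp (- x) * exp (- (beta \<gamma> n + x) * (v (real n) / v (real i) - 1))"
    unfolding tail_def exp_add[symmetric] by (simp add: algebra_simps)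
  also have "\<dots> = \<gamma> * (ln (real n) / real n) * exp (- x) * exp (- (beta \<gamma> n + x) * (v (real n) / v (real i) - 1))"
    by (simp only: e)
  also have "- (beta \<gamma> n + x) * (v (real n) / v (real i) - 1) =
      - ((beta \<gamma> n + x) / ln (real n)) * (ln (real n) * (v (real n) / v (real i) - 1))"
    using assms by (simp add: minus_mult_left[symmetric] del: minus_add_distrib mult_minus_left)
  finally show ?thesis using assms by simp
qed

lemma tail_bound:
  "\<exists>c>0. \<exists>K>0. \<forall>\<^sub>F n in sequentially. \<forall>i\<ge>1. z < position n i \<longrightarrow>
     tail x n i / (ln (real n) / real n) \<le> K * exp (- c * position n i)"
proof -
  obtain c C where c: "c > 0" and ev: "\<forall>\<^sub>F n in sequentially. \<forall>i\<ge>1. z < position n i \<longrightarrow>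
     ln (real n) * (v (real n) / v (real i) - 1) \<ge> c * position n i - C"
    using weight_ratio_lower by blast
  define K where "K = \<gamma> * exp (- x) * exp (2 * c * \<bar>z\<bar> + 2 * \<bar>C\<bar>)"
  have "\<forall>\<^sub>F n in sequentially. (beta \<gamma> n + x) / ln (real n) > 1/2"
    by (rule order_tendstoD[OF beta_asymp]) simp
  moreover have "\<forall>\<^sub>F n in sequentially. (beta \<gamma> n + x) / ln (real n) < 2"
    by (rule order_tendstoD[OF beta_asymp]) simp
  ultimately have "\<forall>\<^sub>F n in sequentially. \<forall>i\<ge>1. z < position n i \<longrightarrow>
     tail x n i / (ln (real n) / real n) \<le> K * exp (- (c / 2) * position n i)"
    using ev eventually_ge_at_top[of 2]
  proof eventually_elim
    case (elim n)
    show ?case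
    proof (intro allI impI)
      fix i :: nat assume i: "i \<ge> 1" "z < position n i"
      define r where "r = (beta \<gamma> n + x) / ln (real n)"
      have r: "1/2 < r" "r < 2" using elim by (auto simp: r_def)
      let ?Y = "ln (real n) * (v (real n) / v (real i) - 1)"
      have "r * ?Y \<ge> r * (c * position n i - C)"
        using elim i r by (intro mult_left_mono) auto
      moreover have "r * C \<le> 2 * \<bar>C\<bar>"
      proof -
        have "r * C \<le> r * \<bar>C\<bar>" using r by (intro mult_left_mono) auto
        also have "\<dots> \<le> 2 * \<bar>C\<bar>" using r by (intro mult_right_mono) auto
        finally show ?thesis .
      qed
      moreover have "r * (c * position n i) \<ge> c / 2 * position n i - 2 * c * \<bar>z\<bar>"
      proof (cases "position n i \<ge> 0")
        case True
        then have "1/2 * (c * position n i) \<le> r * (c * position n i)"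
          using r c by (intro mult_right_mono) auto
        moreover have "c * \<bar>z\<bar> \<ge> 0" using c by simp
        ultimately show ?thesis by linarith
      next
        case False
        have "r * (c * - position n i) \<le> 2 * (c * - position n i)"
          using r c False by (intro mult_right_mono mult_nonneg_nonneg) auto
        also have "\<dots> \<le> 2 * (c * \<bar>z\<bar>)" using c i False by (intro mult_left_mono) auto
        finally have "- (r * (c * position n i)) \<le> 2 * (c * \<bar>z\<bar>)" by simp
        moreover have "c * position n i \<le> 0" using c False by (simp add: mult_le_0_iff)
        ultimately show ?thesis by linarith
      qed
      ultimately have "- r * ?Y \<le> (2 * c * \<bar>z\<bar> + 2 * \<bar>C\<bar>) + - (c / 2) * position n i"
        by (simp add: right_diff_distrib)
      then have "exp (- r * ?Y) \<le> exp (2 * c * \<bar>z\<bar> + 2 * \<bar>C\<bar>) * exp (- (c / 2) * position n i)"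
        unfolding exp_add[symmetric] by simp
      then have "\<gamma> * exp (- x) * exp (- r * ?Y) \<le> \<gamma> * exp (- x) * (exp (2 * c * \<bar>z\<bar> + 2 * \<bar>C\<bar>) * exp (- (c / 2) * position n i))"
        using gamma_pos by (intro mult_left_mono) auto
      then show "tail x n i / (ln (real n) / real n) \<le> K * exp (- (c / 2) * position n i)"
        unfolding tail_eq[OF elim(4)] r_def[symmetric] K_def by (simp add: mult.assoc)
    qed
  qed
  moreover have "c / 2 > 0" "K > 0" using c gamma_pos by (auto simp: K_def)
  ultimately show ?thesis by blast
qed

lemma tail_uniformly_small:
  assumes "e > 0"
  shows "\<forall>\<^sub>F n in sequentially. \<forall>i\<ge>1. z < position n i \<longrightarrow> tail x n i \<le> e"
proof -
  obtain c K where c: "c > 0" "K > 0" and ev: "\<forall>\<^sub>F n in sequentially. \<forall>i\<ge>1. z < position n i \<longrightarrow>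
     tail x n i / (ln (real n) / real n) \<le> K * exp (- c * position n i)"
    using tail_bound by blast
  have "(\<lambda>n. ln (real n) / real n * (K * exp (- c * z))) \<longlonglongrightarrow> 0"
    by real_asymp
  then have "\<forall>\<^sub>F n in sequentially. ln (real n) / real n * (K * exp (- c * z)) < e"
    using assms by (rule order_tendstoD)
  with ev eventually_ge_at_top[of 2] show ?thesis
  proof eventually_elim
    case (elim n)
    show ?case
    proof (intro allI impI)
      fix i :: nat assume i: "i \<ge> 1" "z < position n i"
      have "tail x n i / (ln (real n) / real n) \<le> K * exp (- c * position n i)" using elim i by blast
      also have "\<dots> \<le> K * exp (- c * z)" using c i by (intro mult_left_mono) auto
      finally have "tail x n i \<le> ln (real n) / real n * (K * exp (- c * z))"
        using elim by (simp add: field_simps)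
      then show "tail x n i \<le> e" using elim by linarith
    qed
  qed
qed

text \<open>
  Divided by the mesh, the tails form a step function of the rescaled time. It converges to
  \<open>\<gamma> exp (- x - \<gamma> s)\<close> at every \<open>s > z\<close> and vanishes in the limit for \<open>s < z\<close>; a multiple of
  \<open>exp (- c s)\<close> on \<open>s \<ge> z\<close> dominates it.
\<close>
lemma tail_sum_limit:
  "(\<lambda>n. \<Sum>i | 1 \<le> i \<and> z < position n i. tail x n i) \<longlonglongrightarrow> exp (- x) * exp (- \<gamma> * z)"
proof -
  obtain c K where c: "c > 0" "K > 0" and ev: "\<forall>\<^sub>F n in sequentially. \<forall>i\<ge>1. z < position n i \<longrightarrow>
     tail x n i / (ln (real n) / real n) \<le> K * exp (- c * position n i)"
    using tail_bound by blast
  from ev eventually_ge_at_top[of 2]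
  have "\<forall>\<^sub>F n in sequentially. n \<ge> 2 \<and> (\<forall>i\<ge>1. z < position n i \<longrightarrow>
     tail x n i / (ln (real n) / real n) \<le> K * exp (- c * position n i))"
    by eventually_elim auto
  then obtain n0 where n0': "\<forall>n\<ge>n0. n \<ge> 2 \<and> (\<forall>i\<ge>1. z < position n i \<longrightarrow>
     tail x n i / (ln (real n) / real n) \<le> K * exp (- c * position n i))"
    unfolding eventually_sequentially by blast
  then have n0: "\<And>n. n \<ge> n0 \<Longrightarrow> n \<ge> 2"
    and n0b: "\<And>n i. n \<ge> n0 \<Longrightarrow> 1 \<le> i \<Longrightarrow> z < position n i \<Longrightarrow>
      tail x n i / (ln (real n) / real n) \<le> K * exp (- c * position n i)"
    by blast+
  \<comment> \<open>The interval of each index has length \<open>D n\<close>, so the step function \<open>g n\<close> integrates to the sum.\<close>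
  define D where "D n = ln (real n) / real n" for n
  define I where "I n = {i. 1 \<le> i \<and> z < position n i}" for n
  define g where "g n s = (\<Sum>i\<in>I n. (tail x n i / D n) * indicator {position n i ..< position n i + D n} s)" for n s
  define f where "f s = \<gamma> * exp (- x) * (exp (- \<gamma> * s) * indicator {z..} s)" for s
  have D: "D n > 0" if "n \<ge> 2" for n using that by (simp add: D_def)
  have D1: "D n \<le> 1" if "n \<ge> 2" for n
    using that ln_le_minus_one[of "real n"] by (simp add: D_def field_simps)
  have fin: "finite (I n)" if "n \<ge> 2" for n
    by (rule finite_subset[OF _ finite_position[OF that, of z]]) (auto simp: I_def)
  have g_int: "integral\<^sup>L lborel (g n) = (\<Sum>i\<in>I n. tail x n i)" if n: "n \<ge> 2" for n
  proof -
    have "integral\<^sup>L lborel (g n) = (\<Sum>i\<in>I n. \<integral>s. (tail x n i / D n) * indicator {position n i ..< position n i + D n} s \<partial>lborel)"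
      unfolding g_def using D[OF n] by (intro Bochner_Integration.integral_sum) (auto simp: emeasure_lborel_Ico)
    also have "\<dots> = (\<Sum>i\<in>I n. tail x n i)"
      using D[OF n] by (intro sum.cong) (auto simp: measure_lborel_Ico)
    finally show ?thesis .
  qed
  have g_in: "g n s = (if i \<in> I n then tail x n i / D n else 0)"
    if n: "n \<ge> 2" and i: "position n i \<le> s" "s < position n i + D n" for n s i
  proof -
    have "g n s = (\<Sum>j\<in>I n. if j = i then tail x n j / D n else 0)"
      unfolding g_def
    proof (intro sum.cong refl)
      fix j
      show "tail x n j / D n * indicator {position n j..<position n j + D n} s =
          (if j = i then tail x n j / D n else 0)"
      proof (cases "j = i")
        case True
        then show ?thesis using i by simp
      next
        case False
        then have "s \<notin> {position n j..<position n j + D n}"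
          using position_inj[OF n i[unfolded D_def], of j] by (auto simp: D_def)
        then show ?thesis using False by simp
      qed
    qed
    then show ?thesis using fin[OF n] by simp
  qed
  have g_out: "g n s = 0" if "\<And>i. i \<in> I n \<Longrightarrow> \<not> (position n i \<le> s \<and> s < position n i + D n)" for n s
    unfolding g_def using that by (intro sum.neutral) (auto simp: indicator_def)
  define w where "w s = K * exp c * (exp (- c * s) * indicator {z..} s)" for s
  have dom: "norm (g n s) \<le> w s" if "n \<ge> n0" for n s
  proof (cases "\<exists>i\<in>I n. position n i \<le> s \<and> s < position n i + D n")
    case True
    then obtain i where i: "i \<in> I n" "position n i \<le> s" "s < position n i + D n" by blast
    have n: "n \<ge> 2" using n0[OF that] by simp
    have "g n s = tail x n i / D n" using g_in[OF n i(2,3)] i(1) by simp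
    moreover have "tail x n i \<ge> 0" by (simp add: tail_def)
    moreover have "tail x n i / D n \<le> K * exp (- c * position n i)"
      using n0b[OF that, of i] i(1) unfolding D_def I_def by simp
    moreover have "- c * position n i \<le> c + - c * s"
    proof -
      have "s - 1 \<le> position n i" using i D1[OF n] by linarith
      then have "c * (s - 1) \<le> c * position n i" using c by (intro mult_left_mono) auto
      then show ?thesis by (simp add: algebra_simps)
    qed
    then have "K * exp (- c * position n i) \<le> K * exp (c + - c * s)" using c by (intro mult_left_mono) auto
    moreover have "w s = K * exp (c + - c * s)"
      unfolding exp_add w_def using i by (simp add: I_def)
    ultimately show ?thesis using D[OF n] by simp
  next
    case False
    then have "g n s = 0" by (intro g_out) auto
    then show ?thesis using c by (simp add: w_def)
  qed
  have lim: "(\<lambda>n. g n s) \<longlonglongrightarrow> f s" if "s \<noteq> z" for s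
  proof -
    \<comment> \<open>The index whose interval contains \<open>s\<close>.\<close>
    define i where "i n = nat (int n - \<lfloor>s / D n\<rfloor>)" for n
    have "(\<lambda>n. s / D n / real n) \<longlonglongrightarrow> 0" unfolding D_def by real_asymp
    then have "\<forall>\<^sub>F n in sequentially. s / D n / real n < 1/2" by (rule order_tendstoD) simp
    then have i1: "\<forall>\<^sub>F n in sequentially. n \<ge> 2 \<and> real (i n) = real n - of_int \<lfloor>s / D n\<rfloor> \<and> i n \<ge> 1"
      using eventually_ge_at_top[of 2]
    proof eventually_elim
      case (elim n)
      then have "s / D n / real n * real n < 1 / 2 * real n" by (intro mult_strict_right_mono) auto
      then have "s / D n < 1 / 2 * real n" using elim by simp
      then have "s / D n < real n" by (rule order_less_trans) (use elim in simp)
      then have "\<lfloor>s / D n\<rfloor> < int n" by linarith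
      then have "int n - \<lfloor>s / D n\<rfloor> \<ge> 1" by linarith
      then show ?case using elim unfolding i_def
        by (intro conjI) (simp, simp add: of_nat_nat, linarith)
    qed
    have inn: "\<forall>\<^sub>F n in sequentially. n \<ge> 2 \<and> i n \<ge> 1 \<and> position n (i n) \<le> s \<and> s < position n (i n) + D n"
      using i1
    proof eventually_elim
      case (elim n)
      then have p: "position n (i n) = of_int \<lfloor>s / D n\<rfloor> * D n"
        by (simp add: position_def D_def)
      have Dp: "D n > 0" using D elim by simp
      have "of_int \<lfloor>s / D n\<rfloor> * D n \<le> s / D n * D n" using Dp by (intro mult_right_mono) auto
      moreover have "s / D n * D n < (of_int \<lfloor>s / D n\<rfloor> + 1) * D n" using Dp by (intro mult_strict_right_mono) linarith+
      ultimately show ?case using Dp elim unfolding p by (simp add: distrib_right)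
    qed
    have D0: "D \<longlonglongrightarrow> 0" unfolding D_def by real_asymp
    have ps: "(\<lambda>n. position n (i n)) \<longlonglongrightarrow> s"
    proof (rule tendsto_sandwich)
      show "\<forall>\<^sub>F n in sequentially. s - D n \<le> position n (i n)" using inn by eventually_elim auto
      show "\<forall>\<^sub>F n in sequentially. position n (i n) \<le> s" using inn by eventually_elim auto
      show "(\<lambda>n. s - D n) \<longlonglongrightarrow> s" using tendsto_diff[OF tendsto_const D0, of s] by simp
    qed simp
    show ?thesis
    proof (cases "s > z")
      case True
      have "(\<lambda>n. \<gamma> * exp (- x) * exp (- ((beta \<gamma> n + x) / ln (real n)) *
          (ln (real n) * (v (real n) / v (real (i n)) - 1)))) \<longlonglongrightarrow> \<gamma> * exp (- x) * exp (- 1 * (\<gamma> * s))"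
        by (intro tendsto_intros beta_asymp weight_ratio_limit ps)
      moreover have "\<gamma> * exp (- x) * exp (- 1 * (\<gamma> * s)) = f s" using True by (simp add: f_def)
      ultimately have l: "(\<lambda>n. \<gamma> * exp (- x) * exp (- ((beta \<gamma> n + x) / ln (real n)) *
          (ln (real n) * (v (real n) / v (real (i n)) - 1)))) \<longlonglongrightarrow> f s" by simp
      show ?thesis
        using l
      proof (rule Lim_transform_eventually)
        show "\<forall>\<^sub>F n in sequentially. \<gamma> * exp (- x) * exp (- ((beta \<gamma> n + x) / ln (real n)) *
          (ln (real n) * (v (real n) / v (real (i n)) - 1))) = g n s"
          using inn order_tendstoD(1)[OF ps True]
        proof eventually_elim
          case (elim n)
          then have "i n \<in> I n" by (simp add: I_def)
          then show ?case using g_in[of n "i n" s] elim tail_eq[of n x "i n"] by (simp add: D_def)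
        qed
      qed
    next
      case False
      then have sz: "s < z" using that by simp
      have "\<forall>\<^sub>F n in sequentially. g n s = f s"
        using inn
      proof eventually_elim
        case (elim n)
        then have "i n \<notin> I n" using sz by (auto simp: I_def)
        then show ?case using g_in[of n "i n" s] elim sz by (simp add: f_def)
      qed
      then show ?thesis by (rule tendsto_eventually)
    qed
  qed
  have fint: "integral\<^sup>L lborel f = exp (- x) * exp (- \<gamma> * z)"
    using has_bochner_integral_integral_eq[OF exponential_tail_integral[OF gamma_pos, of z]] gamma_pos
    unfolding f_def by simp
  have "(\<lambda>n. integral\<^sup>L lborel (g (n + n0))) \<longlonglongrightarrow> integral\<^sup>L lborel f"
  proof (rule integral_dominated_convergence)
    show "integrable lborel w" unfolding w_def
      using integrable.intros[OF exponential_tail_integral[OF c(1), of z]] by (intro integrable_mult_right)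
    show "AE s in lborel. (\<lambda>n. g (n + n0) s) \<longlonglongrightarrow> f s"
      using AE_lborel_singleton[of z] by eventually_elim (intro LIMSEQ_ignore_initial_segment lim)
    show "AE s in lborel. norm (g (n + n0) s) \<le> w s" for n using dom by simp
  qed (auto simp: f_def[abs_def] g_def[abs_def])
  moreover have "integral\<^sup>L lborel (g (n + n0)) = (\<Sum>i | 1 \<le> i \<and> z < position (n + n0) i. tail x (n + n0) i)" for n
    using n0[of "n + n0"] by (subst g_int) (auto simp: I_def)
  ultimately have "(\<lambda>n. \<Sum>i | 1 \<le> i \<and> z < position (n + n0) i. tail x (n + n0) i) \<longlonglongrightarrow> exp (- x) * exp (- \<gamma> * z)"
    by (simp only: fint)
  then show ?thesis
    by (rule LIMSEQ_offset[where f = "\<lambda>n. \<Sum>i | 1 \<le> i \<and> z < position n i. tail x n i"])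
qed

end

section \<open>Avoidance probabilities and occupation patterns\<close>

text \<open>
  The Poisson approximation in its simplest form: \<open>1 - p\<close> lies between \<open>exp (- p - 2 p\<^sup>2)\<close> and
  \<open>exp (- p)\<close>, and the sum of the squares is negligible because it is at most the largest \<open>p\<close> times the
  convergent sum.
\<close>
lemma prod_one_minus_limit:
  fixes p :: "nat \<Rightarrow> 'i \<Rightarrow> real"
  assumes p0: "\<And>n i. 0 \<le> p n i"
    and small: "\<And>e. e > 0 \<Longrightarrow> \<forall>\<^sub>F n in sequentially. \<forall>i\<in>I n. p n i \<le> e"
    and sum: "(\<lambda>n. \<Sum>i\<in>I n. p n i) \<longlonglongrightarrow> \<mu>"
  shows "(\<lambda>n. \<Prod>i\<in>I n. 1 - p n i) \<longlonglongrightarrow> exp (- \<mu>)"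
proof -
  have sq: "(\<lambda>n. \<Sum>i\<in>I n. (p n i)\<^sup>2) \<longlonglongrightarrow> 0"
  proof (rule tendstoI)
    fix e :: real assume e: "e > 0"
    have "\<forall>\<^sub>F n in sequentially. (\<Sum>i\<in>I n. p n i) < \<bar>\<mu>\<bar> + 1"
      by (rule order_tendstoD[OF sum]) simp
    moreover have "e / (\<bar>\<mu>\<bar> + 2) > 0" using e by simp
    note small[OF this]
    ultimately show "\<forall>\<^sub>F n in sequentially. dist (\<Sum>i\<in>I n. (p n i)\<^sup>2) 0 < e"
    proof eventually_elim
      case (elim n)
      have "(\<Sum>i\<in>I n. (p n i)\<^sup>2) \<le> (\<Sum>i\<in>I n. e / (\<bar>\<mu>\<bar> + 2) * p n i)"
        unfolding power2_eq_square using elim p0 by (intro sum_mono mult_right_mono) auto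
      also have "\<dots> = e / (\<bar>\<mu>\<bar> + 2) * (\<Sum>i\<in>I n. p n i)" by (simp add: sum_distrib_left)
      also have "\<dots> \<le> e / (\<bar>\<mu>\<bar> + 2) * (\<bar>\<mu>\<bar> + 1)" using elim e by (intro mult_left_mono) auto
      also have "\<dots> < e" using e by (simp add: field_simps)
      finally show ?case by (simp add: dist_real_def sum_nonneg)
    qed
  qed
  show ?thesis
  proof (rule tendsto_sandwich)
    show "\<forall>\<^sub>F n in sequentially. exp (- (\<Sum>i\<in>I n. p n i) - 2 * (\<Sum>i\<in>I n. (p n i)\<^sup>2)) \<le> (\<Prod>i\<in>I n. 1 - p n i)"
      using small[of "1/2", simplified]
    proof eventually_elim
      case (elim n)
      show ?case
      proof (cases "finite (I n)")
        case True
        have "exp (- (\<Sum>i\<in>I n. p n i) - 2 * (\<Sum>i\<in>I n. (p n i)\<^sup>2)) = (\<Prod>i\<in>I n. exp (- p n i - 2 * (p n i)\<^sup>2))"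
          using True by (simp add: exp_sum[symmetric] sum_negf sum_subtractf sum_distrib_left)
        also have "\<dots> \<le> (\<Prod>i\<in>I n. 1 - p n i)"
        proof (intro prod_mono conjI)
          fix i assume "i \<in> I n"
          then have i: "0 \<le> p n i" "p n i \<le> 1 / 2" using elim p0 by auto
          have "exp (- p n i - 2 * (p n i)\<^sup>2) \<le> exp (ln (1 - p n i))"
            using ln_one_minus_pos_lower_bound[OF i] by simp
          then show "exp (- p n i - 2 * (p n i)\<^sup>2) \<le> 1 - p n i" using i by simp
        qed auto
        finally show ?thesis .
      qed simp
    qed
    show "\<forall>\<^sub>F n in sequentially. (\<Prod>i\<in>I n. 1 - p n i) \<le> exp (- (\<Sum>i\<in>I n. p n i))"
      using small[of "1/2", simplified]
    proof eventually_elim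
      case (elim n)
      have "(\<Prod>i\<in>I n. 1 - p n i) \<le> (\<Prod>i\<in>I n. exp (- p n i))"
      proof (intro prod_mono conjI)
        fix i assume "i \<in> I n"
        then have "p n i \<le> 1 / 2" using elim by auto
        then show "0 \<le> 1 - p n i" by simp
        show "1 - p n i \<le> exp (- p n i)" using exp_ge_add_one_self[of "- p n i"] by simp
      qed
      also have "\<dots> = exp (- (\<Sum>i\<in>I n. p n i))"
        by (cases "finite (I n)") (simp_all add: exp_sum[symmetric] sum_negf)
      finally show ?case .
    qed
    show "(\<lambda>n. exp (- (\<Sum>i\<in>I n. p n i))) \<longlonglongrightarrow> exp (- \<mu>)"
      by (intro tendsto_intros sum)
    have "(\<lambda>n. exp (- (\<Sum>i\<in>I n. p n i) - 2 * (\<Sum>i\<in>I n. (p n i)\<^sup>2))) \<longlonglongrightarrow> exp (- \<mu> - 2 * 0)"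
      by (intro tendsto_intros sum sq)
    then show "(\<lambda>n. exp (- (\<Sum>i\<in>I n. p n i) - 2 * (\<Sum>i\<in>I n. (p n i)\<^sup>2))) \<longlonglongrightarrow> exp (- \<mu>)" by simp
  qed
qed

text \<open>
  Inclusion-exclusion, one cell at a time: avoiding \<open>Z\<close> and hitting \<open>S \<union> {a}\<close> is avoiding \<open>Z\<close> and
  hitting \<open>S\<close>, without the event of avoiding \<open>Z \<union> {a}\<close> and hitting \<open>S\<close>. Hence the avoidance
  probabilities alone determine all occupation patterns. The same lemma serves the Poisson process, as
  a constant sequence.
\<close>
lemma hit_avoid_limit:
  fixes hit :: "nat \<Rightarrow> 'c \<Rightarrow> 'a \<Rightarrow> bool" and \<nu> :: real
  assumes "prob_space M"
    and meas: "\<forall>\<^sub>F n in sequentially. \<forall>c. {\<omega> \<in> space M. hit n c \<omega>} \<in> sets M"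
    and avoid: "\<And>Z. finite Z \<Longrightarrow>
      (\<lambda>n. \<P>(\<omega> in M. \<forall>c\<in>Z. \<not> hit n c \<omega>)) \<longlonglongrightarrow> exp (- \<nu> * real (card Z))"
    and "finite S" "finite Z" "Z \<inter> S = {}"
  shows "(\<lambda>n. \<P>(\<omega> in M. (\<forall>c\<in>Z. \<not> hit n c \<omega>) \<and> (\<forall>c\<in>S. hit n c \<omega>)))
    \<longlonglongrightarrow> exp (- \<nu> * real (card Z)) * (1 - exp (- \<nu>)) ^ card S"
  using assms(4-6)
proof (induction S arbitrary: Z rule: finite_induct)
  case empty
  then show ?case using avoid by simp
next
  case (insert a S)
  interpret prob_space M by fact
  have a: "a \<notin> Z" "Z \<inter> S = {}" "insert a Z \<inter> S = {}" using insert by auto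
  define q where "q n Z S = \<P>(\<omega> in M. (\<forall>c\<in>Z. \<not> hit n c \<omega>) \<and> (\<forall>c\<in>S. hit n c \<omega>))" for n Z S
  have "(\<lambda>n. q n Z S - q n (insert a Z) S) \<longlonglongrightarrow> exp (- \<nu> * real (card Z)) * (1 - exp (- \<nu>)) ^ card S -
      exp (- \<nu> * real (card (insert a Z))) * (1 - exp (- \<nu>)) ^ card S"
    unfolding q_def using insert.prems a by (intro tendsto_diff insert.IH) auto
  moreover have "exp (- \<nu> * real (card Z)) * (1 - exp (- \<nu>)) ^ card S -
      exp (- \<nu> * real (card (insert a Z))) * (1 - exp (- \<nu>)) ^ card S =
      exp (- \<nu> * real (card Z)) * (1 - exp (- \<nu>)) ^ card (insert a S)"
    using insert a by (simp add: exp_add exp_minus exp_diff field_simps)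
  moreover have "\<forall>\<^sub>F n in sequentially. q n Z S - q n (insert a Z) S = q n Z (insert a S)"
    using meas
  proof eventually_elim
    case (elim n)
    have E: "{\<omega> \<in> space M. (\<forall>c\<in>Z'. \<not> hit n c \<omega>) \<and> (\<forall>c\<in>S'. hit n c \<omega>)} \<in> sets M"
      if "finite Z'" "finite S'" for Z' S'
      using that elim by (intro sets.sets_Collect_conj sets.sets_Collect_finite_All sets.sets_Collect_neg) auto
    have "q n Z S = q n (insert a Z) S + q n Z (insert a S)"
      unfolding q_def
    proof (subst finite_measure_Union[symmetric])
      show "{\<omega> \<in> space M. (\<forall>c\<in>insert a Z. \<not> hit n c \<omega>) \<and> (\<forall>c\<in>S. hit n c \<omega>)} \<in> sets M"
        "{\<omega> \<in> space M. (\<forall>c\<in>Z. \<not> hit n c \<omega>) \<and> (\<forall>c\<in>insert a S. hit n c \<omega>)} \<in> sets M"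
        using insert.prems insert.hyps by (intro E; simp)+
    qed (auto intro!: arg_cong[where f="measure M"])
    then show ?case by simp
  qed
  ultimately show ?case unfolding q_def[symmetric] by (simp add: Lim_transform_eventually)
qed

section \<open>Convergence in distribution from open sets\<close>

text \<open>
  Fatou's lemma for events. Below, \<open>B m\<close> is an event that sees the outcome only at the resolution of the
  \<open>m\<close>-th dyadic grid.
\<close>
lemma measure_eventually_in_lower:
  assumes "prob_space M" and A: "A \<in> sets M" and B: "\<And>m. B m \<in> sets M"
    and ev: "AE \<omega> in M. \<omega> \<in> A \<longrightarrow> (\<forall>\<^sub>F m in sequentially. \<omega> \<in> B m)" and "e > 0"
  shows "\<forall>\<^sub>F m in sequentially. measure M A - e \<le> measure M (B m)"
proof -
  interpret prob_space M by fact
  have "(\<lambda>m. integral\<^sup>L M (indicat_real (A - B m))) \<longlonglongrightarrow> integral\<^sup>L M (\<lambda>_. 0)"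
  proof (rule integral_dominated_convergence[where w = "\<lambda>_. 1"])
    show "AE \<omega> in M. (\<lambda>m. indicat_real (A - B m) \<omega>) \<longlonglongrightarrow> 0"
      using ev
    proof eventually_elim
      case (elim \<omega>)
      show ?case
      proof (rule tendsto_eventually, cases "\<omega> \<in> A")
        case True
        with elim have "\<forall>\<^sub>F m in sequentially. \<omega> \<in> B m" by simp
        then show "\<forall>\<^sub>F m in sequentially. indicat_real (A - B m) \<omega> = 0"
          by eventually_elim simp
      qed simp
    qed
  qed (use A B in \<open>auto simp: indicator_def\<close>)
  then have "(\<lambda>m. measure M (A - B m)) \<longlonglongrightarrow> 0"
    using A B by simp
  then have "\<forall>\<^sub>F m in sequentially. measure M (A - B m) < e" using \<open>e > 0\<close> by (rule order_tendstoD)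
  then show ?thesis
  proof eventually_elim
    case (elim m)
    have "measure M A = measure M (A \<inter> B m) + measure M (A - B m)"
      using A B by (subst finite_measure_Union[symmetric]) (auto intro!: arg_cong[where f="measure M"])
    moreover have "measure M (A \<inter> B m) \<le> measure M (B m)" using B by (intro finite_measure_mono) auto
    ultimately show ?case using elim by linarith
  qed
qed

lemma space_borel_of [simp]: "space (borel_of T) = topspace T"
  unfolding borel_of_def by (intro space_measure_of) (auto dest: openin_subset)

lemma sets_borel_of: "sets (borel_of T) = sigma_sets (topspace T) {U. openin T U}"
  unfolding borel_of_def by (intro sets_measure_of) (auto dest: openin_subset)

lemma openin_sets_borel_of: "openin T U \<Longrightarrow> U \<in> sets (borel_of T)"
  by (simp add: sets_borel_of sigma_sets.Basic)

lemma measurable_borel_ofI: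
  assumes "\<And>\<omega>. \<omega> \<in> space M \<Longrightarrow> f \<omega> \<in> topspace T"
    and "\<And>U. openin T U \<Longrightarrow> {\<omega> \<in> space M. f \<omega> \<in> U} \<in> sets M"
  shows "f \<in> measurable M (borel_of T)"
  unfolding borel_of_def
proof (rule measurable_measure_of)
  show "f -` U \<inter> space M \<in> sets M" if "U \<in> {U. openin T U}" for U
  proof -
    have "f -` U \<inter> space M = {\<omega> \<in> space M. f \<omega> \<in> U}" by auto
    then show ?thesis using assms(2) that by simp
  qed
qed (use assms in \<open>auto dest: openin_subset\<close>)

lemma continuous_map_measurable_borel_of:
  assumes "continuous_map T euclideanreal F"
  shows "F \<in> borel_measurable (borel_of T)"
proof (rule borel_measurableI)
  fix S :: "real set" assume "open S"
  then have "openin T {x \<in> topspace T. F x \<in> S}"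
    using assms by (auto simp: continuous_map_def)
  moreover have "F -` S \<inter> space (borel_of T) = {x \<in> topspace T. F x \<in> S}" by auto
  ultimately show "F -` S \<inter> space (borel_of T) \<in> sets (borel_of T)"
    by (metis openin_sets_borel_of)
qed

text \<open>
  Layers of height \<open>1 / k\<close> reduce the expectation of a function with values in \<open>[0, 1]\<close> to
  probabilities of its superlevel sets.
\<close>
lemma staircase_approx:
  fixes y :: real and k :: nat
  assumes "k > 0" "0 \<le> y" "y \<le> 1"
  shows "(\<Sum>j=1..k. of_bool (real j / real k < y)) / real k \<le> y"
    and "y \<le> (\<Sum>j=1..k. of_bool (real j / real k < y)) / real k + 1 / real k"
proof -
  define m where "m = nat (\<lceil>real k * y\<rceil> - 1)"
  have mk: "real m < real k * y \<or> m = 0" "real m \<ge> real k * y - 1"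
    unfolding m_def by linarith+
  have ky: "real k * y \<le> real k" using assms by (simp add: mult_le_cancel_left1)
  have iff: "real j / real k < y \<longleftrightarrow> j \<le> m" if "j \<ge> 1" for j
  proof -
    have "real j / real k < y \<longleftrightarrow> real j < real k * y" using assms by (simp add: field_simps)
    also have "\<dots> \<longleftrightarrow> int j < \<lceil>real k * y\<rceil>" by linarith
    also have "\<dots> \<longleftrightarrow> j \<le> m" using that unfolding m_def by linarith
    finally show ?thesis .
  qed
  have "(\<Sum>j=1..k. of_bool (real j / real k < y) :: real) = (\<Sum>j=1..k. of_bool (j \<le> m))"
    by (intro sum.cong) (auto simp: iff)
  also have "\<dots> = real (card {j\<in>{1..k}. j \<le> m})" by (simp add: sum_of_bool_eq Int_def)
  also have "{j\<in>{1..k}. j \<le> m} = {1..m}"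
    using mk ky by (auto)
  finally have eq: "(\<Sum>j=1..k. of_bool (real j / real k < y)) = real m" by simp
  have "real m \<le> real k * y" using mk assms by auto
  then show "(\<Sum>j=1..k. of_bool (real j / real k < y)) / real k \<le> y"
    unfolding eq using assms by (simp add: field_simps)
  have "real k * y \<le> real m + 1" using mk by simp
  then show "y \<le> (\<Sum>j=1..k. of_bool (real j / real k < y)) / real k + 1 / real k"
    unfolding eq using assms by (simp add: field_simps)
qed

text \<open>
  The half of the portmanteau theorem that starts from open sets. Superlevel sets of a continuous
  function are open, so the hypothesis bounds the expectation of a function with values in \<open>[0, 1]\<close> from
  below; applied to \<open>1 - F\<close>, it also bounds it from above.
\<close>
lemma converges_in_distributionI:
  assumes "prob_space M" "prob_space M'"
    and mX: "\<forall>\<^sub>F n in sequentially. X n \<in> measurable M (borel_of T)"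
    and mY: "Y \<in> measurable M' (borel_of T)"
    and lower: "\<And>G e. openin T G \<Longrightarrow> e > 0 \<Longrightarrow>
      \<forall>\<^sub>F n in sequentially. \<P>(\<omega> in M'. Y \<omega> \<in> G) - e \<le> \<P>(\<omega> in M. X n \<omega> \<in> G)"
  shows "converges_in_distribution T M X M' Y"
proof -
  interpret M: prob_space M by fact
  interpret M': prob_space M' by fact
  have stair: "integrable N (\<lambda>\<omega>. F (Z \<omega>))"
      "(\<Sum>j=1..k. \<P>(\<omega> in N. real j / real k < F (Z \<omega>))) / real k \<le> (\<integral>\<omega>. F (Z \<omega>) \<partial>N)"
      "(\<integral>\<omega>. F (Z \<omega>) \<partial>N) \<le> (\<Sum>j=1..k. \<P>(\<omega> in N. real j / real k < F (Z \<omega>))) / real k + 1 / real k"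
    if N: "prob_space N" and Z: "Z \<in> measurable N (borel_of T)" and F: "continuous_map T euclideanreal F"
      and F01: "\<And>x. x \<in> topspace T \<Longrightarrow> 0 \<le> F x \<and> F x \<le> 1" and k: "k > 0"
    for N :: "'x measure" and Z F and k :: nat
  proof -
    interpret N: prob_space N by fact
    have FZ [measurable]: "(\<lambda>\<omega>. F (Z \<omega>)) \<in> borel_measurable N"
      using measurable_compose[OF Z continuous_map_measurable_borel_of[OF F]] .
    have b: "0 \<le> F (Z \<omega>) \<and> F (Z \<omega>) \<le> 1" if "\<omega> \<in> space N" for \<omega>
      using F01 measurable_space[OF Z that] by simp
    show int: "integrable N (\<lambda>\<omega>. F (Z \<omega>))"
      using b by (intro N.integrable_const_bound[where B = 1]) auto
    have e: "(\<integral>\<omega>. (\<Sum>j=1..k. of_bool (real j / real k < F (Z \<omega>))) / real k \<partial>N) =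
       (\<Sum>j=1..k. \<P>(\<omega> in N. real j / real k < F (Z \<omega>))) / real k"
    proof -
      have 1: "of_bool (real j / real k < F (Z \<omega>)) = indicat_real {\<omega> \<in> space N. real j / real k < F (Z \<omega>)} \<omega>"
        if "\<omega> \<in> space N" for j \<omega> using that by (simp add: indicator_def)
      have 2: "{\<omega> \<in> space N. real j / real k < F (Z \<omega>)} \<inter> space N = {\<omega> \<in> space N. real j / real k < F (Z \<omega>)}" for j
        by auto
      have "(\<integral>\<omega>. (\<Sum>j=1..k. of_bool (real j / real k < F (Z \<omega>))) / real k \<partial>N) =
          (\<integral>\<omega>. (\<Sum>j=1..k. indicat_real {\<omega> \<in> space N. real j / real k < F (Z \<omega>)} \<omega>) / real k \<partial>N)"
        by (intro Bochner_Integration.integral_cong refl arg_cong2[where f="(/)"] sum.cong 1)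
      also have "\<dots> = (\<Sum>j=1..k. \<P>(\<omega> in N. real j / real k < F (Z \<omega>))) / real k"
        by (subst Bochner_Integration.integral_divide_zero, subst Bochner_Integration.integral_sum)
          (auto simp: 2 less_top[symmetric] intro!: integrable_real_indicator)
      finally show ?thesis .
    qed
    have int2: "integrable N (\<lambda>\<omega>. (\<Sum>j=1..k. of_bool (real j / real k < F (Z \<omega>))) / real k :: real)"
      by (intro integrable_divide Bochner_Integration.integrable_sum N.integrable_const_bound[where B = 1]) auto
    have "(\<integral>\<omega>. (\<Sum>j=1..k. of_bool (real j / real k < F (Z \<omega>))) / real k \<partial>N) \<le> (\<integral>\<omega>. F (Z \<omega>) \<partial>N)"
      using int int2 b by (intro integral_mono staircase_approx(1)[OF k]) auto
    then show "(\<Sum>j=1..k. \<P>(\<omega> in N. real j / real k < F (Z \<omega>))) / real k \<le> (\<integral>\<omega>. F (Z \<omega>) \<partial>N)"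
      unfolding e .
    have "(\<integral>\<omega>. F (Z \<omega>) \<partial>N) \<le> (\<integral>\<omega>. (\<Sum>j=1..k. of_bool (real j / real k < F (Z \<omega>))) / real k + 1 / real k \<partial>N)"
      using int int2 b
      by (intro integral_mono staircase_approx(2)[OF k] Bochner_Integration.integrable_add) auto
    also have "\<dots> = (\<integral>\<omega>. (\<Sum>j=1..k. of_bool (real j / real k < F (Z \<omega>))) / real k \<partial>N) + 1 / real k"
      using int2 by (subst Bochner_Integration.integral_add) (auto simp: N.prob_space)
    finally show "(\<integral>\<omega>. F (Z \<omega>) \<partial>N) \<le> (\<Sum>j=1..k. \<P>(\<omega> in N. real j / real k < F (Z \<omega>))) / real k + 1 / real k"
      unfolding e .
  qed
  have one_sided: "\<forall>\<^sub>F n in sequentially. (\<integral>\<omega>. F (Y \<omega>) \<partial>M') - e \<le> (\<integral>\<omega>. F (X n \<omega>) \<partial>M)"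
    if F: "continuous_map T euclideanreal F" and F01: "\<And>x. x \<in> topspace T \<Longrightarrow> 0 \<le> F x \<and> F x \<le> 1"
      and e: "e > 0" for F e
  proof -
    obtain k :: nat where k: "k > 0" "1 / real k < e / 2"
      using e by (metis half_gt_zero nat_approx_posE of_nat_Suc zero_less_Suc)
    have op: "openin T {x \<in> topspace T. t < F x}" for t
    proof -
      have "openin T {x \<in> topspace T. F x \<in> {t<..}}"
        using F open_greaterThan[of t] unfolding continuous_map_def by (metis open_openin)
      then show ?thesis by (simp only: greaterThan_iff)
    qed
    have "\<forall>\<^sub>F n in sequentially. \<forall>j\<in>{1..k}. \<P>(\<omega> in M'. Y \<omega> \<in> {x \<in> topspace T. real j / real k < F x}) - e / 2
       \<le> \<P>(\<omega> in M. X n \<omega> \<in> {x \<in> topspace T. real j / real k < F x})"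
      using e by (intro eventually_ball_finite ballI lower op) auto
    with mX show ?thesis
    proof eventually_elim
      case (elim n)
      have eq1: "{\<omega> \<in> space M'. Y \<omega> \<in> {x \<in> topspace T. t < F x}} = {\<omega> \<in> space M'. t < F (Y \<omega>)}" for t
        using measurable_space[OF mY] by auto
      have eq2: "{\<omega> \<in> space M. X n \<omega> \<in> {x \<in> topspace T. t < F x}} = {\<omega> \<in> space M. t < F (X n \<omega>)}" for t
        using measurable_space[OF elim(1)] by auto
      have "(\<Sum>j=1..k. \<P>(\<omega> in M'. real j / real k < F (Y \<omega>)) - e / 2) \<le>
          (\<Sum>j=1..k. \<P>(\<omega> in M. real j / real k < F (X n \<omega>)))"
        using elim(2) unfolding eq1 eq2 by (intro sum_mono) auto
      then have "(\<Sum>j=1..k. \<P>(\<omega> in M'. real j / real k < F (Y \<omega>))) - real k * (e / 2) \<le>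
          (\<Sum>j=1..k. \<P>(\<omega> in M. real j / real k < F (X n \<omega>)))"
        by (simp add: sum_subtractf)
      then have "((\<Sum>j=1..k. \<P>(\<omega> in M'. real j / real k < F (Y \<omega>))) - real k * (e / 2)) / real k \<le>
          (\<Sum>j=1..k. \<P>(\<omega> in M. real j / real k < F (X n \<omega>))) / real k"
        by (rule divide_right_mono) simp
      then have "(\<Sum>j=1..k. \<P>(\<omega> in M'. real j / real k < F (Y \<omega>))) / real k - e / 2 \<le>
          (\<Sum>j=1..k. \<P>(\<omega> in M. real j / real k < F (X n \<omega>))) / real k"
        using k by (simp add: diff_divide_distrib)
      moreover note stair(2)[OF \<open>prob_space M\<close> elim(1) F F01 k(1)]
      moreover note stair(3)[OF \<open>prob_space M'\<close> mY F F01 k(1)]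
      ultimately show ?case using k by linarith
    qed
  qed
  have conv: "(\<lambda>n. \<integral>\<omega>. F (X n \<omega>) \<partial>M) \<longlonglongrightarrow> (\<integral>\<omega>. F (Y \<omega>) \<partial>M')"
    if F: "continuous_map T euclideanreal F" and bd: "bounded (F ` topspace T)" for F
  proof -
    obtain B where B: "B > 0" "\<And>x. x \<in> topspace T \<Longrightarrow> \<bar>F x\<bar> \<le> B"
      using bd by (auto simp: bounded_pos)
    define F1 where "F1 x = (F x + B) / (2 * B)" for x
    have F1: "continuous_map T euclideanreal F1"
      unfolding F1_def by (intro continuous_intros F) (use B in auto)
    have F1b: "0 \<le> F1 x \<and> F1 x \<le> 1" if "x \<in> topspace T" for x
      using B(1) B(2)[OF that] by (auto simp: F1_def field_simps abs_le_iff)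
    have F2: "continuous_map T euclideanreal (\<lambda>x. 1 - F1 x)"
      by (intro continuous_intros F1)
    have lim1: "(\<lambda>n. \<integral>\<omega>. F1 (X n \<omega>) \<partial>M) \<longlonglongrightarrow> (\<integral>\<omega>. F1 (Y \<omega>) \<partial>M')"
    proof (rule tendstoI)
      fix e :: real assume e: "e > 0"
      then have e2: "e / 2 > 0" by simp
      have os1: "\<forall>\<^sub>F n in sequentially. (\<integral>\<omega>. F1 (Y \<omega>) \<partial>M') - e / 2 \<le> (\<integral>\<omega>. F1 (X n \<omega>) \<partial>M)"
        by (rule one_sided[OF F1 _ e2]) (use F1b in auto)
      have os2: "\<forall>\<^sub>F n in sequentially. (\<integral>\<omega>. 1 - F1 (Y \<omega>) \<partial>M') - e / 2 \<le> (\<integral>\<omega>. 1 - F1 (X n \<omega>) \<partial>M)"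
        by (rule one_sided[OF F2 _ e2]) (use F1b in auto)
      show "\<forall>\<^sub>F n in sequentially. dist (\<integral>\<omega>. F1 (X n \<omega>) \<partial>M) (\<integral>\<omega>. F1 (Y \<omega>) \<partial>M') < e"
        using os1 os2 mX
      proof eventually_elim
        case (elim n)
        have "integrable M (\<lambda>\<omega>. F1 (X n \<omega>))" using stair(1)[OF \<open>prob_space M\<close> elim(3) F1 F1b, of 1] by simp
        then have "(\<integral>\<omega>. 1 - F1 (X n \<omega>) \<partial>M) = 1 - (\<integral>\<omega>. F1 (X n \<omega>) \<partial>M)"
          by (simp add: M.prob_space)
        moreover have "integrable M' (\<lambda>\<omega>. F1 (Y \<omega>))" using stair(1)[OF \<open>prob_space M'\<close> mY F1 F1b, of 1] by simp
        then have "(\<integral>\<omega>. 1 - F1 (Y \<omega>) \<partial>M') = 1 - (\<integral>\<omega>. F1 (Y \<omega>) \<partial>M')"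
          by (simp add: M'.prob_space)
        ultimately show ?case using elim e unfolding dist_real_def by linarith
      qed
    qed
    have eqF: "F x = 2 * B * F1 x - B" for x using B by (simp add: F1_def)
    show ?thesis
    proof (rule Lim_transform_eventually)
      show "(\<lambda>n. 2 * B * (\<integral>\<omega>. F1 (X n \<omega>) \<partial>M) - B) \<longlonglongrightarrow> (\<integral>\<omega>. F (Y \<omega>) \<partial>M')"
      proof -
        have "integrable M' (\<lambda>\<omega>. F1 (Y \<omega>))" using stair(1)[OF \<open>prob_space M'\<close> mY F1 F1b, of 1] by simp
        then have "(\<integral>\<omega>. F (Y \<omega>) \<partial>M') = 2 * B * (\<integral>\<omega>. F1 (Y \<omega>) \<partial>M') - B"
          unfolding eqF by (simp add: M'.prob_space)
        then show ?thesis by (auto intro!: tendsto_intros lim1)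
      qed
      show "\<forall>\<^sub>F n in sequentially. 2 * B * (\<integral>\<omega>. F1 (X n \<omega>) \<partial>M) - B = (\<integral>\<omega>. F (X n \<omega>) \<partial>M)"
        using mX
      proof eventually_elim
        case (elim n)
        have "integrable M (\<lambda>\<omega>. F1 (X n \<omega>))" using stair(1)[OF \<open>prob_space M\<close> elim F1 F1b, of 1] by simp
        then show ?case unfolding eqF by (simp add: M.prob_space)
      qed
    qed
  qed
  then show ?thesis unfolding converges_in_distribution_def using mX mY by blast
qed

section \<open>Dyadic cells and the points of the prelimit process\<close>

text \<open>
  The index of the dyadic square of level \<open>m\<close> that contains \<open>(u, w)\<close>.
\<close>
definition cell :: "nat \<Rightarrow> real \<Rightarrow> real \<Rightarrow> nat \<times> nat" where
  "cell m u w = (nat \<lfloor>2 ^ m * u\<rfloor>, nat \<lfloor>2 ^ m * w\<rfloor>)"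

lemma cell_eq_iff:
  assumes "u \<ge> 0" "w \<ge> 0"
  shows "cell m u w = (j, k) \<longleftrightarrow> real j / 2 ^ m \<le> u \<and> u < real (Suc j) / 2 ^ m \<and>
    real k / 2 ^ m \<le> w \<and> w < real (Suc k) / 2 ^ m"
proof -
  have *: "nat \<lfloor>2 ^ m * x\<rfloor> = i \<longleftrightarrow> real i / 2 ^ m \<le> x \<and> x < real (Suc i) / 2 ^ m" if "x \<ge> 0" for x :: real and i
  proof -
    have "nat \<lfloor>2 ^ m * x\<rfloor> = i \<longleftrightarrow> \<lfloor>2 ^ m * x\<rfloor> = int i" using that by auto
    also have "\<dots> \<longleftrightarrow> real i \<le> 2 ^ m * x \<and> 2 ^ m * x < real i + 1" by (simp add: floor_eq_iff)
    also have "\<dots> \<longleftrightarrow> real i / 2 ^ m \<le> x \<and> x < real (Suc i) / 2 ^ m" by (simp add: field_simps)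
    finally show ?thesis .
  qed
  show ?thesis using assms by (simp add: cell_def *)
qed

locale weighted_exponentials = slow_weights v l \<gamma> + prob_space M
  for v l :: "real \<Rightarrow> real" and \<gamma> :: real and M :: "'a measure" +
  fixes X :: "nat \<Rightarrow> 'a \<Rightarrow> real"
  assumes indep: "indep_vars (\<lambda>_. borel) X {1..}"
    and expo: "i \<ge> 1 \<Longrightarrow> distributed M lborel (X i) (exponential_density 1)"
begin

definition height :: "nat \<Rightarrow> nat \<Rightarrow> real \<Rightarrow> real" where
  "height n i x = v (real i) * x / v (real n) - beta \<gamma> n"

text \<open>
  In the coordinates \<open>U\<close> and \<open>W\<close> the limiting intensity is Lebesgue measure on the quadrant, so that all
  cells of one level have the same mean. Large values and late times correspond to small \<open>U\<close> and
  to \<open>W\<close> near 1.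
\<close>
definition U :: "nat \<Rightarrow> nat \<Rightarrow> 'a \<Rightarrow> real" where
  "U n i \<omega> = exp (- height n i (X i \<omega>))"

definition W :: "nat \<Rightarrow> nat \<Rightarrow> real" where
  "W n i = exp (- \<gamma> * position n i)"

definition hits :: "nat \<Rightarrow> nat \<Rightarrow> nat \<Rightarrow> nat \<times> nat \<Rightarrow> 'a \<Rightarrow> bool" where
  "hits n m i c \<omega> \<longleftrightarrow> cell m (U n i \<omega>) (W n i) = c"

text \<open>
  For \<open>n \<ge> 2\<close> only finitely many of the infinitely many points lie in a given strip \<open>W < b\<close>, and which
  indices these are does not depend on chance.
\<close>
definition below :: "nat \<Rightarrow> real \<Rightarrow> nat set" where
  "below n b = {i. 1 \<le> i \<and> W n i < b}"

lemma X_measurable: "i \<ge> 1 \<Longrightarrow> X i \<in> borel_measurable M"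
  using distributed_measurable[OF expo] by simp

lemma U_pos: "U n i \<omega> > 0" and W_pos: "W n i > 0"
  by (simp_all add: U_def W_def)

lemma U_measurable: "i \<ge> 1 \<Longrightarrow> U n i \<in> borel_measurable M"
  unfolding U_def[abs_def] height_def using X_measurable by measurable

lemma below_position: "b > 0 \<Longrightarrow> below n b = {i. 1 \<le> i \<and> - ln b / \<gamma> < position n i}"
proof -
  assume b: "b > 0"
  have "W n i < b \<longleftrightarrow> - ln b / \<gamma> < position n i" for i
  proof -
    have "W n i < b \<longleftrightarrow> ln (W n i) < ln b" using b W_pos by simp
    also have "\<dots> \<longleftrightarrow> - ln b / \<gamma> < position n i"
    proof -
      have "ln (W n i) = - (position n i * \<gamma>)" by (simp add: W_def mult.commute)
      then show ?thesis unfolding pos_divide_less_eq[OF gamma_pos] by linarith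
    qed
    finally show ?thesis .
  qed
  then show ?thesis by (simp add: below_def)
qed

lemma finite_below: "n \<ge> 2 \<Longrightarrow> finite (below n b)"
proof (cases "b > 0")
  case True
  assume "n \<ge> 2"
  then show ?thesis
    unfolding below_position[OF True] by (rule finite_subset[OF _ finite_position, rotated]) auto
next
  case False
  then have "below n b = {}" using W_pos[of n] by (auto simp: below_def) (meson less_trans)
  then show ?thesis by simp
qed

lemma prob_U_less:
  assumes i: "i \<ge> 1" and n: "n \<ge> 1" and a: "a > 0" and b: "beta \<gamma> n - ln a \<ge> 0"
  shows "\<P>(\<omega> in M. U n i \<omega> < a) = tail (- ln a) n i"
proof -
  have vi: "v (real i) > 0" "v (real n) > 0" using v_pos i n by auto
  define y where "y = (beta \<gamma> n - ln a) * (v (real n) / v (real i))"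
  have "U n i \<omega> < a \<longleftrightarrow> y < X i \<omega>" for \<omega>
  proof -
    have "U n i \<omega> < a \<longleftrightarrow> ln (U n i \<omega>) < ln a" using a U_pos by simp
    also have "\<dots> \<longleftrightarrow> beta \<gamma> n - ln a < v (real i) * X i \<omega> / v (real n)"
      by (simp add: U_def height_def algebra_simps)
    also have "\<dots> \<longleftrightarrow> y < X i \<omega>" using vi by (simp add: y_def field_simps)
    finally show ?thesis .
  qed
  then have "\<P>(\<omega> in M. U n i \<omega> < a) = \<P>(\<omega> in M. y < X i \<omega>)" by simp
  also have "\<dots> = exp (- y * 1)"
    using vi b by (intro exponential_distributedD_gt[OF expo[OF i]]) (auto simp: y_def)
  also have "- y * 1 = - (beta \<gamma> n + - ln a) * (v (real n) / v (real i))"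
    unfolding y_def by (simp only: mult_1_right minus_mult_left diff_conv_add_uminus)
  finally show ?thesis by (simp only: tail_def)
qed

lemma beta_large: "\<forall>\<^sub>F n in sequentially. n \<ge> 2 \<and> beta \<gamma> n - x \<ge> 0"
proof -
  have "\<forall>\<^sub>F n in sequentially. (beta \<gamma> n + (- x)) / ln (real n) > 1 / 2"
    by (rule order_tendstoD[OF beta_asymp]) simp
  with eventually_ge_at_top[of 2] show ?thesis
  proof eventually_elim
    case (elim n)
    then have "(beta \<gamma> n + (- x)) / ln (real n) > 0" by (intro less_trans[OF _ elim(2)]) simp
    moreover have "ln (real n) > 0" using elim by simp
    ultimately show ?case using elim by (simp add: zero_less_divide_iff)
  qed
qed

text \<open>
  The Riemann sum in the new coordinates: the limiting mean number of points in the box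
  \<open>[0, a) \<times> [0, b)\<close> is its area.
\<close>
lemma mean_limit:
  assumes a: "a \<ge> 0" and b: "b \<ge> 0"
  shows "(\<lambda>n. \<Sum>i\<in>below n b. \<P>(\<omega> in M. U n i \<omega> < a)) \<longlonglongrightarrow> a * b"
proof (cases "a = 0 \<or> b = 0")
  case True
  moreover have "\<P>(\<omega> in M. U n i \<omega> < 0) = 0" for n i
  proof -
    have "{\<omega> \<in> space M. U n i \<omega> < 0} = {}" using U_pos[of n i] by (auto simp: not_less less_imp_le)
    then show ?thesis by (simp only: measure_empty)
  qed
  moreover have "below n 0 = {}" for n using W_pos[of n] by (auto simp: below_def not_less less_imp_le)
  ultimately show ?thesis by auto
next
  case False
  then have ab: "a > 0" "b > 0" using assms by auto
  have "(\<lambda>n. \<Sum>i | 1 \<le> i \<and> - ln b / \<gamma> < position n i. tail (- ln a) n i)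
      \<longlonglongrightarrow> exp (- (- ln a)) * exp (- \<gamma> * (- ln b / \<gamma>))"
    by (rule tail_sum_limit)
  moreover have "exp (- (- ln a)) * exp (- \<gamma> * (- ln b / \<gamma>)) = a * b"
    using gamma_pos ab by simp
  moreover have "\<forall>\<^sub>F n in sequentially. (\<Sum>i | 1 \<le> i \<and> - ln b / \<gamma> < position n i. tail (- ln a) n i) =
      (\<Sum>i\<in>below n b. \<P>(\<omega> in M. U n i \<omega> < a))"
    using beta_large[of "ln a"]
    by eventually_elim (auto simp: below_position[OF ab(2)] prob_U_less[OF _ _ ab(1)] intro!: sum.cong)
  ultimately show ?thesis by (auto intro: Lim_transform_eventually)
qed

lemma uniformly_small:
  assumes "a > 0" "b > 0" "e > 0"
  shows "\<forall>\<^sub>F n in sequentially. \<forall>i\<in>below n b. \<P>(\<omega> in M. U n i \<omega> < a) \<le> e"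
  using tail_uniformly_small[OF \<open>e > 0\<close>, of "- ln b / \<gamma>" "- ln a"] beta_large[of "ln a"]
  by eventually_elim (auto simp: below_position[OF assms(2)] prob_U_less[OF _ _ assms(1)])

lemma hits_measurable: "i \<ge> 1 \<Longrightarrow> {\<omega> \<in> space M. hits n m i c \<omega>} \<in> events"
proof -
  assume i: "i \<ge> 1"
  obtain j k where c: "c = (j, k)" by (cases c)
  have [measurable]: "U n i \<in> borel_measurable M" using U_measurable[OF i] .
  have "0 \<le> U n i \<omega>" "0 \<le> W n i" for \<omega> using U_pos[of n i \<omega>] W_pos[of n i] by simp_all
  then show ?thesis unfolding hits_def c by (simp add: cell_eq_iff)
qed

lemma prob_hits:
  assumes i: "i \<ge> 1"
  shows "\<P>(\<omega> in M. hits n m i (j, k) \<omega>) =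
    (if real k / 2 ^ m \<le> W n i \<and> W n i < real (Suc k) / 2 ^ m then
       \<P>(\<omega> in M. U n i \<omega> < real (Suc j) / 2 ^ m) - \<P>(\<omega> in M. U n i \<omega> < real j / 2 ^ m)
     else 0)"
proof -
  have [measurable]: "U n i \<in> borel_measurable M" using U_measurable[OF i] .
  have nn: "0 \<le> U n i \<omega>" "0 \<le> W n i" for \<omega> using U_pos[of n i \<omega>] W_pos[of n i] by simp_all
  have "\<P>(\<omega> in M. real j / 2 ^ m \<le> U n i \<omega> \<and> U n i \<omega> < real (Suc j) / 2 ^ m) =
      prob ({\<omega> \<in> space M. U n i \<omega> < real (Suc j) / 2 ^ m} - {\<omega> \<in> space M. U n i \<omega> < real j / 2 ^ m})"
    by (intro arg_cong[where f = prob]) auto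
  also have "\<dots> = \<P>(\<omega> in M. U n i \<omega> < real (Suc j) / 2 ^ m) - \<P>(\<omega> in M. U n i \<omega> < real j / 2 ^ m)"
  proof (rule finite_measure_Diff)
    have "real j / 2 ^ m \<le> real (Suc j) / 2 ^ m" by (intro divide_right_mono) auto
    then show "{\<omega> \<in> space M. U n i \<omega> < real j / 2 ^ m} \<subseteq> {\<omega> \<in> space M. U n i \<omega> < real (Suc j) / 2 ^ m}"
      by auto
  qed auto
  finally show ?thesis unfolding hits_def cell_eq_iff[OF nn] by auto
qed

lemma below_mono: "b \<le> b' \<Longrightarrow> below n b \<subseteq> below n b'"
  by (auto simp: below_def)

lemma below_ge_1: "i \<in> below n b \<Longrightarrow> 1 \<le> i"
  by (simp add: below_def)

text \<open>
  A cell is an alternating combination of four boxes, each of which has its area as limiting mean.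
\<close>
lemma sum_prob_hits_limit:
  assumes B: "real (Suc k) / 2 ^ m \<le> B"
  shows "(\<lambda>n. \<Sum>i\<in>below n B. \<P>(\<omega> in M. hits n m i (j, k) \<omega>)) \<longlonglongrightarrow> (1 / 4) ^ m"
proof -
  define h :: real where "h = 1 / 2 ^ m"
  define P where "P n i a = \<P>(\<omega> in M. U n i \<omega> < a)" for n i a
  define S where "S n a b = (\<Sum>i\<in>below n b. P n i a)" for n a b
  have kk: "real k / 2 ^ m \<le> real (Suc k) / 2 ^ m" by (intro divide_right_mono) auto
  have "(\<lambda>n. (S n (real (Suc j) / 2 ^ m) (real (Suc k) / 2 ^ m) - S n (real j / 2 ^ m) (real (Suc k) / 2 ^ m)) -
     (S n (real (Suc j) / 2 ^ m) (real k / 2 ^ m) - S n (real j / 2 ^ m) (real k / 2 ^ m)))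
     \<longlonglongrightarrow> ((real (Suc j) / 2 ^ m) * (real (Suc k) / 2 ^ m) - (real j / 2 ^ m) * (real (Suc k) / 2 ^ m)) -
     ((real (Suc j) / 2 ^ m) * (real k / 2 ^ m) - (real j / 2 ^ m) * (real k / 2 ^ m))"
    unfolding S_def P_def by (intro tendsto_diff mean_limit) auto
  moreover have "((real (Suc j) / 2 ^ m) * (real (Suc k) / 2 ^ m) - (real j / 2 ^ m) * (real (Suc k) / 2 ^ m)) -
     ((real (Suc j) / 2 ^ m) * (real k / 2 ^ m) - (real j / 2 ^ m) * (real k / 2 ^ m)) = (1 / 4 :: real) ^ m"
  proof -
    have "(1 / 4 :: real) ^ m = h * h" by (simp add: h_def power_one_over power_mult_distrib[symmetric])
    moreover have "x / 2 ^ m = x * h" for x by (simp add: h_def)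
    ultimately show ?thesis by (simp add: algebra_simps)
  qed
  moreover have "\<forall>\<^sub>F n in sequentially. (S n (real (Suc j) / 2 ^ m) (real (Suc k) / 2 ^ m) - S n (real j / 2 ^ m) (real (Suc k) / 2 ^ m)) -
     (S n (real (Suc j) / 2 ^ m) (real k / 2 ^ m) - S n (real j / 2 ^ m) (real k / 2 ^ m)) =
     (\<Sum>i\<in>below n B. \<P>(\<omega> in M. hits n m i (j, k) \<omega>))"
    using eventually_ge_at_top[of 2]
  proof eventually_elim
    case (elim n)
    define d where "d i = P n i (real (Suc j) / 2 ^ m) - P n i (real j / 2 ^ m)" for i
    have "(\<Sum>i\<in>below n B. \<P>(\<omega> in M. hits n m i (j, k) \<omega>)) =
        (\<Sum>i\<in>below n (real (Suc k) / 2 ^ m) - below n (real k / 2 ^ m). \<P>(\<omega> in M. hits n m i (j, k) \<omega>))"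
    proof (rule sum.mono_neutral_right[OF finite_below[OF elim]])
      show "below n (real (Suc k) / 2 ^ m) - below n (real k / 2 ^ m) \<subseteq> below n B"
        using below_mono[OF B] by blast
      show "\<forall>i\<in>below n B - (below n (real (Suc k) / 2 ^ m) - below n (real k / 2 ^ m)).
          \<P>(\<omega> in M. hits n m i (j, k) \<omega>) = 0"
      proof
        fix i assume "i \<in> below n B - (below n (real (Suc k) / 2 ^ m) - below n (real k / 2 ^ m))"
        then have "1 \<le> i" "\<not> (real k / 2 ^ m \<le> W n i \<and> W n i < real (Suc k) / 2 ^ m)"
          unfolding below_def by auto
        then show "\<P>(\<omega> in M. hits n m i (j, k) \<omega>) = 0" by (simp only: prob_hits if_False)
      qed
    qed
    also have "\<dots> = (\<Sum>i\<in>below n (real (Suc k) / 2 ^ m) - below n (real k / 2 ^ m). d i)"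
    proof (intro sum.cong refl)
      fix i assume "i \<in> below n (real (Suc k) / 2 ^ m) - below n (real k / 2 ^ m)"
      then have "1 \<le> i" "real k / 2 ^ m \<le> W n i \<and> W n i < real (Suc k) / 2 ^ m"
        unfolding below_def by auto
      then show "\<P>(\<omega> in M. hits n m i (j, k) \<omega>) = d i"
        by (simp only: prob_hits if_True d_def P_def simp_thms)
    qed
    also have "\<dots> = (\<Sum>i\<in>below n (real (Suc k) / 2 ^ m). d i) - (\<Sum>i\<in>below n (real k / 2 ^ m). d i)"
      using below_mono[OF kk] by (intro sum_diff finite_below elim)
    finally show ?case by (simp add: S_def d_def sum_subtractf)
  qed
  ultimately show ?thesis by (auto intro: Lim_transform_eventually)
qed

lemma hits_small:
  assumes "b > 0" "e > 0"
  shows "\<forall>\<^sub>F n in sequentially. \<forall>i\<in>below n b. \<P>(\<omega> in M. hits n m i c \<omega>) \<le> e"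
proof -
  obtain j k where c: "c = (j, k)" by (cases c)
  have "real (Suc j) / 2 ^ m > 0" by simp
  from uniformly_small[OF this assms] show ?thesis
  proof eventually_elim
    case (elim n)
    show ?case
    proof
      fix i assume i: "i \<in> below n b"
      have "\<P>(\<omega> in M. hits n m i c \<omega>) \<le> \<P>(\<omega> in M. U n i \<omega> < real (Suc j) / 2 ^ m)"
        unfolding c prob_hits[OF below_ge_1[OF i]] by simp
      also have "\<dots> \<le> e" using elim i by blast
      finally show "\<P>(\<omega> in M. hits n m i c \<omega>) \<le> e" .
    qed
  qed
qed

lemma indep_cells:
  assumes "finite J" "J \<noteq> {}" "\<And>i. i \<in> J \<Longrightarrow> 1 \<le> i"
  shows "\<P>(\<omega> in M. \<forall>i\<in>J. cell m (U n i \<omega>) (W n i) \<in> Z) =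
    (\<Prod>i\<in>J. \<P>(\<omega> in M. cell m (U n i \<omega>) (W n i) \<in> Z))"
proof -
  define Y where "Y i = {x. cell m (exp (- height n i x)) (W n i) \<in> Z}" for i
  have "Y i \<in> sets borel" for i
  proof -
    have "(\<lambda>x. cell m (exp (- height n i x)) (W n i)) \<in> measurable borel (count_space UNIV)"
      unfolding cell_def height_def by measurable
    from measurable_sets[OF this, of Z] show ?thesis by (simp add: Y_def vimage_def)
  qed
  then have "prob (\<Inter>i\<in>J. X i -` Y i \<inter> space M) = (\<Prod>i\<in>J. prob (X i -` Y i \<inter> space M))"
    using assms by (intro indep_varsD[OF indep]) auto
  moreover have "(\<Inter>i\<in>J. X i -` Y i \<inter> space M) = {\<omega> \<in> space M. \<forall>i\<in>J. cell m (U n i \<omega>) (W n i) \<in> Z}"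
    using assms(2) by (auto simp: Y_def U_def)
  moreover have "X i -` Y i \<inter> space M = {\<omega> \<in> space M. cell m (U n i \<omega>) (W n i) \<in> Z}" for i
    by (auto simp: Y_def U_def)
  ultimately show ?thesis by simp
qed

definition hit :: "nat \<Rightarrow> nat \<Rightarrow> nat \<times> nat \<Rightarrow> 'a \<Rightarrow> bool" where
  "hit n m c \<omega> \<longleftrightarrow> (\<exists>i\<ge>1. hits n m i c \<omega>)"

lemma hit_measurable: "{\<omega> \<in> space M. hit n m c \<omega>} \<in> events"
proof -
  have "{\<omega> \<in> space M. hit n m c \<omega>} = (\<Union>i\<in>{1..}. {\<omega> \<in> space M. hits n m i c \<omega>})"
    by (auto simp: hit_def)
  also have "\<dots> \<in> events" by (intro sets.countable_UN) (auto intro!: hits_measurable)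
  finally show ?thesis .
qed

lemma hits_below: "hits n m i (j, k) \<omega> \<Longrightarrow> 1 \<le> i \<Longrightarrow> real (Suc k) / 2 ^ m \<le> B \<Longrightarrow> i \<in> below n B"
  using U_pos[of n i \<omega>] W_pos[of n i] by (auto simp: hits_def cell_eq_iff below_def)

text \<open>
  The points are independent, so the avoidance probability is the product of the factors \<open>1 - p n i\<close>,
  where \<open>p n i\<close> is the probability that the \<open>i\<close>-th point falls into a cell of \<open>Z\<close>.
\<close>
lemma avoid_limit:
  assumes "finite Z"
  shows "(\<lambda>n. \<P>(\<omega> in M. \<forall>c\<in>Z. \<not> hit n m c \<omega>)) \<longlonglongrightarrow> exp (- ((1 / 4) ^ m) * real (card Z))"
proof -
  \<comment> \<open>A strip that contains all cells of \<open>Z\<close>; the 1 keeps it nonempty when \<open>Z\<close> is empty.\<close>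
  define B where "B = Max (insert 1 ((\<lambda>c. real (Suc (snd c)) / 2 ^ m) ` Z))"
  have B1: "B \<ge> 1" unfolding B_def using assms by (intro Max_ge) auto
  then have B0: "B > 0" by simp
  have B: "real (Suc k) / 2 ^ m \<le> B" if "(j, k) \<in> Z" for j k
    unfolding B_def using assms that by (intro Max_ge) force+
  define p where "p n i = (\<Sum>c\<in>Z. \<P>(\<omega> in M. hits n m i c \<omega>))" for n i
  have "(\<lambda>n. \<Prod>i\<in>below n B. 1 - p n i) \<longlonglongrightarrow> exp (- (real (card Z) * (1 / 4) ^ m))"
  proof (rule prod_one_minus_limit)
    show "0 \<le> p n i" for n i by (simp add: p_def sum_nonneg)
    show "\<forall>\<^sub>F n in sequentially. \<forall>i\<in>below n B. p n i \<le> e" if e: "e > 0" for e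
    proof -
      have "e / (real (card Z) + 1) > 0" using e by simp
      then have "\<forall>\<^sub>F n in sequentially. \<forall>c\<in>Z. \<forall>i\<in>below n B. \<P>(\<omega> in M. hits n m i c \<omega>) \<le> e / (real (card Z) + 1)"
        using assms B0 by (intro eventually_ball_finite ballI hits_small) auto
      then show ?thesis
      proof eventually_elim
        case (elim n)
        show ?case
        proof
          fix i assume "i \<in> below n B"
          then have "p n i \<le> (\<Sum>c\<in>Z. e / (real (card Z) + 1))" unfolding p_def using elim by (intro sum_mono) auto
          also have "\<dots> \<le> e" using e by (simp add: field_simps)
          finally show "p n i \<le> e" .
        qed
      qed
    qed
    have "(\<lambda>n. \<Sum>c\<in>Z. \<Sum>i\<in>below n B. \<P>(\<omega> in M. hits n m i c \<omega>)) \<longlonglongrightarrow> (\<Sum>c\<in>Z. (1 / 4) ^ m)"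
    proof (rule tendsto_sum)
      fix c assume "c \<in> Z"
      then show "(\<lambda>n. \<Sum>i\<in>below n B. \<P>(\<omega> in M. hits n m i c \<omega>)) \<longlonglongrightarrow> (1 / 4) ^ m"
        using B by (cases c) (auto intro: sum_prob_hits_limit)
    qed
    then show "(\<lambda>n. \<Sum>i\<in>below n B. p n i) \<longlonglongrightarrow> real (card Z) * (1 / 4) ^ m"
      unfolding p_def by (subst sum.swap) simp
  qed
  moreover have "\<forall>\<^sub>F n in sequentially. (\<Prod>i\<in>below n B. 1 - p n i) = \<P>(\<omega> in M. \<forall>c\<in>Z. \<not> hit n m c \<omega>)"
    using eventually_ge_at_top[of 2]
  proof eventually_elim
    case (elim n)
    have eq: "{\<omega> \<in> space M. \<forall>c\<in>Z. \<not> hit n m c \<omega>} =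
        {\<omega> \<in> space M. \<forall>i\<in>below n B. cell m (U n i \<omega>) (W n i) \<in> - Z}"
    proof -
      have "(\<forall>c\<in>Z. \<not> hit n m c \<omega>) \<longleftrightarrow> (\<forall>i\<in>below n B. cell m (U n i \<omega>) (W n i) \<in> - Z)" for \<omega>
      proof
        assume "\<forall>c\<in>Z. \<not> hit n m c \<omega>"
        then show "\<forall>i\<in>below n B. cell m (U n i \<omega>) (W n i) \<in> - Z"
          unfolding hit_def hits_def using below_ge_1 by blast
      next
        assume a: "\<forall>i\<in>below n B. cell m (U n i \<omega>) (W n i) \<in> - Z"
        show "\<forall>c\<in>Z. \<not> hit n m c \<omega>"
        proof (intro ballI notI)
          fix c assume c: "c \<in> Z" "hit n m c \<omega>"
          then obtain i where i: "1 \<le> i" "hits n m i c \<omega>" by (auto simp: hit_def)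
          then have "i \<in> below n B" using B c(1) hits_below by (cases c) blast
          then show False using a i c by (auto simp: hits_def)
        qed
      qed
      then show ?thesis by blast
    qed
    have one: "\<P>(\<omega> in M. cell m (U n i \<omega>) (W n i) \<in> - Z) = 1 - p n i" if i: "i \<ge> 1" for i
    proof -
      have E: "{\<omega> \<in> space M. cell m (U n i \<omega>) (W n i) \<in> Z} = (\<Union>c\<in>Z. {\<omega> \<in> space M. hits n m i c \<omega>})"
        by (auto simp: hits_def)
      have "prob (\<Union>c\<in>Z. {\<omega> \<in> space M. hits n m i c \<omega>}) = p n i"
        unfolding p_def using hits_measurable[OF i] assms
        by (intro finite_measure_finite_Union) (auto simp: disjoint_family_on_def hits_def)
      moreover have "{\<omega> \<in> space M. cell m (U n i \<omega>) (W n i) \<in> - Z} =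
          space M - (\<Union>c\<in>Z. {\<omega> \<in> space M. hits n m i c \<omega>})" by (auto simp: hits_def)
      moreover have "(\<Union>c\<in>Z. {\<omega> \<in> space M. hits n m i c \<omega>}) \<in> events"
        using hits_measurable[OF i] assms by (intro sets.finite_UN) auto
      ultimately show ?thesis by (simp add: prob_compl)
    qed
    show ?case
    proof (cases "below n B = {}")
      case True
      then show ?thesis unfolding eq by (simp add: prob_space)
    next
      case False
      have "(\<Prod>i\<in>below n B. 1 - p n i) = (\<Prod>i\<in>below n B. \<P>(\<omega> in M. cell m (U n i \<omega>) (W n i) \<in> - Z))"
        by (intro prod.cong refl one[symmetric]) (rule below_ge_1)
      also have "\<dots> = \<P>(\<omega> in M. \<forall>i\<in>below n B. cell m (U n i \<omega>) (W n i) \<in> - Z)"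
        by (rule indep_cells[OF finite_below[OF elim] False below_ge_1, symmetric])
      finally show ?thesis unfolding eq .
    qed
  qed
  ultimately show ?thesis by (simp add: Lim_transform_eventually mult.commute)
qed

lemma hit_pattern_limit:
  assumes "finite S" "finite Z" "Z \<inter> S = {}"
  shows "(\<lambda>n. \<P>(\<omega> in M. (\<forall>c\<in>Z. \<not> hit n m c \<omega>) \<and> (\<forall>c\<in>S. hit n m c \<omega>)))
    \<longlonglongrightarrow> exp (- ((1 / 4) ^ m) * real (card Z)) * (1 - exp (- ((1 / 4) ^ m))) ^ card S"
  using hit_measurable avoid_limit assms prob_space_axioms
  by (intro hit_avoid_limit) auto

definition double :: "nat \<Rightarrow> nat \<Rightarrow> nat \<times> nat \<Rightarrow> 'a \<Rightarrow> bool" where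
  "double n m c \<omega> \<longleftrightarrow> (\<exists>i i'. 1 \<le> i \<and> i < i' \<and> hits n m i c \<omega> \<and> hits n m i' c \<omega>)"

lemma double_measurable: "{\<omega> \<in> space M. double n m c \<omega>} \<in> events"
proof -
  have "{\<omega> \<in> space M. double n m c \<omega>} = (\<Union>p\<in>{p. 1 \<le> fst p \<and> fst p < snd p}.
      {\<omega> \<in> space M. hits n m (fst p) c \<omega>} \<inter> {\<omega> \<in> space M. hits n m (snd p) c \<omega>})"
    by (auto simp: double_def) blast
  also have "\<dots> \<in> events" by (intro sets.countable_UN' sets.Int) (auto intro!: hits_measurable)
  finally show ?thesis .
qed

text \<open>
  The union bound over pairs of independent points gives the square of the mean number of points.
\<close>
lemma double_rare:
  assumes "e > 0"
  shows "\<forall>\<^sub>F n in sequentially. \<P>(\<omega> in M. double n m c \<omega>) \<le> ((1 / 4) ^ m)\<^sup>2 + e"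
proof -
  obtain j k where c: "c = (j, k)" by (cases c)
  define B where "B = real (Suc k) / 2 ^ m"
  define p where "p n i = \<P>(\<omega> in M. hits n m i c \<omega>)" for n i
  have "(\<lambda>n. (\<Sum>i\<in>below n B. p n i)\<^sup>2) \<longlonglongrightarrow> ((1 / 4) ^ m)\<^sup>2"
    unfolding p_def c by (intro tendsto_power sum_prob_hits_limit) (simp add: B_def)
  then have "\<forall>\<^sub>F n in sequentially. (\<Sum>i\<in>below n B. p n i)\<^sup>2 < ((1 / 4) ^ m)\<^sup>2 + e"
    by (rule order_tendstoD) (use assms in simp)
  with eventually_ge_at_top[of 2] show ?thesis
  proof eventually_elim
    case (elim n)
    define I where "I = below n B"
    have fin: "finite I" unfolding I_def by (rule finite_below[OF elim(1)])
    have pair: "\<P>(\<omega> in M. hits n m (fst q) c \<omega> \<and> hits n m (snd q) c \<omega>) = p n (fst q) * p n (snd q)"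
      if "q \<in> {q \<in> I \<times> I. fst q < snd q}" for q
    proof -
      have "\<P>(\<omega> in M. \<forall>i\<in>{fst q, snd q}. cell m (U n i \<omega>) (W n i) \<in> {c}) =
          (\<Prod>i\<in>{fst q, snd q}. \<P>(\<omega> in M. cell m (U n i \<omega>) (W n i) \<in> {c}))"
        using that by (intro indep_cells) (auto simp: I_def below_def)
      then show ?thesis using that by (simp add: p_def hits_def)
    qed
    have eq: "{\<omega> \<in> space M. double n m c \<omega>} =
        (\<Union>q\<in>{q \<in> I \<times> I. fst q < snd q}. {\<omega> \<in> space M. hits n m (fst q) c \<omega> \<and> hits n m (snd q) c \<omega>})"
    proof -
      have "i \<in> I" if "hits n m i c \<omega>" "1 \<le> i" for i \<omega>
        unfolding I_def by (rule hits_below[OF that[unfolded c]]) (simp add: B_def)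
      then have "double n m c \<omega> \<longleftrightarrow> (\<exists>i\<in>I. \<exists>i'\<in>I. i < i' \<and> hits n m i c \<omega> \<and> hits n m i' c \<omega>)" for \<omega>
        unfolding double_def I_def by (meson below_ge_1 le_trans less_imp_le)
      then show ?thesis by (simp only:) (auto; blast)
    qed
    have "\<P>(\<omega> in M. double n m c \<omega>) \<le> (\<Sum>q\<in>{q \<in> I \<times> I. fst q < snd q}. \<P>(\<omega> in M. hits n m (fst q) c \<omega> \<and> hits n m (snd q) c \<omega>))"
      unfolding eq using fin by (intro finite_measure_subadditive_finite)
        (auto simp: I_def below_def intro!: sets.sets_Collect_conj hits_measurable)
    also have "\<dots> = (\<Sum>q\<in>{q \<in> I \<times> I. fst q < snd q}. p n (fst q) * p n (snd q))"
      by (intro sum.cong refl pair)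
    also have "\<dots> \<le> (\<Sum>q\<in>I \<times> I. p n (fst q) * p n (snd q))"
      using fin by (intro sum_mono2) (auto simp: p_def)
    also have "\<dots> = (\<Sum>i\<in>I. p n i)\<^sup>2"
      unfolding power2_eq_square sum_product by (simp add: sum.cartesian_product case_prod_beta)
    also have "\<dots> \<le> ((1 / 4) ^ m)\<^sup>2 + e" using elim by (simp add: I_def)
    finally show ?case .
  qed
qed

text \<open>
  The point with index \<open>n\<close> lies on the edge \<open>W = 1\<close>, outside every cell below that edge, but it competes
  for the maximum; it is negligible on its own.
\<close>
lemma last_point_small:
  assumes "a > 0" "e > 0"
  shows "\<forall>\<^sub>F n in sequentially. \<P>(\<omega> in M. U n n \<omega> < a) \<le> e"
proof -
  have "(0::real) < 2" by simp
  from uniformly_small[OF assms(1) this assms(2)] eventually_ge_at_top[of 1] show ?thesis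
  proof eventually_elim
    case (elim n)
    have "n \<in> below n 2" using elim(2) by (simp add: below_def W_def position_def)
    then show ?case using elim(1) by blast
  qed
qed

end

section \<open>The maximum and its time\<close>

lemma cell_near:
  assumes "cell m u w = cell m u' w'" "u > 0" "w > 0" "u' > 0" "w' > 0"
  shows "\<bar>u - u'\<bar> < 1 / 2 ^ m \<and> \<bar>w - w'\<bar> < 1 / 2 ^ m"
proof -
  obtain j k where c: "cell m u w = (j, k)" by fastforce
  have s: "real (Suc i) / 2 ^ m = real i / 2 ^ m + 1 / 2 ^ m" for i by (simp add: add_divide_distrib)
  have "real j / 2 ^ m \<le> u \<and> u < real (Suc j) / 2 ^ m \<and> real k / 2 ^ m \<le> w \<and> w < real (Suc k) / 2 ^ m"
    using c assms by (subst (asm) cell_eq_iff) auto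
  moreover have "cell m u' w' = (j, k)" using c assms by simp
  then have "real j / 2 ^ m \<le> u' \<and> u' < real (Suc j) / 2 ^ m \<and> real k / 2 ^ m \<le> w' \<and> w' < real (Suc k) / 2 ^ m"
    using assms by (subst (asm) cell_eq_iff) auto
  ultimately show ?thesis unfolding s by linarith
qed

lemma half_power_small:
  assumes "d > 0" shows "\<forall>\<^sub>F m in sequentially. 1 / 2 ^ m < (d::real)"
proof -
  have "(\<lambda>m. (1 / 2 :: real) ^ m) \<longlonglongrightarrow> 0" by (intro LIMSEQ_power_zero) auto
  from order_tendstoD(2)[OF this assms] show ?thesis by (simp add: power_one_over)
qed

context weighted_exponentials
begin

lemma Mstar_ge: "1 \<le> i \<Longrightarrow> i \<le> n \<Longrightarrow> v (real i) * X i \<omega> \<le> Mstar v X n \<omega>"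
  unfolding Mstar_def by (intro Max_ge) auto

lemma taustar_spec:
  assumes "n \<ge> 1"
  shows "1 \<le> taustar v X n \<omega>" "taustar v X n \<omega> \<le> n"
    "v (real (taustar v X n \<omega>)) * X (taustar v X n \<omega>) \<omega> = Mstar v X n \<omega>"
proof -
  have "Mstar v X n \<omega> \<in> (\<lambda>i. v (real i) * X i \<omega>) ` {1..n}"
    unfolding Mstar_def using assms by (intro Max_in) auto
  then have "{i \<in> {1..n}. v (real i) * X i \<omega> = Mstar v X n \<omega>} \<noteq> {}" by auto
  then have "taustar v X n \<omega> \<in> {i \<in> {1..n}. v (real i) * X i \<omega> = Mstar v X n \<omega>}"
    unfolding taustar_def by (intro Min_in) auto
  then show "1 \<le> taustar v X n \<omega>" "taustar v X n \<omega> \<le> n"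
    "v (real (taustar v X n \<omega>)) * X (taustar v X n \<omega>) \<omega> = Mstar v X n \<omega>" by auto
qed

lemma Mstar_measurable:
  assumes "n \<ge> 1" shows "Mstar v X n \<in> borel_measurable M"
proof -
  have "(\<lambda>\<omega>. v (real i) * X i \<omega>) \<in> borel_measurable M" if "i \<in> {1..n}" for i
    using X_measurable[of i] that by (intro borel_measurable_times) auto
  then show ?thesis unfolding Mstar_def[abs_def] using assms by (intro borel_measurable_Max) auto
qed

lemma taustar_measurable:
  assumes "n \<ge> 1" shows "taustar v X n \<in> measurable M (count_space UNIV)"
proof -
  have eq: "taustar v X n = (\<lambda>\<omega>. LEAST i. i \<in> {1..n} \<and> v (real i) * X i \<omega> = Mstar v X n \<omega>)"
  proof
    fix \<omega>
    have "Mstar v X n \<omega> \<in> (\<lambda>i. v (real i) * X i \<omega>) ` {1..n}"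
      unfolding Mstar_def using assms by (intro Max_in) auto
    then have "\<exists>i. i \<in> {1..n} \<and> v (real i) * X i \<omega> = Mstar v X n \<omega>" by auto
    then show "taustar v X n \<omega> = (LEAST i. i \<in> {1..n} \<and> v (real i) * X i \<omega> = Mstar v X n \<omega>)"
      unfolding taustar_def by (intro Least_Min[symmetric]) auto
  qed
  have [measurable]: "Mstar v X n \<in> borel_measurable M" by (rule Mstar_measurable[OF assms])
  show ?thesis unfolding eq
  proof (rule measurable_Least)
    fix i
    show "(\<lambda>\<omega>. i \<in> {1..n} \<and> v (real i) * X i \<omega> = Mstar v X n \<omega>) \<in> measurable M (count_space UNIV)"
    proof (cases "i \<in> {1..n}")
      case True
      then have [measurable]: "X i \<in> borel_measurable M" using X_measurable by simp
      show ?thesis by measurable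
    next
      case False
      then have "(\<lambda>\<omega>. i \<in> {1..n} \<and> v (real i) * X i \<omega> = Mstar v X n \<omega>) = (\<lambda>_. False)" by blast
      then show ?thesis by (simp only: measurable_const space_count_space UNIV_I)
    qed
  qed
qed

definition argmax_cell :: "nat \<Rightarrow> nat \<Rightarrow> 'a \<Rightarrow> nat \<times> nat" where
  "argmax_cell n m \<omega> = cell m (U n (taustar v X n \<omega>) \<omega>) (W n (taustar v X n \<omega>))"

lemma U_taustar: "n \<ge> 1 \<Longrightarrow> U n (taustar v X n \<omega>) \<omega> = exp (- (Mstar v X n \<omega> / v (real n) - beta \<gamma> n))"
  by (simp add: U_def height_def taustar_spec)

lemma argmax_cell_measurable:
  assumes "n \<ge> 1" shows "{\<omega> \<in> space M. argmax_cell n m \<omega> \<in> C} \<in> events"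
proof -
  have [measurable]: "Mstar v X n \<in> borel_measurable M" by (rule Mstar_measurable[OF assms])
  have [measurable]: "taustar v X n \<in> measurable M (count_space UNIV)" by (rule taustar_measurable[OF assms])
  have "(\<lambda>\<omega>. cell m (exp (- (Mstar v X n \<omega> / v (real n) - beta \<gamma> n))) (W n (taustar v X n \<omega>)))
      \<in> measurable M (count_space UNIV)"
    unfolding cell_def by measurable
  from measurable_sets[OF this, of C] show ?thesis
    by (simp add: argmax_cell_def U_taustar[OF assms] vimage_def Int_def conj_commute)
qed

text \<open>
  The cells with \<open>W < 1\<close> that could contain a point with a smaller \<open>U\<close> than a given point of the cell
  \<open>c\<close>. Only whole columns are compared, so cells of the same column count as rivals.
\<close>
definition rivals :: "nat \<Rightarrow> nat \<times> nat \<Rightarrow> (nat \<times> nat) set" where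
  "rivals m c = ({..fst c} \<times> {..<2 ^ m}) - {c}"

lemma card_rivals: "k < 2 ^ m \<Longrightarrow> real (card (rivals m (j, k))) = real (Suc j) * 2 ^ m - 1"
proof -
  assume "k < 2 ^ m"
  then have "card (rivals m (j, k)) = Suc j * 2 ^ m - 1"
    unfolding rivals_def by (subst card_Diff_singleton) auto
  moreover have "1 \<le> Suc j * 2 ^ m" unfolding One_nat_def by (rule Suc_leI) simp
  ultimately have "real (card (rivals m (j, k))) = real (Suc j * 2 ^ m) - 1" by (simp only: of_nat_diff of_nat_1)
  then show ?thesis by (simp add: distrib_right)
qed

lemma W_less_1_iff: "n \<ge> 2 \<Longrightarrow> W n i < 1 \<longleftrightarrow> i < n"
proof -
  assume n: "n \<ge> 2"
  have "W n i < 1 \<longleftrightarrow> 0 < \<gamma> * position n i" by (simp add: W_def)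
  also have "\<dots> \<longleftrightarrow> 0 < position n i" using gamma_pos by (simp add: zero_less_mult_iff)
  also have "\<dots> \<longleftrightarrow> i < n" using n by (simp add: position_def zero_less_mult_iff zero_less_divide_iff)
  finally show ?thesis .
qed

lemma Suc_dyadic_le_1: "k < 2 ^ m \<Longrightarrow> real (Suc k) / 2 ^ m \<le> 1"
proof -
  assume "k < 2 ^ m"
  then have "Suc k \<le> 2 ^ m" by simp
  then have "real (Suc k) \<le> 2 ^ m" by (metis of_nat_le_iff of_nat_numeral of_nat_power)
  then show ?thesis by simp
qed

text \<open>
  The maximum is attained where \<open>U\<close> is least among the indices up to \<open>n\<close>. If \<open>(j, k)\<close> is occupied, the
  minimizing point has its first cell index at most \<open>j\<close>, and by the last assumption its index is not \<open>n\<close>,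
  so \<open>W < 1\<close>; as the rivals are empty, it lies in \<open>(j, k)\<close>.
\<close>
lemma argmax_in_lonely_cell:
  assumes n: "n \<ge> 2" and k: "k < 2 ^ m"
    and hit: "hit n m (j, k) \<omega>" and avoid: "\<forall>c\<in>rivals m (j, k). \<not> hit n m c \<omega>"
    and last: "\<not> U n n \<omega> < real (Suc j) / 2 ^ m"
  shows "argmax_cell n m \<omega> = (j, k)"
proof -
  define \<tau> where "\<tau> = taustar v X n \<omega>"
  have nn: "0 \<le> U n i \<omega>" "0 \<le> W n i" for i using U_pos[of n i \<omega>] W_pos[of n i] by simp_all
  have \<tau>: "1 \<le> \<tau>" "\<tau> \<le> n" "v (real \<tau>) * X \<tau> \<omega> = Mstar v X n \<omega>"
    using taustar_spec[of n \<omega>] n by (auto simp: \<tau>_def)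
  obtain i where i: "1 \<le> i" "hits n m i (j, k) \<omega>" using hit by (auto simp: hit_def)
  then have ic: "U n i \<omega> < real (Suc j) / 2 ^ m" "W n i < real (Suc k) / 2 ^ m"
    by (auto simp: hits_def cell_eq_iff[OF nn])
  then have "W n i < 1" using Suc_dyadic_le_1[OF k] by linarith
  then have "i < n" using W_less_1_iff[OF n] by simp
  then have "v (real i) * X i \<omega> \<le> v (real \<tau>) * X \<tau> \<omega>" using Mstar_ge i \<tau> by simp
  then have "U n \<tau> \<omega> \<le> U n i \<omega>"
    using v_pos[of "real n"] n by (simp add: U_def height_def divide_right_mono)
  then have U\<tau>: "U n \<tau> \<omega> < real (Suc j) / 2 ^ m" using ic by simp
  then have "\<tau> \<noteq> n" using last by auto
  then have W\<tau>: "W n \<tau> < 1" using \<tau> W_less_1_iff[OF n] by simp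
  obtain j' k' where c': "cell m (U n \<tau> \<omega>) (W n \<tau>) = (j', k')" by fastforce
  then have c'': "real j' / 2 ^ m \<le> U n \<tau> \<omega>" "real k' / 2 ^ m \<le> W n \<tau>"
    by (auto simp: cell_eq_iff[OF nn])
  have "real j' / 2 ^ m < real (Suc j) / 2 ^ m" using c'' U\<tau> by linarith
  then have "real j' < real (Suc j)" by (simp add: divide_less_cancel)
  then have j': "j' \<le> j" by linarith
  have "real k' / 2 ^ m < 1" using c'' W\<tau> by linarith
  then have "real k' < real (2 ^ m)" by simp
  then have k': "k' < 2 ^ m" by (simp only: of_nat_less_iff)
  have "hit n m (j', k') \<omega>" using \<tau> c' by (auto simp: hit_def hits_def)
  then have "(j', k') \<notin> rivals m (j, k)" using avoid by blast
  then show ?thesis using j' k' c' by (auto simp: rivals_def argmax_cell_def \<tau>_def)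
qed

text \<open>
  With mesh \<open>h = 1 / 2 ^ m\<close> and cell area \<open>a = h\<^sup>2\<close> there are \<open>(j + 1) / h - 1\<close> rivals, and
  \<open>1 - exp (- a) \<ge> a exp (- a)\<close>; so the limiting probability is at least \<open>exp (- (j + 1) h) h\<^sup>2\<close>. This
  is at least \<open>exp (- h)\<close> times the probability that the limit law gives to the cell.
\<close>
lemma prob_argmax_cell_lower:
  assumes k: "k < 2 ^ m" and e: "e > 0"
  shows "\<forall>\<^sub>F n in sequentially. exp (- (real (Suc j) / 2 ^ m)) * (1 / 4) ^ m - e \<le>
    \<P>(\<omega> in M. argmax_cell n m \<omega> = (j, k))"
proof -
  define a :: real where "a = (1 / 4) ^ m"
  have ah: "a * 2 ^ m = 1 / 2 ^ m"
  proof -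
    have "a * 2 ^ m = ((1 / 4) * 2) ^ m" unfolding a_def by (simp only: power_mult_distrib)
    then show ?thesis by (simp add: power_one_over)
  qed
  have lim: "(\<lambda>n. \<P>(\<omega> in M. (\<forall>c\<in>rivals m (j, k). \<not> hit n m c \<omega>) \<and> (\<forall>c\<in>{(j, k)}. hit n m c \<omega>)))
    \<longlonglongrightarrow> exp (- a * real (card (rivals m (j, k)))) * (1 - exp (- a)) ^ card {(j, k)}"
    unfolding a_def by (rule hit_pattern_limit) (auto simp: rivals_def)
  have "exp (- (real (Suc j) / 2 ^ m)) * a \<le> exp (- a * real (card (rivals m (j, k)))) * (1 - exp (- a)) ^ card {(j, k)}"
  proof -
    have "- a * real (card (rivals m (j, k))) = - (real (Suc j) / 2 ^ m) + a"
    proof -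
      have "- a * (real (Suc j) * 2 ^ m - 1) = - (real (Suc j) * (a * 2 ^ m)) + a"
        by (simp add: algebra_simps del: of_nat_Suc)
      then show ?thesis unfolding card_rivals[OF k] ah by simp
    qed
    then have "exp (- a * real (card (rivals m (j, k)))) * (1 - exp (- a)) ^ card {(j, k)} =
       exp (- (real (Suc j) / 2 ^ m)) * (exp a * (1 - exp (- a)))"
      by (simp only: exp_add) simp
    moreover have "exp a * (1 - exp (- a)) = exp a - 1" by (simp add: right_diff_distrib exp_minus)
    moreover have "a \<le> exp a - 1" using exp_ge_add_one_self[of a] by linarith
    ultimately show ?thesis by (simp add: mult_left_mono)
  qed
  then have "exp (- (real (Suc j) / 2 ^ m)) * a - e / 2 < exp (- a * real (card (rivals m (j, k)))) * (1 - exp (- a)) ^ card {(j, k)}"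
    using e by linarith
  note order_tendstoD(1)[OF lim this]
  moreover have "\<forall>\<^sub>F n in sequentially. \<P>(\<omega> in M. U n n \<omega> < real (Suc j) / 2 ^ m) \<le> e / 2"
    using e by (intro last_point_small) auto
  ultimately show ?thesis using eventually_ge_at_top[of 2]
  proof eventually_elim
    case (elim n)
    let ?A = "{\<omega> \<in> space M. (\<forall>c\<in>rivals m (j, k). \<not> hit n m c \<omega>) \<and> (\<forall>c\<in>{(j, k)}. hit n m c \<omega>)}"
    let ?L = "{\<omega> \<in> space M. U n n \<omega> < real (Suc j) / 2 ^ m}"
    let ?C = "{\<omega> \<in> space M. argmax_cell n m \<omega> = (j, k)}"
    have C: "?C \<in> events" using argmax_cell_measurable[of n m "{(j, k)}"] elim(3) by simp
    have [measurable]: "U n n \<in> borel_measurable M" using U_measurable elim(3) by simp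
    have "?A \<subseteq> ?C \<union> ?L" using argmax_in_lonely_cell[OF elim(3) k] by auto
    then have "prob ?A \<le> prob (?C \<union> ?L)" using C by (intro finite_measure_mono) auto
    also have "\<dots> \<le> prob ?C + prob ?L" using C by (intro measure_subadditive) auto
    finally show ?case using elim unfolding a_def by linarith
  qed
qed

text \<open>
  The variables \<open>exp (- G)\<close> and \<open>exp (- \<gamma> E)\<close> are independent, exponential with rate 1 and uniform on
  \<open>[0, 1]\<close>. An open set is exhausted by the dyadic cells whose image lies in it, and on each of these
  cells the prelimit has asymptotically at least \<open>exp (- h)\<close> times the mass of the limit, where \<open>h\<close>
  is the mesh.
\<close>
lemma maximum_and_time_limit:
  fixes M' :: "'b measure"
  assumes M': "prob_space M'" and ind: "prob_space.indep_var M' borel G borel E"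
    and G: "\<And>x. cdf (distr M' borel G) x = exp (- exp (- x))"
    and E: "distributed M' lborel E (exponential_density \<gamma>)"
  shows "converges_in_distribution (euclidean :: (real \<times> real) topology) M
              (\<lambda>n \<omega>. (Mstar v X n \<omega> / v (real n) - beta \<gamma> n,
                      (real n - real (taustar v X n \<omega>)) / real n * ln (real n)))
              M' (\<lambda>\<omega>. (G \<omega>, E \<omega>))"
proof -
  interpret M': prob_space M' by fact
  have [measurable]: "G \<in> borel_measurable M'" "E \<in> borel_measurable M'"
    using M'.indep_var_rv1[OF ind] M'.indep_var_rv2[OF ind] by auto
  have bo: "borel_of (euclidean :: (real \<times> real) topology) = borel"
    by (simp add: borel_of_def borel_def)
  define ptm where "ptm n \<omega> = (Mstar v X n \<omega> / v (real n) - beta \<gamma> n,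
                      (real n - real (taustar v X n \<omega>)) / real n * ln (real n))" for n \<omega>
  define inv_coord where "inv_coord p = (- ln (fst p), - ln (snd p) / \<gamma>)" for p :: "real \<times> real"
  define limcell where "limcell m \<omega> = cell m (exp (- G \<omega>)) (exp (- \<gamma> * E \<omega>))" for m \<omega>
  have limcell_meas: "{\<omega> \<in> space M'. limcell m \<omega> \<in> C} \<in> sets M'" for m C
  proof -
    have "limcell m \<in> measurable M' (count_space UNIV)" unfolding limcell_def[abs_def] cell_def by measurable
    from measurable_sets[OF this, of C] show ?thesis by (simp add: vimage_def Int_def conj_commute)
  qed
  have PG: "\<P>(\<omega> in M'. exp (- G \<omega>) < b) = 1 - exp (- b)" if "b \<ge> 0" for b
  proof (cases "b = 0")
    case True
    have "{\<omega> \<in> space M'. exp (- G \<omega>) < 0} = {}" by (auto simp: not_less)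
    then show ?thesis using True by simp
  next
    case False
    then have b: "b > 0" using that by simp
    have "exp (- x) < b \<longleftrightarrow> \<not> x \<le> - ln b" for x
    proof -
      have "exp (- x) < b \<longleftrightarrow> - x < ln b" using b by (metis exp_less_cancel_iff exp_ln)
      then show ?thesis by linarith
    qed
    then have "{\<omega> \<in> space M'. exp (- G \<omega>) < b} = space M' - G -` {.. - ln b} \<inter> space M'" by auto
    then have "\<P>(\<omega> in M'. exp (- G \<omega>) < b) = 1 - M'.prob (G -` {.. - ln b} \<inter> space M')"
      by (simp add: M'.prob_compl)
    also have "M'.prob (G -` {.. - ln b} \<inter> space M') = cdf (distr M' borel G) (- ln b)"
      by (simp add: cdf_def measure_distr)
    also have "\<dots> = exp (- b)" using b by (simp add: G)
    finally show ?thesis .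
  qed
  have PE: "\<P>(\<omega> in M'. exp (- \<gamma> * E \<omega>) < b) = b" if "0 \<le> b" "b \<le> 1" for b
  proof (cases "b = 0")
    case True
    have "{\<omega> \<in> space M'. exp (- \<gamma> * E \<omega>) < 0} = {}" by (auto simp: not_less)
    then show ?thesis using True by simp
  next
    case False
    then have b: "b > 0" using that by simp
    have "exp (- \<gamma> * x) < b \<longleftrightarrow> - ln b / \<gamma> < x" for x
    proof -
      have "exp (- \<gamma> * x) < b \<longleftrightarrow> - \<gamma> * x < ln b" using b by (metis exp_less_cancel_iff exp_ln)
      then show ?thesis unfolding pos_divide_less_eq[OF gamma_pos] by (simp add: mult.commute) linarith
    qed
    then have "\<P>(\<omega> in M'. exp (- \<gamma> * E \<omega>) < b) = \<P>(\<omega> in M'. - ln b / \<gamma> < E \<omega>)" by simp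
    also have "\<dots> = exp (- (- ln b / \<gamma>) * \<gamma>)"
      using gamma_pos b that by (intro M'.exponential_distributedD_gt[OF E]) (auto simp: field_simps)
    also have "\<dots> = b" using gamma_pos b by simp
    finally show ?thesis .
  qed
  have strip: "\<P>(\<omega> in M'. a \<le> f \<omega> \<and> f \<omega> < b) =
      \<P>(\<omega> in M'. f \<omega> < b) - \<P>(\<omega> in M'. f \<omega> < a)"
    if [measurable]: "f \<in> borel_measurable M'" and ab: "a \<le> b" for f :: "'b \<Rightarrow> real" and a b
  proof -
    have "{\<omega> \<in> space M'. a \<le> f \<omega> \<and> f \<omega> < b} = {\<omega> \<in> space M'. f \<omega> < b} - {\<omega> \<in> space M'. f \<omega> < a}" by auto
    moreover have "M'.prob ({\<omega> \<in> space M'. f \<omega> < b} - {\<omega> \<in> space M'. f \<omega> < a}) =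
        \<P>(\<omega> in M'. f \<omega> < b) - \<P>(\<omega> in M'. f \<omega> < a)"
    proof (rule M'.finite_measure_Diff)
      show "{\<omega> \<in> space M'. f \<omega> < a} \<subseteq> {\<omega> \<in> space M'. f \<omega> < b}" using ab by auto
    qed measurable
    ultimately show ?thesis by (simp only:)
  qed
  have limcell_prob: "\<P>(\<omega> in M'. limcell m \<omega> = (j, k)) \<le>
     exp (- (real j / 2 ^ m)) * (1 / 4) ^ m" if k: "k < 2 ^ m" for m j k
  proof -
    define h :: real where "h = 1 / 2 ^ m"
    have h0: "h > 0" by (simp add: h_def)
    have sh: "real (Suc i) / 2 ^ m = real i / 2 ^ m + h" for i by (simp add: h_def add_divide_distrib)
    have mono: "real i / 2 ^ m \<le> real (Suc i) / 2 ^ m" for i using h0 sh by simp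
    let ?A = "{x. real j / 2 ^ m \<le> exp (- x) \<and> exp (- x) < real (Suc j) / 2 ^ m}"
    let ?B = "{x. real k / 2 ^ m \<le> exp (- \<gamma> * x) \<and> exp (- \<gamma> * x) < real (Suc k) / 2 ^ m}"
    have AB: "?A \<in> sets borel" "?B \<in> sets borel" by measurable
    have "{\<omega> \<in> space M'. limcell m \<omega> = (j, k)} = (\<lambda>\<omega>. (G \<omega>, E \<omega>)) -` (?A \<times> ?B) \<inter> space M'"
      by (auto simp: limcell_def cell_eq_iff)
    then have "\<P>(\<omega> in M'. limcell m \<omega> = (j, k)) =
        M'.prob (G -` ?A \<inter> space M') * M'.prob (E -` ?B \<inter> space M')"
      by (simp only: M'.indep_varD[OF ind AB])
    also have "G -` ?A \<inter> space M' = {\<omega> \<in> space M'. real j / 2 ^ m \<le> exp (- G \<omega>) \<and> exp (- G \<omega>) < real (Suc j) / 2 ^ m}"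
      by auto
    also have "M'.prob \<dots> = (1 - exp (- (real (Suc j) / 2 ^ m))) - (1 - exp (- (real j / 2 ^ m)))"
      using mono[of j] by (subst strip) (auto simp: PG)
    also have "\<dots> = exp (- (real j / 2 ^ m)) * (1 - exp (- h))"
      unfolding sh minus_add_distrib exp_add by (simp add: algebra_simps)
    also have "E -` ?B \<inter> space M' = {\<omega> \<in> space M'. real k / 2 ^ m \<le> exp (- \<gamma> * E \<omega>) \<and> exp (- \<gamma> * E \<omega>) < real (Suc k) / 2 ^ m}"
      by auto
    also have "M'.prob \<dots> = real (Suc k) / 2 ^ m - real k / 2 ^ m"
    proof -
      have "real (Suc k) / 2 ^ m \<le> 1" "real k / 2 ^ m \<le> 1"
        using Suc_dyadic_le_1[OF k] mono[of k] by linarith+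
      then have "\<P>(\<omega> in M'. exp (- \<gamma> * E \<omega>) < real (Suc k) / 2 ^ m) = real (Suc k) / 2 ^ m"
        "\<P>(\<omega> in M'. exp (- \<gamma> * E \<omega>) < real k / 2 ^ m) = real k / 2 ^ m"
        by (intro PE; simp)+
      moreover have "(\<lambda>\<omega>. exp (- \<gamma> * E \<omega>)) \<in> borel_measurable M'" by measurable
      ultimately show ?thesis by (simp only: strip[OF _ mono[of k]])
    qed
    also have "\<dots> = h" unfolding sh by simp
    also have "exp (- (real j / 2 ^ m)) * (1 - exp (- h)) * h \<le> exp (- (real j / 2 ^ m)) * h * h"
      using h0 exp_ge_add_one_self[of "- h"] by (intro mult_right_mono mult_left_mono) auto
    also have "\<dots> = exp (- (real j / 2 ^ m)) * (1 / 4) ^ m"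
      by (simp add: h_def power_one_over power_mult_distrib[symmetric])
    finally show ?thesis .
  qed
  have "\<forall>\<^sub>F n in sequentially. ptm n \<in> measurable M (borel_of euclidean)"
    using eventually_ge_at_top[of 1]
  proof eventually_elim
    case (elim n)
    have [measurable]: "Mstar v X n \<in> borel_measurable M" by (rule Mstar_measurable[OF elim])
    have [measurable]: "taustar v X n \<in> measurable M (count_space UNIV)" by (rule taustar_measurable[OF elim])
    show ?case unfolding bo ptm_def[abs_def] by measurable
  qed
  moreover have "(\<lambda>\<omega>. (G \<omega>, E \<omega>)) \<in> measurable M' (borel_of euclidean)" unfolding bo by measurable
  moreover have "\<forall>\<^sub>F n in sequentially. \<P>(\<omega> in M'. (G \<omega>, E \<omega>) \<in> Q) - e \<le> \<P>(\<omega> in M. ptm n \<omega> \<in> Q)"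
    if Q: "openin euclidean Q" and e: "e > 0" for Q e
  proof -
    have oQ: "open Q" using Q by (simp only: open_openin)
    \<comment> \<open>The cells with \<open>U < m\<close> and \<open>W < 1\<close> that are mapped into \<open>Q\<close>.\<close>
    define good where "good m = {c \<in> {..<m * 2 ^ m} \<times> {..<2 ^ m}.
        \<forall>u w. 0 < u \<longrightarrow> 0 < w \<longrightarrow> cell m u w = c \<longrightarrow> inv_coord (u, w) \<in> Q}" for m
    have fin: "finite (good m)" for m unfolding good_def by (rule finite_subset[of _ "{..<m * 2 ^ m} \<times> {..<2 ^ m}"]) auto
    have low1: "\<forall>\<^sub>F m in sequentially. \<P>(\<omega> in M'. (G \<omega>, E \<omega>) \<in> Q) - e / 3 \<le>
        \<P>(\<omega> in M'. limcell m \<omega> \<in> good m)"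
    proof (rule measure_eventually_in_lower[OF M' _ limcell_meas])
      have "{\<omega> \<in> space M'. (G \<omega>, E \<omega>) \<in> Q} = (\<lambda>\<omega>. (G \<omega>, E \<omega>)) -` Q \<inter> space M'" by auto
      also have "\<dots> \<in> sets M'" using oQ by (intro measurable_sets[where A = borel]) measurable
      finally show "{\<omega> \<in> space M'. (G \<omega>, E \<omega>) \<in> Q} \<in> sets M'" .
      show "e / 3 > 0" using e by simp
      have "\<P>(\<omega> in M'. 0 < E \<omega>) = 1"
        using M'.exponential_distributedD_gt[OF E, of 0] gamma_pos by simp
      then have "AE \<omega> in M'. 0 < E \<omega>" by (subst (asm) M'.prob_Collect_eq_1) auto
      then show "AE \<omega> in M'. \<omega> \<in> {\<omega> \<in> space M'. (G \<omega>, E \<omega>) \<in> Q} \<longrightarrow>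
          (\<forall>\<^sub>F m in sequentially. \<omega> \<in> {\<omega> \<in> space M'. limcell m \<omega> \<in> good m})"
      proof eventually_elim
        case (elim \<omega>)
        show ?case
        proof
          assume \<omega>: "\<omega> \<in> {\<omega> \<in> space M'. (G \<omega>, E \<omega>) \<in> Q}"
          define u where "u = exp (- G \<omega>)"
          define w where "w = exp (- \<gamma> * E \<omega>)"
          have uw: "u > 0" "w > 0" "w < 1" using elim gamma_pos by (auto simp: u_def w_def)
          have "inv_coord (u, w) = (G \<omega>, E \<omega>)" using gamma_pos by (simp add: inv_coord_def u_def w_def)
          then have bQ: "inv_coord (u, w) \<in> Q" using \<omega> by simp
          have cont: "isCont inv_coord (u, w)"
            unfolding inv_coord_def[abs_def] using uw gamma_pos by (intro continuous_intros) auto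
          obtain S where S: "open S" "(u, w) \<in> S" "\<And>p. p \<in> S \<Longrightarrow> inv_coord p \<in> Q"
            using continuous_at_open[THEN iffD1, OF cont, rule_format, OF conjI[OF oQ bQ]] by auto
          obtain d where d: "d > 0" "\<And>p. dist p (u, w) < d \<Longrightarrow> p \<in> S"
            using S(1)[unfolded open_dist, rule_format, OF S(2)] by auto
          have "\<forall>\<^sub>F m in sequentially. real m > u"
            using filterlim_at_top_dense filterlim_real_sequentially by blast
          moreover have "\<forall>\<^sub>F m in sequentially. 1 / 2 ^ m < d / 2" using d by (intro half_power_small) simp
          ultimately show "\<forall>\<^sub>F m in sequentially. \<omega> \<in> {\<omega> \<in> space M'. limcell m \<omega> \<in> good m}"
          proof eventually_elim
            case (elim m)
            obtain j k where c: "cell m u w = (j, k)" by fastforce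
            then have jk: "real j / 2 ^ m \<le> u" "real k / 2 ^ m \<le> w"
              using uw by (auto simp: cell_eq_iff)
            have "real j / 2 ^ m < real m" using jk elim by linarith
            then have "real j < real (m * 2 ^ m)" by (simp add: field_simps)
            then have "j < m * 2 ^ m" by (simp only: of_nat_less_iff)
            moreover have "real k / 2 ^ m < 1" using jk uw by linarith
            then have "real k < real (2 ^ m)" by simp
            then have "k < 2 ^ m" by (simp only: of_nat_less_iff)
            moreover have "inv_coord (u', w') \<in> Q" if "0 < u'" "0 < w'" "cell m u' w' = (j, k)" for u' w'
            proof -
              have "\<bar>u' - u\<bar> < 1 / 2 ^ m \<and> \<bar>w' - w\<bar> < 1 / 2 ^ m"
                using that c uw by (intro cell_near) auto
              then have "\<bar>u' - u\<bar> + \<bar>w' - w\<bar> < d" using elim by linarith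
              moreover have "dist (u', w') (u, w) \<le> \<bar>u' - u\<bar> + \<bar>w' - w\<bar>"
                unfolding dist_Pair_Pair dist_real_def by (intro order_trans[OF sqrt_sum_squares_le_sum_abs]) auto
              ultimately show ?thesis using S d by (meson le_less_trans)
            qed
            ultimately have "(j, k) \<in> good m" by (auto simp: good_def)
            then show ?case using \<omega> c by (simp add: limcell_def u_def w_def)
          qed
        qed
      qed
    qed
    have "\<forall>\<^sub>F m in sequentially. 1 / 2 ^ m < e / 3" using e by (intro half_power_small) simp
    from eventually_happens[OF eventually_conj[OF low1 this]]
    obtain m where m: "\<P>(\<omega> in M'. (G \<omega>, E \<omega>) \<in> Q) - e / 3 \<le> \<P>(\<omega> in M'. limcell m \<omega> \<in> good m)"
        "1 / 2 ^ m < e / 3" by auto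
    define \<delta> where "\<delta> = e / 3 / (real (card (good m)) + 1)"
    have \<delta>: "\<delta> > 0" using e by (simp add: \<delta>_def)
    have "\<forall>\<^sub>F n in sequentially. \<forall>c\<in>good m. exp (- (real (Suc (fst c)) / 2 ^ m)) * (1 / 4) ^ m - \<delta> \<le>
        \<P>(\<omega> in M. argmax_cell n m \<omega> = c)"
      using fin
    proof (intro eventually_ball_finite ballI)
      fix c assume "c \<in> good m"
      then show "\<forall>\<^sub>F n in sequentially. exp (- (real (Suc (fst c)) / 2 ^ m)) * (1 / 4) ^ m - \<delta> \<le>
        \<P>(\<omega> in M. argmax_cell n m \<omega> = c)"
        using prob_argmax_cell_lower[of "snd c" m \<delta> "fst c"] \<delta> by (simp add: good_def mem_Times_iff)
    qed
    with eventually_ge_at_top[of 1] show ?thesis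
    proof eventually_elim
      case (elim n)
      have [measurable]: "Mstar v X n \<in> borel_measurable M" by (rule Mstar_measurable[OF elim(1)])
      have [measurable]: "taustar v X n \<in> measurable M (count_space UNIV)" by (rule taustar_measurable[OF elim(1)])
      have ptm_meas: "{\<omega> \<in> space M. ptm n \<omega> \<in> Q} \<in> events"
      proof -
        have "ptm n \<in> borel_measurable M" unfolding ptm_def[abs_def] by measurable
        from measurable_sets[OF this, of Q] oQ show ?thesis by (simp add: vimage_def Int_def conj_commute)
      qed
      have "inv_coord (U n (taustar v X n \<omega>) \<omega>, W n (taustar v X n \<omega>)) = ptm n \<omega>" for \<omega>
        using elim(1) gamma_pos by (simp add: inv_coord_def U_taustar ptm_def W_def position_def)
      then have sub: "{\<omega> \<in> space M. argmax_cell n m \<omega> \<in> good m} \<subseteq> {\<omega> \<in> space M. ptm n \<omega> \<in> Q}"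
        using U_pos W_pos unfolding argmax_cell_def good_def by (smt (verit) Collect_mono mem_Collect_eq)
      have exh: "exp (- (1 / 2 ^ m :: real)) \<ge> 1 - 1 / 2 ^ m" using exp_ge_add_one_self[of "- (1 / 2 ^ m :: real)"] by simp
      have split: "\<P>(\<omega> in M. argmax_cell n m \<omega> \<in> good m) = (\<Sum>c\<in>good m. \<P>(\<omega> in M. argmax_cell n m \<omega> = c))"
      proof -
        have "{\<omega> \<in> space M. argmax_cell n m \<omega> \<in> good m} = (\<Union>c\<in>good m. {\<omega> \<in> space M. argmax_cell n m \<omega> = c})" by auto
        then show ?thesis using fin argmax_cell_measurable[OF elim(1), of m "{_}"]
          by (simp only:) (intro finite_measure_finite_Union, auto simp: disjoint_family_on_def)
      qed
      have split': "\<P>(\<omega> in M'. limcell m \<omega> \<in> good m) = (\<Sum>c\<in>good m. \<P>(\<omega> in M'. limcell m \<omega> = c))"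
      proof -
        have "{\<omega> \<in> space M'. limcell m \<omega> \<in> good m} = (\<Union>c\<in>good m. {\<omega> \<in> space M'. limcell m \<omega> = c})" by auto
        then show ?thesis using fin limcell_meas[of m "{_}"]
          by (simp only:) (intro M'.finite_measure_finite_Union, auto simp: disjoint_family_on_def)
      qed
      have "exp (- (1 / 2 ^ m)) * \<P>(\<omega> in M'. limcell m \<omega> \<in> good m) - e / 3
        \<le> (\<Sum>c\<in>good m. exp (- (1 / 2 ^ m)) * \<P>(\<omega> in M'. limcell m \<omega> = c) - \<delta>)"
      proof -
        have "real (card (good m)) * \<delta> \<le> e / 3" using e unfolding \<delta>_def by (simp add: field_simps)
        then show ?thesis unfolding split' by (simp add: sum_subtractf sum_distrib_left)
      qed
      also have "\<dots> \<le> (\<Sum>c\<in>good m. exp (- (real (Suc (fst c)) / 2 ^ m)) * (1 / 4) ^ m - \<delta>)"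
      proof (rule sum_mono)
        fix c assume c: "c \<in> good m"
        have "exp (- (1 / 2 ^ m)) * \<P>(\<omega> in M'. limcell m \<omega> = c) \<le>
            exp (- (1 / 2 ^ m)) * (exp (- (real (fst c) / 2 ^ m)) * (1 / 4) ^ m)"
          using limcell_prob[of "snd c" m "fst c"] c by (intro mult_left_mono) (auto simp: good_def)
        also have "\<dots> = exp (- (real (Suc (fst c)) / 2 ^ m)) * (1 / 4) ^ m"
          by (simp add: mult.assoc[symmetric] exp_add[symmetric] add_divide_distrib)
        finally show "exp (- (1 / 2 ^ m)) * \<P>(\<omega> in M'. limcell m \<omega> = c) - \<delta> \<le>
            exp (- (real (Suc (fst c)) / 2 ^ m)) * (1 / 4) ^ m - \<delta>" by simp
      qed
      also have "\<dots> \<le> (\<Sum>c\<in>good m. \<P>(\<omega> in M. argmax_cell n m \<omega> = c))"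
        using elim(2) by (intro sum_mono) auto
      also have "\<dots> \<le> \<P>(\<omega> in M. ptm n \<omega> \<in> Q)"
        unfolding split[symmetric] using ptm_meas sub by (intro finite_measure_mono)
      finally have "exp (- (1 / 2 ^ m)) * \<P>(\<omega> in M'. limcell m \<omega> \<in> good m) - e / 3 \<le> \<P>(\<omega> in M. ptm n \<omega> \<in> Q)" .
      moreover have "\<P>(\<omega> in M'. limcell m \<omega> \<in> good m) - 1 / 2 ^ m \<le>
         exp (- (1 / 2 ^ m)) * \<P>(\<omega> in M'. limcell m \<omega> \<in> good m)"
      proof -
        let ?p = "\<P>(\<omega> in M'. limcell m \<omega> \<in> good m)"
        have "(1 - 1 / 2 ^ m) * ?p \<le> exp (- (1 / 2 ^ m)) * ?p" using exh by (intro mult_right_mono) auto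
        moreover have "1 / 2 ^ m * ?p \<le> 1 / 2 ^ m * 1" by (intro mult_left_mono) auto
        ultimately show ?thesis by (simp add: left_diff_distrib)
      qed
      ultimately show ?case using m by linarith
    qed
  qed
  ultimately have "converges_in_distribution euclidean M ptm M' (\<lambda>\<omega>. (G \<omega>, E \<omega>))"
    by (intro converges_in_distributionI prob_space_axioms M')
  then show ?thesis unfolding ptm_def[abs_def] .
qed

end

section \<open>The vague topology and dyadic cells of the plane\<close>

text \<open>
  For \<open>\<kappa> > 0\<close>, the decreasing homeomorphism \<open>x \<mapsto> exp (- \<kappa> x)\<close> from \<open>(-\<infinity>,\<infinity>]\<close> onto \<open>[0,\<infinity>)\<close>, which sends \<open>\<infinity>\<close> to 0.
\<close>
definition decay :: "real \<Rightarrow> ereal \<Rightarrow> real" where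
  "decay \<kappa> x = (if x = \<infinity> then 0 else exp (- \<kappa> * real_of_ereal x))"

definition undecay :: "real \<Rightarrow> real \<Rightarrow> ereal" where
  "undecay \<kappa> u = (if u \<le> 0 then \<infinity> else ereal (- ln u / \<kappa>))"

lemma decay_ereal [simp]: "decay \<kappa> (ereal x) = exp (- \<kappa> * x)"
  by (simp add: decay_def)

lemma decay_nonneg: "decay \<kappa> x \<ge> 0"
  by (simp add: decay_def)

lemma undecay_decay: "\<kappa> > 0 \<Longrightarrow> x > -\<infinity> \<Longrightarrow> undecay \<kappa> (decay \<kappa> x) = x"
  by (cases x) (auto simp: undecay_def decay_def)

lemma undecay_gt: "undecay \<kappa> u > -\<infinity>"
  by (simp add: undecay_def)

lemma decay_measurable: "decay \<kappa> \<in> borel_measurable borel"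
  unfolding decay_def[abs_def] by measurable

lemma decay_antimono: "\<kappa> > 0 \<Longrightarrow> a > -\<infinity> \<Longrightarrow> a \<le> x \<Longrightarrow> decay \<kappa> x \<le> decay \<kappa> a"
  by (cases a; cases x) (auto simp: decay_def)

lemma continuous_on_undecay:
  assumes "\<kappa> > 0" shows "continuous_on {0..} (undecay \<kappa>)"
  unfolding continuous_on_def
proof
  fix u0 :: real assume "u0 \<in> {0..}"
  then consider "u0 = 0" | "u0 > 0" by force
  then show "(undecay \<kappa> \<longlongrightarrow> undecay \<kappa> u0) (at u0 within {0..})"
  proof cases
    case 1
    have "(undecay \<kappa> \<longlongrightarrow> \<infinity>) (at 0 within {0..})"
      unfolding tendsto_PInfty
    proof
      fix r :: real
      have "\<forall>\<^sub>F u in at 0 within {0..}. u < exp (- \<kappa> * r)"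
        by (rule order_tendstoD(2)[OF tendsto_ident_at]) simp
      then show "\<forall>\<^sub>F u in at 0 within {0..}. ereal r < undecay \<kappa> u"
      proof eventually_elim
        case (elim u)
        have "r < - ln u / \<kappa>" if "u > 0"
        proof -
          have "ln u < - \<kappa> * r" using elim that by (metis exp_less_cancel_iff exp_ln)
          then have "ln u < - (r * \<kappa>)" by (simp add: mult.commute)
          then have "r * \<kappa> < - ln u" by linarith
          then show ?thesis unfolding pos_less_divide_eq[OF assms] .
        qed
        then show ?case by (auto simp: undecay_def)
      qed
    qed
    then show ?thesis using 1 by (simp add: undecay_def)
  next
    case 2
    have "((\<lambda>u. ereal (- ln u / \<kappa>)) \<longlongrightarrow> ereal (- ln u0 / \<kappa>)) (at u0 within {0..})"
      using 2 assms by (intro tendsto_intros) auto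
    moreover have "\<forall>\<^sub>F u in at u0 within {0..}. u > 0"
      by (rule order_tendstoD(1)[OF tendsto_ident_at 2])
    then have "\<forall>\<^sub>F u in at u0 within {0..}. ereal (- ln u / \<kappa>) = undecay \<kappa> u"
      by eventually_elim (simp add: undecay_def)
    ultimately have "(undecay \<kappa> \<longlongrightarrow> ereal (- ln u0 / \<kappa>)) (at u0 within {0..})"
      by (rule Lim_transform_eventually)
    then show ?thesis using 2 by (simp add: undecay_def)
  qed
qed

definition ecell :: "real \<Rightarrow> nat \<Rightarrow> nat \<times> nat \<Rightarrow> (ereal \<times> ereal) set" where
  "ecell \<gamma> m c = {p \<in> upper_plane. cell m (decay 1 (fst p)) (decay \<gamma> (snd p)) = c}"

definition ewindow :: "real \<Rightarrow> nat \<Rightarrow> (ereal \<times> ereal) set" where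
  "ewindow \<gamma> r = {p \<in> upper_plane. decay 1 (fst p) < real r \<and> decay \<gamma> (snd p) < real r}"

definition window :: "nat \<Rightarrow> nat \<Rightarrow> (nat \<times> nat) set" where
  "window r m = {..<r * 2 ^ m} \<times> {..<r * 2 ^ m}"

lemma finite_window [simp]: "finite (window r m)"
  by (simp add: window_def)

lemma card_window: "card (window r m) = r * 2 ^ m * (r * 2 ^ m)"
  by (simp add: window_def card_cartesian_product)

lemma window_mono: "r \<le> r' \<Longrightarrow> window r m \<subseteq> window r' m"
  unfolding window_def by (intro Sigma_mono) (auto intro: less_le_trans)

lemma coordinate_measurable:
  "(\<lambda>p. decay \<kappa> (fst p)) \<in> borel_measurable (borel :: (ereal \<times> ereal) measure)"
  "(\<lambda>p. decay \<kappa> (snd p)) \<in> borel_measurable (borel :: (ereal \<times> ereal) measure)"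
  by (intro measurable_compose[OF _ decay_measurable] borel_measurable_continuous_onI continuous_intros)+

lemma sets_ecell: "ecell \<gamma> m c \<in> sets (restrict_space borel upper_plane)"
proof -
  note [measurable] = coordinate_measurable
  have "(\<lambda>p::ereal \<times> ereal. cell m (decay 1 (fst p)) (decay \<gamma> (snd p))) \<in> measurable borel (count_space UNIV)"
    unfolding cell_def by measurable
  from measurable_sets[OF this, of "{c}"]
  have "{p::ereal \<times> ereal. cell m (decay 1 (fst p)) (decay \<gamma> (snd p)) = c} \<in> sets borel"
    by (simp add: vimage_def)
  then show ?thesis unfolding sets_restrict_space ecell_def by (rule image_eqI[rotated]) auto
qed

lemma sets_ewindow: "ewindow \<gamma> r \<in> sets (restrict_space borel upper_plane)"
proof -
  note [measurable] = coordinate_measurable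
  have "{p::ereal \<times> ereal. decay 1 (fst p) < real r \<and> decay \<gamma> (snd p) < real r} \<in> sets borel"
    by measurable
  then show ?thesis unfolding sets_restrict_space ewindow_def by (rule image_eqI[rotated]) auto
qed

lemma nat_floor_less_iff: "x \<ge> 0 \<Longrightarrow> nat \<lfloor>2 ^ m * x\<rfloor> < r * 2 ^ m \<longleftrightarrow> x < real r"
proof -
  assume x: "x \<ge> 0"
  have "nat \<lfloor>2 ^ m * x\<rfloor> < r * 2 ^ m \<longleftrightarrow> \<lfloor>2 ^ m * x\<rfloor> < int (r * 2 ^ m)" using x by (simp add: nat_less_iff)
  also have "\<dots> \<longleftrightarrow> 2 ^ m * x < real_of_int (int (r * 2 ^ m))" by (rule floor_less_iff)
  also have "\<dots> \<longleftrightarrow> x < real r" by (simp add: mult.commute)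
  finally show ?thesis .
qed

lemma ewindow_eq_Union: "ewindow \<gamma> r = (\<Union>c\<in>window r m. ecell \<gamma> m c)"
  unfolding ewindow_def ecell_def window_def
  by (auto simp: cell_def nat_floor_less_iff decay_nonneg)

lemma disjoint_ecell: "disjoint_family_on (ecell \<gamma> m) C"
  by (auto simp: disjoint_family_on_def ecell_def)

text \<open>
  Both coordinates attain their minima on a nonempty compact set, and these are greater than \<open>-\<infinity>\<close>.
\<close>
lemma compact_in_ewindow:
  assumes "\<gamma> > 0" "compact K" "K \<subseteq> upper_plane"
  shows "\<exists>r. K \<subseteq> ewindow \<gamma> r"
proof (cases "K = {}")
  case False
  have "\<exists>a>-\<infinity>. \<forall>p\<in>K. a \<le> fst p"
  proof -
    have "compact (fst ` K)" using assms(2) by (intro compact_continuous_image continuous_intros)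
    then obtain a where a: "a \<in> fst ` K" "\<And>x. x \<in> fst ` K \<Longrightarrow> a \<le> x"
      using compact_attains_inf[of "fst ` K"] False by auto
    then obtain p where "p \<in> K" "a = fst p" by blast
    then have "a > -\<infinity>" using subsetD[OF assms(3)] by (cases p) (auto simp: upper_plane_def)
    then show ?thesis using a(2) by blast
  qed
  then obtain a where a: "a > -\<infinity>" "\<And>p. p \<in> K \<Longrightarrow> a \<le> fst p" by blast
  have "\<exists>b>-\<infinity>. \<forall>p\<in>K. b \<le> snd p"
  proof -
    have "compact (snd ` K)" using assms(2) by (intro compact_continuous_image continuous_intros)
    then obtain a where a: "a \<in> snd ` K" "\<And>x. x \<in> snd ` K \<Longrightarrow> a \<le> x"
      using compact_attains_inf[of "snd ` K"] False by auto
    then obtain p where "p \<in> K" "a = snd p" by blast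
    then have "a > -\<infinity>" using subsetD[OF assms(3)] by (cases p) (auto simp: upper_plane_def)
    then show ?thesis using a(2) by blast
  qed
  then obtain b where b: "b > -\<infinity>" "\<And>p. p \<in> K \<Longrightarrow> b \<le> snd p" by blast
  obtain r :: nat where r: "max (decay 1 a) (decay \<gamma> b) < real r" using reals_Archimedean2 by blast
  have "K \<subseteq> ewindow \<gamma> r"
  proof
    fix p assume p: "p \<in> K"
    have "decay 1 (fst p) \<le> decay 1 a" using a p by (intro decay_antimono) auto
    moreover have "decay \<gamma> (snd p) \<le> decay \<gamma> b" using b p assms by (intro decay_antimono) auto
    ultimately show "p \<in> ewindow \<gamma> r" using r p assms(3) by (auto simp: ewindow_def)
  qed
  then show ?thesis by blast
qed simp

definition unplane :: "real \<Rightarrow> real \<times> real \<Rightarrow> ereal \<times> ereal" where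
  "unplane \<gamma> q = (undecay 1 (fst q), undecay \<gamma> (snd q))"

lemma continuous_on_unplane: "\<gamma> > 0 \<Longrightarrow> continuous_on ({0..} \<times> {0..}) (unplane \<gamma>)"
  unfolding unplane_def[abs_def]
  by (intro continuous_on_Pair continuous_on_compose2[OF continuous_on_undecay] continuous_intros) auto

lemma unplane_in: "unplane \<gamma> q \<in> upper_plane"
  using undecay_gt[of 1 "fst q"] undecay_gt[of \<gamma> "snd q"] by (simp add: unplane_def upper_plane_def)

lemma unplane_decay: "\<gamma> > 0 \<Longrightarrow> p \<in> upper_plane \<Longrightarrow> unplane \<gamma> (decay 1 (fst p), decay \<gamma> (snd p)) = p"
  by (cases p) (auto simp: unplane_def upper_plane_def undecay_decay)

lemma ewindow_in_compact:
  assumes "\<gamma> > 0"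
  shows "\<exists>K. compact K \<and> K \<subseteq> upper_plane \<and> ewindow \<gamma> r \<subseteq> K"
proof (intro exI conjI)
  show "compact (unplane \<gamma> ` ({0..real r} \<times> {0..real r}))"
    by (intro compact_continuous_image compact_Times continuous_on_subset[OF continuous_on_unplane[OF assms]]) auto
  show "unplane \<gamma> ` ({0..real r} \<times> {0..real r}) \<subseteq> upper_plane" using unplane_in by auto
  show "ewindow \<gamma> r \<subseteq> unplane \<gamma> ` ({0..real r} \<times> {0..real r})"
  proof
    fix p assume p: "p \<in> ewindow \<gamma> r"
    then have "p = unplane \<gamma> (decay 1 (fst p), decay \<gamma> (snd p))"
      by (subst unplane_decay[OF assms]) (auto simp: ewindow_def)
    moreover have "(decay 1 (fst p), decay \<gamma> (snd p)) \<in> {0..real r} \<times> {0..real r}"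
      using p decay_nonneg by (auto simp: ewindow_def)
    ultimately show "p \<in> unplane \<gamma> ` ({0..real r} \<times> {0..real r})" by blast
  qed
qed

lemma radon_sets: "\<nu> \<in> radon_measures upper_plane \<Longrightarrow> sets \<nu> = sets (restrict_space borel upper_plane)"
  by (simp add: radon_measures_def)

lemma radon_ewindow_finite:
  assumes "\<gamma> > 0" "\<nu> \<in> radon_measures upper_plane"
  shows "emeasure \<nu> (ewindow \<gamma> r) < \<infinity>"
proof -
  obtain K where K: "compact K" "K \<subseteq> upper_plane" "ewindow \<gamma> r \<subseteq> K" using ewindow_in_compact[OF assms(1)] by blast
  have "K \<in> sets borel" using K(1) by (simp add: borel_compact)
  then have "K \<in> sets (restrict_space borel upper_plane)" using K(2)
    unfolding sets_restrict_space by (intro image_eqI[where x = K]) auto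
  then have "emeasure \<nu> (ewindow \<gamma> r) \<le> emeasure \<nu> K"
    using K(3) radon_sets[OF assms(2)] by (intro emeasure_mono) auto
  also have "\<dots> < \<infinity>" using assms(2) K by (simp add: radon_measures_def)
  finally show ?thesis .
qed

lemma test_function_window:
  assumes "\<gamma> > 0" "f \<in> compactly_supported upper_plane"
  shows "\<exists>r. \<forall>p\<in>upper_plane - ewindow \<gamma> r. f p = 0"
proof -
  obtain K where "compact K" "K \<subseteq> upper_plane" "\<forall>x\<in>upper_plane - K. f x = 0"
    using assms(2) by (auto simp: compactly_supported_def)
  moreover obtain r where "K \<subseteq> ewindow \<gamma> r" using compact_in_ewindow assms calculation by blast
  ultimately show ?thesis by (intro exI[of _ r]) blast
qed

text \<open>
  In the coordinates of the quadrant a test function is continuous on a compact square, hence uniformly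
  continuous, also near the points at infinity.
\<close>
lemma test_function_oscillation:
  assumes g: "\<gamma> > 0" and f: "f \<in> compactly_supported upper_plane" and e: "e > 0"
  shows "\<forall>\<^sub>F m in sequentially. \<forall>c\<in>window r m. \<forall>p\<in>ecell \<gamma> m c. \<forall>q\<in>ecell \<gamma> m c. \<bar>f p - f q\<bar> < e"
proof -
  let ?S = "{0..real r} \<times> {0..real r}"
  have c1: "continuous_on ?S (unplane \<gamma>)"
    by (rule continuous_on_subset[OF continuous_on_unplane[OF g]]) auto
  have c2: "continuous_on upper_plane f" using f by (simp add: compactly_supported_def)
  have "continuous_on ?S (\<lambda>q. f (unplane \<gamma> q))"
    by (rule continuous_on_compose2[OF c2 c1]) (use unplane_in in blast)
  then have uc: "uniformly_continuous_on ?S (\<lambda>q. f (unplane \<gamma> q))"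
    by (intro compact_uniformly_continuous compact_Times) auto
  obtain d where d: "d > 0" "\<forall>x\<in>?S. \<forall>y\<in>?S. dist y x < d \<longrightarrow> dist (f (unplane \<gamma> y)) (f (unplane \<gamma> x)) < e"
    using uc[unfolded uniformly_continuous_on_def, rule_format, OF e] by (elim exE conjE) (rule that)
  have "(\<lambda>m. (1 / 2 :: real) ^ m) \<longlonglongrightarrow> 0" by (intro LIMSEQ_power_zero) auto
  then have "\<forall>\<^sub>F m in sequentially. (1 / 2 :: real) ^ m < d / 2" using d by (intro order_tendstoD(2)) auto
  then show ?thesis
  proof eventually_elim
    case (elim m)
    show ?case
    proof (intro ballI)
      fix c p q assume c: "c \<in> window r m" and p: "p \<in> ecell \<gamma> m c" and q: "q \<in> ecell \<gamma> m c"
      obtain j k where jk: "c = (j, k)" by (cases c)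
      define P where "P x = (decay 1 (fst x), decay \<gamma> (snd x))" for x :: "ereal \<times> ereal"
      have E: "P x \<in> ?S \<and> unplane \<gamma> (P x) = x \<and> real j / 2 ^ m \<le> fst (P x) \<and> fst (P x) < real j / 2 ^ m + 1 / 2 ^ m \<and>
          real k / 2 ^ m \<le> snd (P x) \<and> snd (P x) < real k / 2 ^ m + 1 / 2 ^ m" if x: "x \<in> ecell \<gamma> m c" for x
      proof -
        have "x \<in> ewindow \<gamma> r" using x c unfolding ewindow_eq_Union[of \<gamma> r m] by blast
        then have "P x \<in> ?S" by (auto simp: P_def ewindow_def decay_nonneg)
        moreover have "unplane \<gamma> (P x) = x" using x unplane_decay[OF g] by (simp add: P_def ecell_def)
        moreover have "cell m (fst (P x)) (snd (P x)) = (j, k)" using x jk by (simp add: P_def ecell_def)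
        then have "real j / 2 ^ m \<le> fst (P x) \<and> fst (P x) < real (Suc j) / 2 ^ m \<and>
          real k / 2 ^ m \<le> snd (P x) \<and> snd (P x) < real (Suc k) / 2 ^ m"
          by (subst (asm) cell_eq_iff) (auto simp: P_def decay_nonneg)
        moreover have "real (Suc i) / 2 ^ m = real i / 2 ^ m + 1 / 2 ^ m" for i by (simp add: add_divide_distrib)
        ultimately show ?thesis by (simp only:)
      qed
      have "dist (P p) (P q) \<le> \<bar>fst (P p) - fst (P q)\<bar> + \<bar>snd (P p) - snd (P q)\<bar>"
        unfolding dist_prod_def dist_real_def by (intro order_trans[OF sqrt_sum_squares_le_sum_abs]) auto
      also have "\<dots> < d"
      proof -
        have "1 / 2 ^ m < d / 2" using elim by (simp add: power_one_over)
        with E[OF p] E[OF q] show ?thesis by - (elim conjE, linarith)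
      qed
      finally have "dist (f (unplane \<gamma> (P p))) (f (unplane \<gamma> (P q))) < e" using E[OF p] E[OF q] by (intro d(2)[rule_format]) auto
      then show "\<bar>f p - f q\<bar> < e" using E[OF p] E[OF q] by (simp add: dist_real_def)
    qed
  qed
qed

text \<open>
  The integral of a test function depends on the cell masses only, up to its oscillation on a cell times
  the mass of a window that contains its support.
\<close>
lemma integral_near_step:
  assumes g: "\<gamma> > 0" and f: "f \<in> compactly_supported upper_plane"
    and f0: "\<And>p. p \<in> upper_plane - ewindow \<gamma> r \<Longrightarrow> f p = 0"
    and osc: "\<And>c p q. c \<in> window r m \<Longrightarrow> p \<in> ecell \<gamma> m c \<Longrightarrow> q \<in> ecell \<gamma> m c \<Longrightarrow> \<bar>f p - f q\<bar> \<le> e"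
    and e: "e \<ge> 0"
    and \<nu>: "\<nu> \<in> radon_measures upper_plane"
  shows "\<bar>(\<integral>p. f p \<partial>\<nu>) - (\<Sum>c\<in>window r m. f (SOME p. p \<in> ecell \<gamma> m c) * measure \<nu> (ecell \<gamma> m c))\<bar>
    \<le> e * measure \<nu> (ewindow \<gamma> r)"
proof -
  define a where "a c = f (SOME p. p \<in> ecell \<gamma> m c)" for c
  define s where "s p = (\<Sum>c\<in>window r m. a c * indicator (ecell \<gamma> m c) p)" for p
  have sets: "ecell \<gamma> m c \<in> sets \<nu>" "ewindow \<gamma> r \<in> sets \<nu>" for c
    using sets_ecell sets_ewindow radon_sets[OF \<nu>] by auto
  have sp: "space \<nu> = upper_plane" using sets_eq_imp_space_eq[OF radon_sets[OF \<nu>]] by (simp add: space_restrict_space)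
  have fin: "emeasure \<nu> (ewindow \<gamma> r) < \<infinity>" by (rule radon_ewindow_finite[OF g \<nu>])
  have finc: "emeasure \<nu> (ecell \<gamma> m c) < \<infinity>" if "c \<in> window r m" for c
  proof -
    have "emeasure \<nu> (ecell \<gamma> m c) \<le> emeasure \<nu> (ewindow \<gamma> r)"
      using that sets by (intro emeasure_mono) (auto simp: ewindow_eq_Union[of \<gamma> r m])
    then show ?thesis using fin by simp
  qed
  have near: "\<bar>f p - s p\<bar> \<le> e * indicator (ewindow \<gamma> r) p" if p: "p \<in> upper_plane" for p
  proof (cases "p \<in> ewindow \<gamma> r")
    case False
    then have "s p = 0" unfolding s_def ewindow_eq_Union[of \<gamma> r m] by (intro sum.neutral) auto
    then show ?thesis using f0 p False by simp
  next
    case True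
    then obtain c where c: "c \<in> window r m" "p \<in> ecell \<gamma> m c" unfolding ewindow_eq_Union[of \<gamma> r m] by blast
    have "s p = (\<Sum>c'\<in>window r m. if c' = c then a c' else 0)"
      unfolding s_def using c(2) by (intro sum.cong) (auto simp: ecell_def indicator_def)
    then have "s p = a c" using c by simp
    moreover have "(SOME p. p \<in> ecell \<gamma> m c) \<in> ecell \<gamma> m c" using c(2) by (rule someI)
    then have "\<bar>f p - a c\<bar> \<le> e" unfolding a_def using c by (intro osc) auto
    ultimately show ?thesis using True by simp
  qed
  have s_int: "integrable \<nu> s" unfolding s_def using sets finc by (intro Bochner_Integration.integrable_sum integrable_mult_right integrable_real_indicator) auto
  have f_meas: "f \<in> borel_measurable \<nu>"
  proof -
    have "f \<in> borel_measurable (restrict_space borel upper_plane)"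
      using f by (intro borel_measurable_continuous_on_restrict) (simp add: compactly_supported_def)
    then show ?thesis using measurable_cong_sets[OF radon_sets[OF \<nu>] refl] by blast
  qed
  have w_int: "integrable \<nu> (\<lambda>p. e * indicator (ewindow \<gamma> r) p)"
    using sets fin by (intro integrable_mult_right integrable_real_indicator) auto
  have d_int: "integrable \<nu> (\<lambda>p. f p - s p)"
  proof (rule Bochner_Integration.integrable_bound[OF w_int])
    show "(\<lambda>p. f p - s p) \<in> borel_measurable \<nu>" using f_meas s_int by measurable
    show "AE p in \<nu>. norm (f p - s p) \<le> norm (e * indicator (ewindow \<gamma> r) p)"
      using near e sp by (intro AE_I2) (auto simp: abs_mult)
  qed
  have f_int: "integrable \<nu> f" using Bochner_Integration.integrable_add[OF d_int s_int] by simp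
  have "integral\<^sup>L \<nu> s = (\<Sum>c\<in>window r m. a c * measure \<nu> (ecell \<gamma> m c))"
  proof -
    have "integral\<^sup>L \<nu> s = (\<Sum>c\<in>window r m. \<integral>p. a c * indicator (ecell \<gamma> m c) p \<partial>\<nu>)"
      unfolding s_def using sets finc
      by (intro Bochner_Integration.integral_sum integrable_mult_right integrable_real_indicator) auto
    also have "\<dots> = (\<Sum>c\<in>window r m. a c * measure \<nu> (ecell \<gamma> m c))"
      using sets.sets_into_space[OF sets(1)] by (intro sum.cong refl) (simp add: Int_absorb2)
    finally show ?thesis .
  qed
  moreover have "\<bar>integral\<^sup>L \<nu> f - integral\<^sup>L \<nu> s\<bar> \<le> e * measure \<nu> (ewindow \<gamma> r)"
  proof -
    have "\<bar>integral\<^sup>L \<nu> f - integral\<^sup>L \<nu> s\<bar> = \<bar>\<integral>p. f p - s p \<partial>\<nu>\<bar>"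
      using f_int s_int by simp
    also have "\<dots> \<le> (\<integral>p. \<bar>f p - s p\<bar> \<partial>\<nu>)" by (rule integral_abs_bound)
    also have "\<dots> \<le> (\<integral>p. e * indicator (ewindow \<gamma> r) p \<partial>\<nu>)"
      using d_int w_int near sp by (intro integral_mono) auto
    also have "\<dots> = e * measure \<nu> (ewindow \<gamma> r)"
      using sets.sets_into_space[OF sets(2)] by (simp add: Int_absorb2)
    finally show ?thesis .
  qed
  ultimately show ?thesis by (simp add: a_def)
qed

definition agree :: "real \<Rightarrow> nat \<Rightarrow> (ereal \<times> ereal) measure \<Rightarrow> (ereal \<times> ereal) measure \<Rightarrow> bool" where
  "agree \<gamma> m \<nu> \<nu>' \<longleftrightarrow> (\<forall>c\<in>window m m. emeasure \<nu> (ecell \<gamma> m c) = emeasure \<nu>' (ecell \<gamma> m c))"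

lemma integral_agree:
  assumes g: "\<gamma> > 0" and f: "f \<in> compactly_supported upper_plane"
    and \<nu>: "\<nu> \<in> radon_measures upper_plane" and e: "e > 0"
  shows "\<forall>\<^sub>F m in sequentially. \<forall>\<nu>'\<in>radon_measures upper_plane. agree \<gamma> m \<nu> \<nu>' \<longrightarrow>
    \<bar>(\<integral>p. f p \<partial>\<nu>') - (\<integral>p. f p \<partial>\<nu>)\<bar> < e"
proof -
  obtain r where r: "\<And>p. p \<in> upper_plane - ewindow \<gamma> r \<Longrightarrow> f p = 0"
    using test_function_window[OF g f] by blast
  define R where "R = measure \<nu> (ewindow \<gamma> r)"
  have R: "R \<ge> 0" by (simp add: R_def)
  define d where "d = e / (2 * R + 1)"
  have d: "d > 0" using e R by (simp add: d_def)
  from test_function_oscillation[OF g f d, of r] eventually_ge_at_top[of r]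
  show ?thesis
  proof eventually_elim
    case (elim m)
    have osc: "\<And>c p q. c \<in> window r m \<Longrightarrow> p \<in> ecell \<gamma> m c \<Longrightarrow> q \<in> ecell \<gamma> m c \<Longrightarrow> \<bar>f p - f q\<bar> \<le> d"
      using elim(1) by (meson less_imp_le)
    have near: "\<bar>(\<integral>p. f p \<partial>\<rho>) - (\<Sum>c\<in>window r m. f (SOME p. p \<in> ecell \<gamma> m c) * measure \<rho> (ecell \<gamma> m c))\<bar>
        \<le> d * measure \<rho> (ewindow \<gamma> r)" if "\<rho> \<in> radon_measures upper_plane" for \<rho>
      by (rule integral_near_step[OF g f _ _ less_imp_le[OF d] that]) (fact r, fact osc)
    show ?case
    proof (intro ballI impI)
      fix \<nu>' assume \<nu>': "\<nu>' \<in> radon_measures upper_plane" and ag: "agree \<gamma> m \<nu> \<nu>'"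
      have eq: "emeasure \<nu>' (ecell \<gamma> m c) = emeasure \<nu> (ecell \<gamma> m c)" if "c \<in> window r m" for c
        using ag that window_mono[OF elim(2), of m] by (auto simp: agree_def)
      have "emeasure \<nu>' (ewindow \<gamma> r) = emeasure \<nu> (ewindow \<gamma> r)"
      proof -
        have "emeasure \<nu>' (ewindow \<gamma> r) = (\<Sum>c\<in>window r m. emeasure \<nu>' (ecell \<gamma> m c))"
          unfolding ewindow_eq_Union[of \<gamma> r m] using sets_ecell radon_sets[OF \<nu>'] disjoint_ecell
          by (intro sum_emeasure[symmetric]) auto
        also have "\<dots> = (\<Sum>c\<in>window r m. emeasure \<nu> (ecell \<gamma> m c))" by (intro sum.cong refl eq)
        also have "\<dots> = emeasure \<nu> (ewindow \<gamma> r)"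
          unfolding ewindow_eq_Union[of \<gamma> r m] using sets_ecell radon_sets[OF \<nu>] disjoint_ecell
          by (intro sum_emeasure) auto
        finally show ?thesis .
      qed
      then have R': "measure \<nu>' (ewindow \<gamma> r) = R" by (simp add: R_def measure_def)
      have "(\<Sum>c\<in>window r m. f (SOME p. p \<in> ecell \<gamma> m c) * measure \<nu>' (ecell \<gamma> m c)) =
          (\<Sum>c\<in>window r m. f (SOME p. p \<in> ecell \<gamma> m c) * measure \<nu> (ecell \<gamma> m c))"
        by (intro sum.cong refl) (simp add: measure_def eq)
      moreover note near[OF \<nu>', unfolded R'] near[OF \<nu>, folded R_def]
      ultimately have "\<bar>(\<integral>p. f p \<partial>\<nu>') - (\<integral>p. f p \<partial>\<nu>)\<bar> \<le> d * R + d * R"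
        by linarith
      also have "d * R + d * R = e * (2 * R) / (2 * R + 1)" by (simp add: d_def)
      also have "\<dots> < e" using e R by (simp add: pos_divide_less_eq)
      finally show "\<bar>(\<integral>p. f p \<partial>\<nu>') - (\<integral>p. f p \<partial>\<nu>)\<bar> < e" .
    qed
  qed
qed

lemma topspace_vague: "topspace (vague_topology upper_plane) = radon_measures upper_plane"
proof -
  have "(\<lambda>_. 0) \<in> compactly_supported upper_plane"
    by (auto simp: compactly_supported_def intro: exI[of _ "{}"])
  then have "radon_measures upper_plane \<in> {{\<mu> \<in> radon_measures upper_plane. (\<integral>x. f x \<partial>\<mu>) \<in> U} | f U.
      f \<in> compactly_supported upper_plane \<and> open U}"
    by (intro CollectI exI[of _ "\<lambda>_. 0"] exI[of _ UNIV]) auto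
  then show ?thesis unfolding vague_topology_def topology_generated_by_topspace by blast
qed

text \<open>
  Sets given by one integral have this property by \<open>integral_agree\<close>, and it passes to finite
  intersections and arbitrary unions. Agreement at level \<open>m\<close>, for all \<open>m\<close>, thus plays
  the part of a countable base of neighbourhoods.
\<close>
lemma vague_open_agree:
  assumes g: "\<gamma> > 0" and G: "openin (vague_topology upper_plane) G" and \<nu>: "\<nu> \<in> G"
  shows "\<forall>\<^sub>F m in sequentially. \<forall>\<nu>'\<in>radon_measures upper_plane. agree \<gamma> m \<nu> \<nu>' \<longrightarrow> \<nu>' \<in> G"
proof -
  let ?B = "{{\<mu> \<in> radon_measures upper_plane. (\<integral>x. f x \<partial>\<mu>) \<in> U} | f U.
      f \<in> compactly_supported upper_plane \<and> open U}"
  have "generate_topology_on ?B G"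
    using G unfolding vague_topology_def by (rule openin_topology_generated_by)
  then have "\<forall>\<nu>\<in>G. \<forall>\<^sub>F m in sequentially. \<forall>\<nu>'\<in>radon_measures upper_plane. agree \<gamma> m \<nu> \<nu>' \<longrightarrow> \<nu>' \<in> G"
  proof induction
    case Empty
    then show ?case by simp
  next
    case (Int a b)
    show ?case
    proof
      fix \<nu> assume "\<nu> \<in> a \<inter> b"
      then have "\<nu> \<in> a" "\<nu> \<in> b" by auto
      with Int.IH have "\<forall>\<^sub>F m in sequentially. \<forall>\<nu>'\<in>radon_measures upper_plane. agree \<gamma> m \<nu> \<nu>' \<longrightarrow> \<nu>' \<in> a"
        "\<forall>\<^sub>F m in sequentially. \<forall>\<nu>'\<in>radon_measures upper_plane. agree \<gamma> m \<nu> \<nu>' \<longrightarrow> \<nu>' \<in> b" by blast+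
      then show "\<forall>\<^sub>F m in sequentially. \<forall>\<nu>'\<in>radon_measures upper_plane. agree \<gamma> m \<nu> \<nu>' \<longrightarrow> \<nu>' \<in> a \<inter> b"
        by eventually_elim blast
    qed
  next
    case (UN K)
    show ?case
    proof
      fix \<nu> assume "\<nu> \<in> \<Union>K"
      then obtain k where k: "k \<in> K" "\<nu> \<in> k" by blast
      with UN.IH have "\<forall>\<^sub>F m in sequentially. \<forall>\<nu>'\<in>radon_measures upper_plane. agree \<gamma> m \<nu> \<nu>' \<longrightarrow> \<nu>' \<in> k" by blast
      then show "\<forall>\<^sub>F m in sequentially. \<forall>\<nu>'\<in>radon_measures upper_plane. agree \<gamma> m \<nu> \<nu>' \<longrightarrow> \<nu>' \<in> \<Union>K"
        by eventually_elim (use k in blast)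
    qed
  next
    case (Basis s)
    then obtain f U where s: "s = {\<mu> \<in> radon_measures upper_plane. (\<integral>x. f x \<partial>\<mu>) \<in> U}"
      and f: "f \<in> compactly_supported upper_plane" and U: "open U" by blast
    show ?case
    proof
      fix \<nu> assume "\<nu> \<in> s"
      then have \<nu>: "\<nu> \<in> radon_measures upper_plane" "(\<integral>x. f x \<partial>\<nu>) \<in> U" by (auto simp: s)
      obtain e where e: "e > 0" "\<And>y. dist y (\<integral>x. f x \<partial>\<nu>) < e \<Longrightarrow> y \<in> U"
        using U \<nu>(2) unfolding open_dist by blast
      from integral_agree[OF g f \<nu>(1) e(1)]
      show "\<forall>\<^sub>F m in sequentially. \<forall>\<nu>'\<in>radon_measures upper_plane. agree \<gamma> m \<nu> \<nu>' \<longrightarrow> \<nu>' \<in> s"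
      proof eventually_elim
        case (elim m)
        then show ?case using e(2) by (auto simp: s dist_real_def)
      qed
    qed
  qed
  then show ?thesis using \<nu> by blast
qed

lemma exponential_strip_measure:
  fixes k a b :: real
  assumes k: "k > 0" and a: "0 \<le> a" and ab: "a \<le> b"
  shows "emeasure (density lborel (\<lambda>x. ennreal (k * exp (- k * x)))) {x. a \<le> exp (- k * x) \<and> exp (- k * x) < b} = ennreal (b - a)"
proof -
  let ?D = "density lborel (\<lambda>x. ennreal (k * exp (- k * x)))"
  have below: "emeasure ?D {x. exp (- k * x) < y} = ennreal y" if y: "y \<ge> 0" for y
  proof (cases "y = 0")
    case True
    have "{x. exp (- k * x) < 0} = {}" by (auto simp: not_less)
    then show ?thesis using True by simp
  next
    case False
    then have y0: "y > 0" using y by simp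
    let ?z = "- ln y / k"
    have iff: "exp (- k * x) < y \<longleftrightarrow> ?z < x" for x
    proof -
      have "exp (- k * x) < y \<longleftrightarrow> - k * x < ln y" using y0 by (metis exp_less_cancel_iff exp_ln)
      then show ?thesis unfolding pos_divide_less_eq[OF k] by (simp add: mult.commute) linarith
    qed
    have "emeasure ?D {x. exp (- k * x) < y} = (\<integral>\<^sup>+ x. ennreal (k * exp (- k * x)) * indicator {x. exp (- k * x) < y} x \<partial>lborel)"
      by (intro emeasure_density) measurable
    also have "\<dots> = (\<integral>\<^sup>+ x. ennreal (k * (exp (- k * x) * indicator {?z..} x)) \<partial>lborel)"
    proof (rule nn_integral_cong_AE)
      show "AE x in lborel. ennreal (k * exp (- k * x)) * indicator {x. exp (- k * x) < y} x =
          ennreal (k * (exp (- k * x) * indicator {?z..} x))"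
        using AE_lborel_singleton[of ?z]
      proof eventually_elim
        case (elim x)
        then show ?case using iff[of x] by (cases "?z < x") (simp_all add: indicator_def)
      qed
    qed
    also have "\<dots> = ennreal (\<integral>x. k * (exp (- k * x) * indicator {?z..} x) \<partial>lborel)"
      using k integrable.intros[OF exponential_tail_integral[OF k, of ?z]]
      by (intro nn_integral_eq_integral integrable_mult_right) (auto simp: indicator_def)
    also have "(\<integral>x. k * (exp (- k * x) * indicator {?z..} x) \<partial>lborel) = k * (exp (- k * ?z) / k)"
      using has_bochner_integral_integral_eq[OF exponential_tail_integral[OF k, of ?z]] by simp
    also have "\<dots> = y" using k y0 by simp
    finally show ?thesis .
  qed
  have "{x. a \<le> exp (- k * x) \<and> exp (- k * x) < b} = {x. exp (- k * x) < b} - {x. exp (- k * x) < a}" by auto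
  moreover have "emeasure ?D ({x. exp (- k * x) < b} - {x. exp (- k * x) < a}) =
      emeasure ?D {x. exp (- k * x) < b} - emeasure ?D {x. exp (- k * x) < a}"
  proof (rule emeasure_Diff)
    show "emeasure ?D {x. exp (- k * x) < a} \<noteq> \<infinity>" using below[OF a] by simp
    show "{x. exp (- k * x) < b} \<in> sets ?D" "{x. exp (- k * x) < a} \<in> sets ?D" by simp_all
    show "{x. exp (- k * x) < a} \<subseteq> {x. exp (- k * x) < b}" using ab by auto
  qed
  ultimately show ?thesis using below a ab by (simp add: ennreal_minus)
qed

lemma sets_mu_hat: "sets (mu_hat \<gamma>) = sets (restrict_space borel upper_plane)"
  by (simp add: mu_hat_def)

lemma mu_hat_ecell:
  assumes g: "\<gamma> > 0"
  shows "emeasure (mu_hat \<gamma>) (ecell \<gamma> m c) = ennreal ((1 / 4) ^ m)"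
proof -
  obtain j k where c: "c = (j, k)" by (cases c)
  let ?D1 = "density lborel (\<lambda>x::real. ennreal (exp (- x)))"
  let ?D2 = "density lborel (\<lambda>z::real. ennreal (\<gamma> * exp (- \<gamma> * z)))"
  let ?T = "\<lambda>(x, z). (ereal x, ereal z)"
  have "?T \<in> measurable (?D1 \<Otimes>\<^sub>M ?D2) (restrict_space borel upper_plane)"
  proof (rule measurable_restrict_space2)
    show "?T \<in> space (?D1 \<Otimes>\<^sub>M ?D2) \<rightarrow> upper_plane" by (auto simp: upper_plane_def)
    have "sets (?D1 \<Otimes>\<^sub>M ?D2) = sets (borel :: (real \<times> real) measure)"
      unfolding borel_prod[symmetric] by (intro sets_pair_measure_cong) auto
    moreover have "?T \<in> borel_measurable (borel :: (real \<times> real) measure)"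
      unfolding case_prod_beta by (intro borel_measurable_continuous_onI continuous_intros)
    ultimately show "?T \<in> borel_measurable (?D1 \<Otimes>\<^sub>M ?D2)" using measurable_cong_sets by blast
  qed
  then have "emeasure (mu_hat \<gamma>) (ecell \<gamma> m c) = emeasure (?D1 \<Otimes>\<^sub>M ?D2) (?T -` ecell \<gamma> m c \<inter> space (?D1 \<Otimes>\<^sub>M ?D2))"
    unfolding mu_hat_def by (intro emeasure_distr sets_ecell)
  also have "?T -` ecell \<gamma> m c \<inter> space (?D1 \<Otimes>\<^sub>M ?D2) =
      {x. real j / 2 ^ m \<le> exp (- 1 * x) \<and> exp (- 1 * x) < real (Suc j) / 2 ^ m} \<times>
      {z. real k / 2 ^ m \<le> exp (- \<gamma> * z) \<and> exp (- \<gamma> * z) < real (Suc k) / 2 ^ m}"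
    by (auto simp: ecell_def upper_plane_def c cell_eq_iff space_pair_measure)
  also have "emeasure (?D1 \<Otimes>\<^sub>M ?D2) \<dots> =
      emeasure ?D1 {x. real j / 2 ^ m \<le> exp (- 1 * x) \<and> exp (- 1 * x) < real (Suc j) / 2 ^ m} *
      emeasure ?D2 {z. real k / 2 ^ m \<le> exp (- \<gamma> * z) \<and> exp (- \<gamma> * z) < real (Suc k) / 2 ^ m}"
  proof (rule sigma_finite_measure.emeasure_pair_measure_Times)
    show "sigma_finite_measure ?D2"
      by (subst sigma_finite_measure.sigma_finite_iff_density_finite[OF sigma_finite_lborel]) auto
  qed (simp_all, measurable)
  also have "emeasure ?D1 {x. real j / 2 ^ m \<le> exp (- 1 * x) \<and> exp (- 1 * x) < real (Suc j) / 2 ^ m} =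
      ennreal (real (Suc j) / 2 ^ m - real j / 2 ^ m)"
    using exponential_strip_measure[of 1 "real j / 2 ^ m" "real (Suc j) / 2 ^ m"]
    by (simp add: divide_right_mono)
  also have "emeasure ?D2 {z. real k / 2 ^ m \<le> exp (- \<gamma> * z) \<and> exp (- \<gamma> * z) < real (Suc k) / 2 ^ m} =
      ennreal (real (Suc k) / 2 ^ m - real k / 2 ^ m)"
    using g by (intro exponential_strip_measure) (auto simp: divide_right_mono)
  also have "ennreal (real (Suc j) / 2 ^ m - real j / 2 ^ m) * ennreal (real (Suc k) / 2 ^ m - real k / 2 ^ m) =
      ennreal ((1 / 4) ^ m)"
  proof -
    have *: "real (Suc i) / 2 ^ m - real i / 2 ^ m = 1 / 2 ^ m" for i by (simp add: diff_divide_distrib[symmetric])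
    show ?thesis unfolding * by (simp add: ennreal_mult'[symmetric] power_one_over power_mult_distrib[symmetric])
  qed
  finally show ?thesis .
qed

lemma mu_hat_cells:
  assumes g: "\<gamma> > 0" and Z: "finite Z"
  shows "emeasure (mu_hat \<gamma>) (\<Union>c\<in>Z. ecell \<gamma> m c) = ennreal ((1 / 4) ^ m * real (card Z))"
proof -
  have "emeasure (mu_hat \<gamma>) (\<Union>c\<in>Z. ecell \<gamma> m c) = (\<Sum>c\<in>Z. emeasure (mu_hat \<gamma>) (ecell \<gamma> m c))"
    using Z sets_ecell disjoint_ecell by (intro sum_emeasure[symmetric]) (auto simp: sets_mu_hat)
  also have "\<dots> = ennreal ((1 / 4) ^ m * real (card Z))"
    unfolding mu_hat_ecell[OF g] by (simp add: ennreal_mult' ennreal_of_nat_eq_real_of_nat mult.commute)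
  finally show ?thesis .
qed

section \<open>Convergence of the point processes\<close>

context weighted_exponentials
begin

text \<open>
  The points are written as a function of a real sequence \<open>x\<close> instead of an outcome: the measurability of
  the random configuration then follows from continuity in \<open>x\<close> for the product topology.
\<close>
definition plane_point :: "nat \<Rightarrow> (nat \<Rightarrow> real) \<Rightarrow> nat \<Rightarrow> ereal \<times> ereal" where
  "plane_point n x i = (ereal (height n i (x i)), ereal (position n i))"

definition config :: "nat \<Rightarrow> (nat \<Rightarrow> real) \<Rightarrow> (ereal \<times> ereal) measure" where
  "config n x = point_measure_of upper_plane {1..} (plane_point n x)"

lemma plane_point_in: "plane_point n x i \<in> upper_plane"
  by (simp add: plane_point_def upper_plane_def)

lemma plane_point_ewindow: "1 \<le> i \<Longrightarrow> plane_point n x i \<in> ewindow \<gamma> r \<Longrightarrow> i \<in> below n (real r)"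
  by (simp add: plane_point_def ewindow_def below_def W_def)

lemma plane_point_ecell: "plane_point n (\<lambda>i. X i \<omega>) i \<in> ecell \<gamma> m c \<longleftrightarrow> hits n m i c \<omega>"
  by (simp add: ecell_def plane_point_in) (simp add: plane_point_def hits_def U_def W_def)

lemma plane_point_measurable: "plane_point n x \<in> measurable (count_space {1..}) (restrict_space borel upper_plane)"
  using plane_point_in by (simp add: space_restrict_space)

lemma sets_config: "sets (config n x) = sets (restrict_space borel upper_plane)"
  by (simp add: config_def point_measure_of_def)

lemma emeasure_config:
  assumes "A \<in> sets (restrict_space borel upper_plane)"
  shows "emeasure (config n x) A = emeasure (count_space {1..}) {i \<in> {1..}. plane_point n x i \<in> A}"
proof -
  have "plane_point n x -` A \<inter> space (count_space {1..}) = {i \<in> {1..}. plane_point n x i \<in> A}" by auto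
  then show ?thesis
    unfolding config_def point_measure_of_def
    using emeasure_distr[OF plane_point_measurable assms] by simp
qed

lemma config_radon:
  assumes n: "n \<ge> 2" shows "config n x \<in> radon_measures upper_plane"
  unfolding radon_measures_def
proof (intro CollectI conjI allI impI sets_config)
  fix K :: "(ereal \<times> ereal) set" assume K: "compact K \<and> K \<subseteq> upper_plane"
  obtain r where r: "K \<subseteq> ewindow \<gamma> r" using compact_in_ewindow[OF gamma_pos] K by blast
  have "K \<in> sets borel" using K by (simp add: borel_compact)
  then have Ks: "K \<in> sets (restrict_space borel upper_plane)" using K
    unfolding sets_restrict_space by (intro image_eqI[where x = K]) auto
  have "{i \<in> {1..}. plane_point n x i \<in> K} \<subseteq> below n (real r)"
    using r plane_point_ewindow by auto
  then have "finite {i \<in> {1..}. plane_point n x i \<in> K}" using finite_below[OF n] finite_subset by blast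
  then show "emeasure (config n x) K < \<infinity>"
    unfolding emeasure_config[OF Ks] by (subst emeasure_count_space_finite) (auto simp: of_nat_less_top)
qed

lemma integral_config:
  assumes n: "n \<ge> 2" and f: "f \<in> compactly_supported upper_plane"
    and r: "\<And>p. p \<in> upper_plane - ewindow \<gamma> r \<Longrightarrow> f p = 0"
  shows "(\<integral>p. f p \<partial>(config n x)) = (\<Sum>i\<in>below n (real r). f (plane_point n x i))"
proof -
  have supp: "i \<in> below n (real r)" if "1 \<le> i" "f (plane_point n x i) \<noteq> 0" for i
  proof (rule plane_point_ewindow[OF that(1)])
    show "plane_point n x i \<in> ewindow \<gamma> r" using r[of "plane_point n x i"] that(2) plane_point_in by blast
  qed
  have "f \<in> borel_measurable (restrict_space borel upper_plane)"
    using f by (intro borel_measurable_continuous_on_restrict) (simp add: compactly_supported_def)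
  then have "(\<integral>p. f p \<partial>(config n x)) = (\<integral>i. f (plane_point n x i) \<partial>(count_space {1..}))"
    unfolding config_def point_measure_of_def by (rule integral_distr[OF plane_point_measurable])
  also have "\<dots> = (\<Sum>i | i \<in> {1..} \<and> f (plane_point n x i) \<noteq> 0. f (plane_point n x i))"
  proof (rule lebesgue_integral_count_space_finite_support)
    have "{i \<in> {1..}. f (plane_point n x i) \<noteq> 0} \<subseteq> below n (real r)"
      using supp by auto
    then show "finite {i \<in> {1..}. f (plane_point n x i) \<noteq> 0}" using finite_below[OF n] finite_subset by blast
  qed
  also have "\<dots> = (\<Sum>i\<in>below n (real r). f (plane_point n x i))"
  proof (rule sum.mono_neutral_left[OF finite_below[OF n]])
    show "{i. i \<in> {1..} \<and> f (plane_point n x i) \<noteq> 0} \<subseteq> below n (real r)"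
      using supp by auto
    show "\<forall>i\<in>below n (real r) - {i. i \<in> {1..} \<and> f (plane_point n x i) \<noteq> 0}. f (plane_point n x i) = 0"
      by (auto simp: below_def)
  qed
  finally show ?thesis .
qed

text \<open>
  Against a test function only the finitely many indices in a strip count, and each point depends
  continuously on its coordinate of \<open>x\<close>.
\<close>
lemma config_continuous:
  assumes n: "n \<ge> 2"
  shows "continuous_map euclidean (vague_topology upper_plane) (config n)"
  unfolding vague_topology_def
proof (rule continuous_on_generated_topo)
  show "config n ` topspace euclidean \<subseteq> \<Union> {{\<mu> \<in> radon_measures upper_plane. (\<integral>x. f x \<partial>\<mu>) \<in> U} | f U.
      f \<in> compactly_supported upper_plane \<and> open U}"
    using config_radon[OF n] topspace_vague unfolding vague_topology_def topology_generated_by_topspace by blast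
next
  fix V assume "V \<in> {{\<mu> \<in> radon_measures upper_plane. (\<integral>x. f x \<partial>\<mu>) \<in> U} | f U.
      f \<in> compactly_supported upper_plane \<and> open U}"
  then obtain f U where V: "V = {\<mu> \<in> radon_measures upper_plane. (\<integral>x. f x \<partial>\<mu>) \<in> U}"
    and f: "f \<in> compactly_supported upper_plane" and U: "open U" by blast
  obtain r where r: "\<And>p. p \<in> upper_plane - ewindow \<gamma> r \<Longrightarrow> f p = 0"
    using test_function_window[OF gamma_pos f] by blast
  have int: "(\<integral>p. f p \<partial>(config n x)) = (\<Sum>i\<in>below n (real r). f (plane_point n x i))" for x
    by (rule integral_config[OF n f]) (fact r)
  have fc: "continuous_on upper_plane f" using f by (simp add: compactly_supported_def)
  have pc: "continuous_on UNIV (\<lambda>x. plane_point n x i)" for i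
    unfolding plane_point_def height_def divide_inverse by (intro continuous_intros continuous_on_product_coordinates)
  have "continuous_on UNIV (\<lambda>x. \<Sum>i\<in>below n (real r). f (plane_point n x i))"
    using plane_point_in by (intro continuous_on_sum continuous_on_compose2[OF fc pc]) auto
  then have "open ((\<lambda>x. \<Sum>i\<in>below n (real r). f (plane_point n x i)) -` U)"
    using U by (simp add: continuous_on_open_vimage)
  moreover have "config n -` V \<inter> topspace euclidean = (\<lambda>x. \<Sum>i\<in>below n (real r). f (plane_point n x i)) -` U"
    using config_radon[OF n] by (auto simp: V int)
  ultimately show "openin euclidean (config n -` V \<inter> topspace euclidean)" by (simp only: open_openin)
qed

text \<open>
  The vague Borel sets are generated by all vaguely open sets, so measurability of integrals against
  test functions does not suffice at once. Continuity of \<open>config n\<close> on the sequence space does, because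
  there the Borel sets are generated by the coordinates.
\<close>
lemma config_measurable:
  assumes n: "n \<ge> 2"
  shows "(\<lambda>\<omega>. config n (\<lambda>i. X i \<omega>)) \<in> measurable M (borel_of (vague_topology upper_plane))"
proof (rule measurable_borel_ofI)
  show "config n (\<lambda>i. X i \<omega>) \<in> topspace (vague_topology upper_plane)" for \<omega>
    using config_radon[OF n] by (simp add: topspace_vague)
  fix V assume V: "openin (vague_topology upper_plane) V"
  \<comment> \<open>\<open>X 0\<close> is arbitrary, possibly not measurable, but no point of the configuration uses it.\<close>
  define X' where "X' \<omega> i = (if 1 \<le> i then X i \<omega> else 0)" for \<omega> i
  have "(\<lambda>\<omega>. X' \<omega> i) \<in> borel_measurable M" for i
    unfolding X'_def using X_measurable[of i] by (cases "1 \<le> i") auto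
  then have X': "X' \<in> borel_measurable M" by (rule measurable_coordinatewise_then_product)
  have eq: "config n (\<lambda>i. X i \<omega>) = config n (X' \<omega>)" for \<omega>
    unfolding config_def point_measure_of_def
    by (intro distr_cong) (auto simp: plane_point_def X'_def)
  have "open {x. config n x \<in> V}"
  proof -
    have "openin euclidean {x \<in> topspace euclidean. config n x \<in> V}"
      using config_continuous[OF n] V by (rule openin_continuous_map_preimage)
    then have "openin euclidean {x. config n x \<in> V}" by simp
    then show ?thesis by (simp only: open_openin)
  qed
  then have "X' -` {x. config n x \<in> V} \<inter> space M \<in> sets M"
    using X' by (intro measurable_sets[where A = borel]) auto
  moreover have "X' -` {x. config n x \<in> V} \<inter> space M = {\<omega> \<in> space M. config n (\<lambda>i. X i \<omega>) \<in> V}"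
    using eq by auto
  ultimately show "{\<omega> \<in> space M. config n (\<lambda>i. X i \<omega>) \<in> V} \<in> sets M" by simp
qed

lemma config_cell_empty:
  assumes "\<not> hit n m c \<omega>"
  shows "emeasure (config n (\<lambda>i. X i \<omega>)) (ecell \<gamma> m c) = 0"
proof -
  have "{i \<in> {1..}. plane_point n (\<lambda>i. X i \<omega>) i \<in> ecell \<gamma> m c} = {}"
    using assms by (auto simp: plane_point_ecell hit_def)
  then show ?thesis unfolding emeasure_config[OF sets_ecell] by (simp only: emeasure_empty)
qed

lemma config_cell_single:
  assumes "hit n m c \<omega>" "\<not> double n m c \<omega>"
  shows "emeasure (config n (\<lambda>i. X i \<omega>)) (ecell \<gamma> m c) = 1"
proof -
  obtain i where i: "1 \<le> i" "hits n m i c \<omega>" using assms(1) by (auto simp: hit_def)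
  have uniq: "i' = i" if "i' \<in> {1..}" "hits n m i' c \<omega>" for i'
    using assms(2) i that unfolding double_def by (metis atLeast_iff nat_neq_iff)
  have "i \<in> {1..}" using i by simp
  with i uniq have "{i \<in> {1..}. plane_point n (\<lambda>i. X i \<omega>) i \<in> ecell \<gamma> m c} = {i}"
    unfolding plane_point_ecell by blast
  then show ?thesis unfolding emeasure_config[OF sets_ecell] using i by (simp add: emeasure_count_space)
qed

text \<open>
  The limiting probability that precisely the cells of \<open>S\<close> are occupied in the window.
\<close>
definition pattern_weight :: "nat \<Rightarrow> (nat \<times> nat) set \<Rightarrow> real" where
  "pattern_weight m S = exp (- ((1 / 4) ^ m) * real (card (window m m - S))) * (1 - exp (- ((1 / 4) ^ m))) ^ card S"

text \<open>
  A cell of area \<open>a\<close> contains two points with probability at most about \<open>a\<^sup>2\<close>; summed over the window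
  this is still negligible for large \<open>m\<close>.
\<close>
lemma window_rare: "(\<lambda>m. real (card (window m m)) * ((1 / 4) ^ m)\<^sup>2) \<longlonglongrightarrow> 0"
proof -
  have "real (card (window m m)) * ((1 / 4) ^ m)\<^sup>2 = (real m)\<^sup>2 * (1 / 4) ^ m" for m
  proof -
    have "(2 :: real) ^ m * 2 ^ m * (1 / 4) ^ m = 1" by (simp add: power_mult_distrib[symmetric])
    then show ?thesis by (simp add: card_window power2_eq_square algebra_simps)
  qed
  moreover have "(\<lambda>m. (real m)\<^sup>2 * (1 / 4) ^ m) \<longlonglongrightarrow> 0" by real_asymp
  ultimately show ?thesis by simp
qed

text \<open>
  Given a vaguely open set \<open>G\<close>, a pattern of occupied cells is good if all measures with one unit of mass
  in each of these cells and none elsewhere in the window belong to \<open>G\<close>. By \<open>vague_open_agree\<close> a Poisson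
  configuration in \<open>G\<close> has a good pattern at every fine enough level, unless some cell holds more
  than one point. The probability of each pattern converges, a prelimit configuration with a good pattern and
  no double point lies in \<open>G\<close>, and double points are rare on both sides.
\<close>
lemma points_limit:
  fixes M' :: "'c measure"
  assumes M': "prob_space M'" and PP: "poisson_process upper_plane (mu_hat \<gamma>) M' N"
  shows "converges_in_distribution (vague_topology upper_plane) M
    (\<lambda>n \<omega>. config n (\<lambda>i. X i \<omega>)) M' N"
proof -
  interpret M': prob_space M' by fact
  have N_meas: "N \<in> measurable M' (borel_of (vague_topology upper_plane))"
    using PP by (simp add: poisson_process_def)
  have N_radon: "N \<omega> \<in> radon_measures upper_plane" if "\<omega> \<in> space M'" for \<omega>
    using measurable_space[OF N_meas that] by (simp add: topspace_vague)
  have count_meas: "(\<lambda>\<omega>. emeasure (N \<omega>) A) \<in> borel_measurable M'"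
    if A: "A \<in> sets (restrict_space borel upper_plane)" for A
  proof -
    \<comment> \<open>Independence of a family of one set includes the measurability of its count.\<close>
    have "M'.indep_vars (\<lambda>_. borel) (\<lambda>i \<omega>. emeasure (N \<omega>) ((\<lambda>_. A) i)) {..<1::nat}"
      using PP A unfolding poisson_process_def by (elim conjE allE[of _ "\<lambda>_. A"] allE[of _ 1]) (auto simp: disjoint_family_on_def)
    then show ?thesis unfolding M'.indep_vars_def by simp
  qed
  have pois: "\<P>(\<omega> in M'. emeasure (N \<omega>) A = of_nat k) = exp (- a) * a ^ k / fact k"
    if "A \<in> sets (restrict_space borel upper_plane)" "emeasure (mu_hat \<gamma>) A = ennreal a" "a \<ge> 0" for A k a
  proof -
    have "measure (mu_hat \<gamma>) A = a" using that by (simp add: measure_def)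
    moreover have "emeasure (mu_hat \<gamma>) A < \<infinity>" using that by simp
    ultimately show ?thesis using PP that(1) unfolding poisson_process_def by blast
  qed
  have cell_meas: "{\<omega> \<in> space M'. P (emeasure (N \<omega>) (ecell \<gamma> m c))} \<in> sets M'"
    if "{y. P y} \<in> sets borel" for P m c
  proof -
    have "{\<omega> \<in> space M'. P (emeasure (N \<omega>) (ecell \<gamma> m c))} = (\<lambda>\<omega>. emeasure (N \<omega>) (ecell \<gamma> m c)) -` {y. P y} \<inter> space M'" by auto
    then show ?thesis using measurable_sets[OF count_meas[OF sets_ecell] that] by simp
  qed
  define pattern where "pattern m \<omega> = {c \<in> window m m. emeasure (N \<omega>) (ecell \<gamma> m c) \<noteq> 0}" for m \<omega>
  define simple where "simple m \<omega> \<longleftrightarrow> (\<forall>c\<in>window m m. emeasure (N \<omega>) (ecell \<gamma> m c) \<in> {0, 1})" for m \<omega>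
  have pattern_iff: "pattern m \<omega> = S \<longleftrightarrow> (\<forall>c\<in>window m m - S. \<not> emeasure (N \<omega>) (ecell \<gamma> m c) \<noteq> 0) \<and>
      (\<forall>c\<in>S. emeasure (N \<omega>) (ecell \<gamma> m c) \<noteq> 0)" if "S \<subseteq> window m m" for S m \<omega>
    using that unfolding pattern_def by blast
  have nz: "{y::ennreal. y \<noteq> 0} \<in> sets borel" and n01: "{y::ennreal. y \<notin> {0, 1}} \<in> sets borel"
  proof -
    have "{y::ennreal. y \<noteq> 0} = - {0}" "{y::ennreal. y \<notin> {0, 1}} = - {0, 1}" by auto
    then show "{y::ennreal. y \<noteq> 0} \<in> sets borel" "{y::ennreal. y \<notin> {0, 1}} \<in> sets borel"
      by (simp_all only: borel_comp sets.insert_in_sets borel_singleton sets.empty_sets)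
  qed
  have avoid: "\<P>(\<omega> in M'. \<forall>c\<in>Z. \<not> emeasure (N \<omega>) (ecell \<gamma> m c) \<noteq> 0) = exp (- ((1 / 4) ^ m) * real (card Z))"
    if Z: "finite Z" for Z m
  proof -
    have U: "(\<Union>c\<in>Z. ecell \<gamma> m c) \<in> sets (restrict_space borel upper_plane)"
      using Z sets_ecell by (intro sets.finite_UN) auto
    have "emeasure (N \<omega>) (\<Union>c\<in>Z. ecell \<gamma> m c) = (\<Sum>c\<in>Z. emeasure (N \<omega>) (ecell \<gamma> m c))" if "\<omega> \<in> space M'" for \<omega>
      using Z sets_ecell disjoint_ecell radon_sets[OF N_radon[OF that]] by (intro sum_emeasure[symmetric]) auto
    then have "{\<omega> \<in> space M'. \<forall>c\<in>Z. \<not> emeasure (N \<omega>) (ecell \<gamma> m c) \<noteq> 0} =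
        {\<omega> \<in> space M'. emeasure (N \<omega>) (\<Union>c\<in>Z. ecell \<gamma> m c) = of_nat 0}"
      using Z by auto
    then show ?thesis using pois[OF U mu_hat_cells[OF gamma_pos Z], of 0] by simp
  qed
  have pattern_prob: "\<P>(\<omega> in M'. pattern m \<omega> = S) = pattern_weight m S" if S: "S \<subseteq> window m m" for S m
  proof -
    have "(\<lambda>n::nat. \<P>(\<omega> in M'. (\<forall>c\<in>window m m - S. \<not> emeasure (N \<omega>) (ecell \<gamma> m c) \<noteq> 0) \<and>
        (\<forall>c\<in>S. emeasure (N \<omega>) (ecell \<gamma> m c) \<noteq> 0))) \<longlonglongrightarrow>
      exp (- ((1 / 4) ^ m) * real (card (window m m - S))) * (1 - exp (- ((1 / 4) ^ m))) ^ card S"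
    proof (rule hit_avoid_limit[OF M'])
      show "\<forall>\<^sub>F n::nat in sequentially. \<forall>c. {\<omega> \<in> space M'. emeasure (N \<omega>) (ecell \<gamma> m c) \<noteq> 0} \<in> sets M'"
        using cell_meas[OF nz] by simp
      show "(\<lambda>n::nat. \<P>(\<omega> in M'. \<forall>c\<in>Z. \<not> emeasure (N \<omega>) (ecell \<gamma> m c) \<noteq> 0)) \<longlonglongrightarrow>
          exp (- ((1 / 4) ^ m) * real (card Z))" if "finite Z" for Z
        unfolding avoid[OF that] by (rule tendsto_const)
      show "finite S" using S finite_window finite_subset by blast
    qed auto
    then show ?thesis unfolding pattern_iff[OF S] pattern_weight_def
      by (rule LIMSEQ_unique[OF tendsto_const])
  qed
  have not_simple: "\<P>(\<omega> in M'. \<not> simple m \<omega>) \<le> real (card (window m m)) * ((1 / 4) ^ m)\<^sup>2" for m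
  proof -
    define a :: real where "a = (1 / 4) ^ m"
    have a: "a \<ge> 0" by (simp add: a_def)
    have one: "\<P>(\<omega> in M'. emeasure (N \<omega>) (ecell \<gamma> m c) \<notin> {0, 1}) \<le> a\<^sup>2" for c
    proof -
      let ?E = "\<lambda>k::nat. {\<omega> \<in> space M'. emeasure (N \<omega>) (ecell \<gamma> m c) = of_nat k}"
      have Em: "?E k \<in> sets M'" for k
      proof -
        have "{y::ennreal. y = of_nat k} \<in> sets borel" by simp
        from cell_meas[OF this] show ?thesis .
      qed
      have P: "M'.prob (?E k) = exp (- a) * a ^ k / fact k" for k
        using pois[OF sets_ecell mu_hat_ecell[OF gamma_pos]] by (simp add: a_def)
      have "{\<omega> \<in> space M'. emeasure (N \<omega>) (ecell \<gamma> m c) \<notin> {0, 1}} = space M' - (?E 0 \<union> ?E 1)" by auto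
      then have "\<P>(\<omega> in M'. emeasure (N \<omega>) (ecell \<gamma> m c) \<notin> {0, 1}) = 1 - M'.prob (?E 0 \<union> ?E 1)"
        using Em by (simp only: M'.prob_compl sets.Un)
      also have "M'.prob (?E 0 \<union> ?E 1) = M'.prob (?E 0) + M'.prob (?E 1)"
        by (rule M'.finite_measure_Union[OF Em Em]) auto
      also have "\<dots> = exp (- a) * (1 + a)" unfolding P by (simp add: algebra_simps)
      also have "1 - exp (- a) * (1 + a) \<le> a\<^sup>2"
      proof -
        have "(1 - a) * (1 + a) \<le> exp (- a) * (1 + a)"
          using exp_ge_add_one_self[of "- a"] a by (intro mult_right_mono) auto
        then show ?thesis by (simp add: algebra_simps power2_eq_square)
      qed
      finally show ?thesis .
    qed
    have "{\<omega> \<in> space M'. \<not> simple m \<omega>} = (\<Union>c\<in>window m m. {\<omega> \<in> space M'. emeasure (N \<omega>) (ecell \<gamma> m c) \<notin> {0, 1}})"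
      by (auto simp: simple_def)
    then have "\<P>(\<omega> in M'. \<not> simple m \<omega>) = M'.prob (\<Union>c\<in>window m m. {\<omega> \<in> space M'. emeasure (N \<omega>) (ecell \<gamma> m c) \<notin> {0, 1}})"
      by (simp only:)
    also have "\<dots> \<le> (\<Sum>c\<in>window m m. \<P>(\<omega> in M'. emeasure (N \<omega>) (ecell \<gamma> m c) \<notin> {0, 1}))"
      using cell_meas[OF n01] by (intro M'.finite_measure_subadditive_finite) auto
    also have "\<dots> \<le> (\<Sum>c\<in>window m m. a\<^sup>2)" by (intro sum_mono one)
    finally show ?thesis by (simp add: a_def)
  qed
  have simple_meas: "{\<omega> \<in> space M'. \<not> simple m \<omega>} \<in> sets M'" for m
  proof -
    have "{\<omega> \<in> space M'. \<not> simple m \<omega>} = (\<Union>c\<in>window m m. {\<omega> \<in> space M'. emeasure (N \<omega>) (ecell \<gamma> m c) \<notin> {0, 1}})"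
      by (auto simp: simple_def)
    also have "\<dots> \<in> sets M'" using cell_meas[OF n01] by (intro sets.finite_UN) auto
    finally show ?thesis .
  qed
  have pattern_meas: "{\<omega> \<in> space M'. pattern m \<omega> = S} \<in> sets M'" if S: "S \<subseteq> window m m" for S m
  proof -
    have "finite S" using S finite_window finite_subset by blast
    moreover have "{y::ennreal. y = 0} \<in> sets borel" by simp
    note cell_meas[OF this]
    ultimately show ?thesis unfolding pattern_iff[OF S]
      by (intro sets.sets_Collect_conj sets.sets_Collect_finite_All sets.sets_Collect_neg) auto
  qed
  have "\<forall>\<^sub>F n in sequentially. \<P>(\<omega> in M'. N \<omega> \<in> G) - e \<le> \<P>(\<omega> in M. config n (\<lambda>i. X i \<omega>) \<in> G)"
    if G: "openin (vague_topology upper_plane) G" and e: "e > 0" for G e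
  proof -
    define good where "good m = {S \<in> Pow (window m m). \<forall>\<nu>\<in>radon_measures upper_plane.
        (\<forall>c\<in>window m m. emeasure \<nu> (ecell \<gamma> m c) = of_bool (c \<in> S)) \<longrightarrow> \<nu> \<in> G}" for m
    have fin: "finite (good m)" for m unfolding good_def by (rule finite_subset[of _ "Pow (window m m)"]) auto
    have sub: "S \<subseteq> window m m" if "S \<in> good m" for S m using that by (simp add: good_def)
    have gset: "{\<omega> \<in> space M'. pattern m \<omega> \<in> good m} = (\<Union>S\<in>good m. {\<omega> \<in> space M'. pattern m \<omega> = S})" for m by auto
    have good_meas: "{\<omega> \<in> space M'. pattern m \<omega> \<in> good m} \<in> sets M'" for m
      unfolding gset using fin sub pattern_meas by (intro sets.finite_UN) auto
    have NG: "{\<omega> \<in> space M'. N \<omega> \<in> G} \<in> sets M'"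
    proof -
      have "{\<omega> \<in> space M'. N \<omega> \<in> G} = N -` G \<inter> space M'" by auto
      then show ?thesis using measurable_sets[OF N_meas openin_sets_borel_of[OF G]] by simp
    qed
    \<comment> \<open>At a level where some cell holds two points the pattern says nothing, so these outcomes are
      admitted here and bounded afterwards.\<close>
    have low: "\<forall>\<^sub>F m in sequentially. \<P>(\<omega> in M'. N \<omega> \<in> G) - e / 4 \<le>
        M'.prob ({\<omega> \<in> space M'. pattern m \<omega> \<in> good m} \<union> {\<omega> \<in> space M'. \<not> simple m \<omega>})"
    proof (rule measure_eventually_in_lower[OF M' NG])
      show "{\<omega> \<in> space M'. pattern m \<omega> \<in> good m} \<union> {\<omega> \<in> space M'. \<not> simple m \<omega>} \<in> sets M'" for m
        using good_meas simple_meas by (rule sets.Un)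
      show "e / 4 > 0" using e by simp
      show "AE \<omega> in M'. \<omega> \<in> {\<omega> \<in> space M'. N \<omega> \<in> G} \<longrightarrow>
        (\<forall>\<^sub>F m in sequentially. \<omega> \<in> {\<omega> \<in> space M'. pattern m \<omega> \<in> good m} \<union> {\<omega> \<in> space M'. \<not> simple m \<omega>})"
      proof (intro AE_I2 impI)
        fix \<omega> assume \<omega>: "\<omega> \<in> space M'" "\<omega> \<in> {\<omega> \<in> space M'. N \<omega> \<in> G}"
        then have "N \<omega> \<in> G" by simp
        from vague_open_agree[OF gamma_pos G this]
        show "\<forall>\<^sub>F m in sequentially. \<omega> \<in> {\<omega> \<in> space M'. pattern m \<omega> \<in> good m} \<union> {\<omega> \<in> space M'. \<not> simple m \<omega>}"
        proof eventually_elim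
          case (elim m)
          have "pattern m \<omega> \<in> good m" if s: "simple m \<omega>"
            unfolding good_def
          proof (intro CollectI conjI ballI impI)
            show "pattern m \<omega> \<in> Pow (window m m)" by (auto simp: pattern_def)
            fix \<nu> assume \<nu>: "\<nu> \<in> radon_measures upper_plane"
              and eq: "\<forall>c\<in>window m m. emeasure \<nu> (ecell \<gamma> m c) = of_bool (c \<in> pattern m \<omega>)"
            have "agree \<gamma> m (N \<omega>) \<nu>"
              unfolding agree_def
            proof
              fix c assume c: "c \<in> window m m"
              then have "emeasure (N \<omega>) (ecell \<gamma> m c) = 0 \<or> emeasure (N \<omega>) (ecell \<gamma> m c) = 1"
                using s by (simp add: simple_def)
              then show "emeasure (N \<omega>) (ecell \<gamma> m c) = emeasure \<nu> (ecell \<gamma> m c)"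
                using eq c by (auto simp: pattern_def)
            qed
            then show "\<nu> \<in> G" using elim \<nu> by blast
          qed
          then show ?case using \<omega>(1) by blast
        qed
      qed
    qed
    have "\<forall>\<^sub>F m in sequentially. real (card (window m m)) * ((1 / 4) ^ m)\<^sup>2 < e / 8"
      using e by (intro order_tendstoD(2)[OF window_rare]) simp
    from eventually_happens[OF eventually_conj[OF low this]]
    obtain m where m: "\<P>(\<omega> in M'. N \<omega> \<in> G) - e / 4 \<le>
        M'.prob ({\<omega> \<in> space M'. pattern m \<omega> \<in> good m} \<union> {\<omega> \<in> space M'. \<not> simple m \<omega>})"
      "real (card (window m m)) * ((1 / 4) ^ m)\<^sup>2 < e / 8" by auto
    have "M'.prob ({\<omega> \<in> space M'. pattern m \<omega> \<in> good m} \<union> {\<omega> \<in> space M'. \<not> simple m \<omega>}) \<le>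
        \<P>(\<omega> in M'. pattern m \<omega> \<in> good m) + \<P>(\<omega> in M'. \<not> simple m \<omega>)"
      using good_meas simple_meas by (rule measure_subadditive) auto
    moreover have "\<P>(\<omega> in M'. pattern m \<omega> \<in> good m) = (\<Sum>S\<in>good m. pattern_weight m S)"
    proof -
      have "\<P>(\<omega> in M'. pattern m \<omega> \<in> good m) = (\<Sum>S\<in>good m. \<P>(\<omega> in M'. pattern m \<omega> = S))"
        unfolding gset using fin sub pattern_meas
        by (intro M'.finite_measure_finite_Union) (auto simp: disjoint_family_on_def)
      also have "\<dots> = (\<Sum>S\<in>good m. pattern_weight m S)" by (intro sum.cong refl pattern_prob sub)
      finally show ?thesis .
    qed
    ultimately have weights: "\<P>(\<omega> in M'. N \<omega> \<in> G) - e / 4 - e / 8 \<le> (\<Sum>S\<in>good m. pattern_weight m S)"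
      using m not_simple[of m] by linarith
    \<comment> \<open>The event that \<open>S\<close> is the set of occupied cells of the window.\<close>
    define A where "A n S = {\<omega> \<in> space M. (\<forall>c\<in>window m m - S. \<not> hit n m c \<omega>) \<and> (\<forall>c\<in>S. hit n m c \<omega>)}" for n S
    have A_meas: "A n S \<in> events" if "S \<in> good m" for n S
    proof -
      have "finite S" using sub[OF that] finite_window finite_subset by blast
      then show ?thesis unfolding A_def
        using hit_measurable by (intro sets.sets_Collect_conj sets.sets_Collect_finite_All sets.sets_Collect_neg) auto
    qed
    have "(\<lambda>n. \<Sum>S\<in>good m. prob (A n S)) \<longlonglongrightarrow> (\<Sum>S\<in>good m. pattern_weight m S)"
    proof (rule tendsto_sum)
      fix S assume "S \<in> good m"
      then have "finite S" using sub finite_window finite_subset by blast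
      then show "(\<lambda>n. prob (A n S)) \<longlonglongrightarrow> pattern_weight m S"
        unfolding A_def pattern_weight_def by (intro hit_pattern_limit) auto
    qed
    then have "\<forall>\<^sub>F n in sequentially. (\<Sum>S\<in>good m. pattern_weight m S) - e / 4 < (\<Sum>S\<in>good m. prob (A n S))"
      by (rule order_tendstoD) (use e in simp)
    moreover define d where "d = e / 8 / (real (card (window m m)) + 1)"
    have d: "d > 0" using e by (simp add: d_def)
    have "\<forall>\<^sub>F n in sequentially. \<forall>c\<in>window m m. \<P>(\<omega> in M. double n m c \<omega>) \<le> ((1 / 4) ^ m)\<^sup>2 + d"
      using d by (intro eventually_ball_finite ballI double_rare) auto
    ultimately show ?thesis using eventually_ge_at_top[of 2]
    proof eventually_elim
      case (elim n)
      let ?D = "\<Union>c\<in>window m m. {\<omega> \<in> space M. double n m c \<omega>}"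
      let ?C = "{\<omega> \<in> space M. config n (\<lambda>i. X i \<omega>) \<in> G}"
      have C: "?C \<in> events"
      proof -
        have "?C = (\<lambda>\<omega>. config n (\<lambda>i. X i \<omega>)) -` G \<inter> space M" by auto
        then show ?thesis using measurable_sets[OF config_measurable[OF elim(3)] openin_sets_borel_of[OF G]] by simp
      qed
      have D: "?D \<in> events" using double_measurable by (intro sets.finite_UN) auto
      have "prob ?D \<le> (\<Sum>c\<in>window m m. \<P>(\<omega> in M. double n m c \<omega>))"
        using double_measurable by (intro finite_measure_subadditive_finite) auto
      also have "\<dots> \<le> (\<Sum>c\<in>window m m. ((1 / 4) ^ m)\<^sup>2 + d)" using elim(2) by (intro sum_mono) auto
      also have "\<dots> = real (card (window m m)) * ((1 / 4) ^ m)\<^sup>2 + real (card (window m m)) * d"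
        by (simp add: distrib_left)
      also have "real (card (window m m)) * d \<le> e / 8" using e unfolding d_def by (simp add: field_simps)
      finally have "prob ?D \<le> e / 8 + e / 8" using m(2) by linarith
      moreover have "(\<Sum>S\<in>good m. prob (A n S)) = prob (\<Union>S\<in>good m. A n S)"
      proof (rule finite_measure_finite_Union[symmetric, OF fin])
        show "A n ` good m \<subseteq> events" using A_meas by auto
        show "disjoint_family_on (A n) (good m)"
        proof (unfold disjoint_family_on_def, intro ballI impI)
          fix S S' assume S: "S \<in> good m" "S' \<in> good m" "S \<noteq> S'"
          have eqS: "S = {c \<in> window m m. hit n m c \<omega>}" if "\<omega> \<in> A n S" "S \<in> good m" for \<omega> S
            using that sub[OF that(2)] by (auto simp: A_def)
          show "A n S \<inter> A n S' = {}" using eqS S by blast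
        qed
      qed
      moreover have "prob (\<Union>S\<in>good m. A n S) \<le> prob (?C \<union> ?D)"
      proof (rule finite_measure_mono)
        show "(\<Union>S\<in>good m. A n S) \<subseteq> ?C \<union> ?D"
        proof
          fix \<omega> assume "\<omega> \<in> (\<Union>S\<in>good m. A n S)"
          then obtain S where S: "S \<in> good m" "\<omega> \<in> A n S" by blast
          have sp: "\<omega> \<in> space M" using S by (simp add: A_def)
          show "\<omega> \<in> ?C \<union> ?D"
          proof (cases "\<omega> \<in> ?D")
            case False
            have "emeasure (config n (\<lambda>i. X i \<omega>)) (ecell \<gamma> m c) = of_bool (c \<in> S)" if c: "c \<in> window m m" for c
            proof (cases "c \<in> S")
              case True
              then have "hit n m c \<omega>" using S by (simp add: A_def)
              then show ?thesis using config_cell_single False c sp True by auto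
            next
              case nS: False
              then have "\<not> hit n m c \<omega>" using S c by (simp add: A_def)
              then show ?thesis using config_cell_empty nS by simp
            qed
            then have "config n (\<lambda>i. X i \<omega>) \<in> G"
              using S(1) config_radon[OF elim(3)] unfolding good_def by blast
            then show ?thesis using sp by simp
          qed simp
        qed
      qed (use C D in auto)
      moreover have "prob (?C \<union> ?D) \<le> prob ?C + prob ?D"
        using C D by (rule measure_subadditive) auto
      ultimately show ?case using weights elim(1) e by linarith
    qed
  qed
  moreover have "\<forall>\<^sub>F n in sequentially. (\<lambda>\<omega>. config n (\<lambda>i. X i \<omega>)) \<in> measurable M (borel_of (vague_topology upper_plane))"
    using eventually_ge_at_top[of 2] by eventually_elim (rule config_measurable)
  ultimately show ?thesis using N_meas
    by (intro converges_in_distributionI prob_space_axioms M')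
qed

end

theorem proposition4p5:
  fixes v l :: "real \<Rightarrow> real" and \<gamma> :: real
    and M :: "'a measure" and X :: "nat \<Rightarrow> 'a \<Rightarrow> real"
  assumes "\<gamma> > 0" and "regularly_varying \<gamma> v"
    and "\<And>t. t > 0 \<Longrightarrow> l t = t powr (- \<gamma>) * v t"
    and "\<And>\<epsilon> :: real \<Rightarrow> real. (\<forall>t>0. \<epsilon> t > 0) \<Longrightarrow> (\<epsilon> \<longlongrightarrow> 0) at_top \<Longrightarrow>
           ((\<lambda>t. ln t * (l ((1 + \<epsilon> t) * t) / l t - 1)) \<longlongrightarrow> 0) at_top"
    and "prob_space M"
    and "prob_space.indep_vars M (\<lambda>_. borel) X {1..}"
    and "\<And>i. i \<ge> 1 \<Longrightarrow> distributed M lborel (X i) (exponential_density 1)"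
  shows "(\<forall>(M' :: 'b measure) G E. prob_space M' \<and> prob_space.indep_var M' borel G borel E \<and>
            (\<forall>x. cdf (distr M' borel G) x = exp (- exp (- x))) \<and>
            distributed M' lborel E (exponential_density \<gamma>) \<longrightarrow>
            converges_in_distribution (euclidean :: (real \<times> real) topology) M
              (\<lambda>n \<omega>. (Mstar v X n \<omega> / v (real n) - beta \<gamma> n,
                      (real n - real (taustar v X n \<omega>)) / real n * ln (real n)))
              M' (\<lambda>\<omega>. (G \<omega>, E \<omega>))) \<and>
         (\<forall>(M' :: 'c measure) N. prob_space M' \<and>
            poisson_process upper_plane (mu_hat \<gamma>) M' N \<longrightarrow>
            converges_in_distribution (vague_topology upper_plane) M
              (\<lambda>n \<omega>. point_measure_of upper_plane {1..}
                 (\<lambda>i. (ereal (v (real i) * X i \<omega> / v (real n) - beta \<gamma> n),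
                       ereal ((real n - real i) / real n * ln (real n)))))
              M' N)"
proof -
  interpret prob_space M by fact
  have "\<And>t. t > 0 \<Longrightarrow> v t > 0" using assms(2) by (simp add: regularly_varying_def)
  then interpret weighted_exponentials v l \<gamma> M X
    using assms(1,3,4,6,7) by unfold_locales
  show ?thesis
  proof (intro conjI allI impI)
    fix M' :: "'b measure" and G E
    assume "prob_space M' \<and> prob_space.indep_var M' borel G borel E \<and>
      (\<forall>x. cdf (distr M' borel G) x = exp (- exp (- x))) \<and>
      distributed M' lborel E (exponential_density \<gamma>)"
    then show "converges_in_distribution (euclidean :: (real \<times> real) topology) M
        (\<lambda>n \<omega>. (Mstar v X n \<omega> / v (real n) - beta \<gamma> n,
                (real n - real (taustar v X n \<omega>)) / real n * ln (real n)))
        M' (\<lambda>\<omega>. (G \<omega>, E \<omega>))"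
      by (intro maximum_and_time_limit) auto
  next
    fix M' :: "'c measure" and N
    assume "prob_space M' \<and> poisson_process upper_plane (mu_hat \<gamma>) M' N"
    then have "converges_in_distribution (vague_topology upper_plane) M
        (\<lambda>n \<omega>. config n (\<lambda>i. X i \<omega>)) M' N"
      by (intro points_limit) auto
    then show "converges_in_distribution (vague_topology upper_plane) M
        (\<lambda>n \<omega>. point_measure_of upper_plane {1..}
           (\<lambda>i. (ereal (v (real i) * X i \<omega> / v (real n) - beta \<gamma> n),
                 ereal ((real n - real i) / real n * ln (real n)))))
        M' N"
      unfolding config_def plane_point_def[abs_def] height_def position_def .
  qed
qed

end
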